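(* There is an algorithm which, given as input a directed graph $D=(V,E)$ together with a set $S\subseteq V$ of sources and a set $Z\subseteq V$ of sinks representing a gammoid $M=(S,\mathcal{I})$ that is $k$-colorable, computes in time polynomial in the size of $D$ a partition $\mathcal{X}$ of $S$ such that the partition matroid $N$ represented by $\mathcal{X}$ is $(2k-2)$-colorable and is a reduction of $M$; that is, every part $X\in\mathcal{X}$ satisfies $|X|\le 2k-2$, and every set $Y\subseteq S$ with $|Y\cap X|\le 1$ for all $X\in\mathcal{X}$ is independent in $M$.
   Context: A set system $(S,\mathcal{I})$ consists of a finite universe $S$ and a family $\mathcal{I}\subseteq 2^S$ of independent sets. A $k$-coloring is a partition of $S$ into $k$ independent sets $C_1,\dots,C_k$; the system is $k$-colorable if a $k$-coloring exists, and its coloring number is the least such $k$. The gammoid represented by $(D,S,Z)$, where $D=(V,E)$ is a directed graph and $S,Z\subseteq V$, is the matroid on universe $S$ in which $I\subseteq S$ is independent if and only if there exist $|I|$ pairwise vertex-disjoint directed paths in $D$ from the vertices of $I$ to (distinct) vertices of $Z$. The partition matroid represented by a partition $\mathcal{X}$ of $S$ is the matroid on $S$ in which $Y\subseteq S$ is independent if and only if $|Y\cap X|\le 1$ for every $X\in\mathcal{X}$; it is $c$-colorable exactly when every part has at most $c$ elements. A matroid $N$ on the same universe as a matroid $M$ is a reduction of $M$ if every independent set of $N$ is independent in $M$; when $N$ is a partition matroid this is called a partition reduction from $M$ to $N$.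
   Formalization: The formal statement assumes k ≥ 2: for k = 1 the printed bound 2k−2 = 0 is false for every nonempty S (e.g. V = S = Z = {v}, E empty), and for empty S nothing is lost, since the system is then also 2-colorable. *)

theory Defs
  imports
    "HOL-Library.Disjoint_Sets"
    "HOL-Computational_Algebra.Polynomial"
    "Graph_Theory.Pair_Digraph"
    "Graph_Theory.Vertex_Walk"
begin

section \<open>Set systems, gammoids and partition matroids\<close>

text \<open>A set system is the pair of its universe and its family of independent sets.\<close>

type_synonym 'a set_system = "'a set \<times> 'a set set"

text \<open>The colour classes are indexed by \<open>0, \<dots>, k - 1\<close>; classes may be empty, so that
  \<open>k\<close>-colourability is monotone in \<open>k\<close> whenever the empty set is independent.\<close>

definition coloring :: "'a set_system \<Rightarrow> nat \<Rightarrow> (nat \<Rightarrow> 'a set) \<Rightarrow> bool" where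
  "coloring M k C \<longleftrightarrow>
     disjoint_family_on C {..<k} \<and> (\<Union>i<k. C i) = fst M \<and> (\<forall>i<k. C i \<in> snd M)"

definition colorable :: "'a set_system \<Rightarrow> nat \<Rightarrow> bool" where
  "colorable M k \<longleftrightarrow> (\<exists>C. coloring M k C)"

text \<open>\<open>p v\<close> is the path that starts in \<open>v\<close>.  A path may consist of a single vertex,
  so elements of \<open>S \<inter> Z\<close> are linked to themselves.\<close>

definition linked :: "'a pair_pre_digraph \<Rightarrow> 'a set \<Rightarrow> 'a set \<Rightarrow> bool" where
  "linked D I Z \<longleftrightarrow>
     (\<exists>p. (\<forall>v\<in>I. vpath (p v) (with_proj D) \<and> hd (p v) = v \<and> last (p v) \<in> Z) \<and>
          (\<forall>u\<in>I. \<forall>v\<in>I. u \<noteq> v \<longrightarrow> set (p u) \<inter> set (p v) = {}))"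

definition gammoid :: "'a pair_pre_digraph \<Rightarrow> 'a set \<Rightarrow> 'a set \<Rightarrow> 'a set_system" where
  "gammoid D S Z = (S, {I. I \<subseteq> S \<and> linked D I Z})"

definition partition_matroid :: "'a set \<Rightarrow> 'a set set \<Rightarrow> 'a set_system" where
  "partition_matroid S \<X> = (S, {Y. Y \<subseteq> S \<and> (\<forall>X\<in>\<X>. card (Y \<inter> X) \<le> 1)})"

definition is_reduction :: "'a set_system \<Rightarrow> 'a set_system \<Rightarrow> bool" where
  "is_reduction N M \<longleftrightarrow> fst N = fst M \<and> snd N \<subseteq> snd M"


section \<open>Model of computation\<close>

text \<open>
  Algorithms are programs of a first-order functional language (pure Lisp with recursive
  functions, call by value) whose only values are binary trees; cf. N. D. Jones,
  \<^emph>\<open>Computability and Complexity: From a Programming Perspective\<close>.  A program is the list of the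
  bodies of its functions.  Function names are positions in that list, variables are positions
  in the argument list of the current call, and function \<open>0\<close> is the main function.

  Every primitive operation has unit cost.  With values stored as shared pointer structures each
  of them takes constant time, and a computation of \<open>t\<close> steps allocates at most \<open>t\<close> new
  cells, so polynomial time here implies polynomial time on a Turing machine.  There is no
  primitive comparison of trees other than the test for \<open>Leaf\<close>.
\<close>

datatype data = Leaf | Node data data

fun left :: "data \<Rightarrow> data" where
  "left Leaf = Leaf"
| "left (Node a b) = a"

fun right :: "data \<Rightarrow> data" where
  "right Leaf = Leaf"
| "right (Node a b) = b"

datatype expr =
    EVar nat
  | ELeaf
  | ENode expr expr
  | ELeft expr
  | ERight expr
  | EIf expr expr expr
  | ECall nat "expr list"

type_synonym program = "expr list"

text \<open>\<open>eval P env e v t\<close>: in program \<open>P\<close> with arguments \<open>env\<close>, the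
  expression \<open>e\<close> evaluates to \<open>v\<close> in exactly \<open>t\<close> steps.  Every argument of a call costs
  at least one step, which also pays for passing it.\<close>

inductive
  eval :: "program \<Rightarrow> data list \<Rightarrow> expr \<Rightarrow> data \<Rightarrow> nat \<Rightarrow> bool" and
  evals :: "program \<Rightarrow> data list \<Rightarrow> expr list \<Rightarrow> data list \<Rightarrow> nat \<Rightarrow> bool"
  for P :: program
where
  eval_Var: "i < length env \<Longrightarrow> eval P env (EVar i) (env ! i) 1"
| eval_Leaf: "eval P env ELeaf Leaf 1"
| eval_Node: "eval P env a u s \<Longrightarrow> eval P env b v t \<Longrightarrow>
    eval P env (ENode a b) (Node u v) (s + t + 1)"
| eval_Left: "eval P env e v t \<Longrightarrow> eval P env (ELeft e) (left v) (t + 1)"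
| eval_Right: "eval P env e v t \<Longrightarrow> eval P env (ERight e) (right v) (t + 1)"
| eval_If_Node: "eval P env c u s \<Longrightarrow> u \<noteq> Leaf \<Longrightarrow> eval P env a v t \<Longrightarrow>
    eval P env (EIf c a b) v (s + t + 1)"
| eval_If_Leaf: "eval P env c Leaf s \<Longrightarrow> eval P env b v t \<Longrightarrow>
    eval P env (EIf c a b) v (s + t + 1)"
| eval_Call: "evals P env es vs s \<Longrightarrow> f < length P \<Longrightarrow> eval P vs (P ! f) v t \<Longrightarrow>
    eval P env (ECall f es) v (s + t + 1)"
| evals_Nil: "evals P env [] [] 0"
| evals_Cons: "eval P env e v s \<Longrightarrow> evals P env es vs t \<Longrightarrow>
    evals P env (e # es) (v # vs) (s + t)"

definition computes_in :: "program \<Rightarrow> data \<Rightarrow> data \<Rightarrow> nat \<Rightarrow> bool" where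
  "computes_in P x y t \<longleftrightarrow> eval P [x] (ECall 0 [EVar 0]) y t"

inductive_cases eval_elims:
  "eval P env (EVar i) v t"
  "eval P env ELeaf v t"
  "eval P env (ENode a b) v t"
  "eval P env (ELeft e) v t"
  "eval P env (ERight e) v t"
  "eval P env (EIf c a b) v t"
  "eval P env (ECall f es) v t"
  "evals P env [] vs t"
  "evals P env (e # es) vs t"

lemma eval_deterministic:
  "eval P env e v t \<Longrightarrow> eval P env e v' t' \<Longrightarrow> v' = v \<and> t' = t"
  "evals P env es vs s \<Longrightarrow> evals P env es vs' s' \<Longrightarrow> vs' = vs \<and> s' = s"
proof (induction arbitrary: v' t' and vs' s' rule: eval_evals.inducts)
  case eval_Var
  then show ?case by (auto elim: eval_elims(1))
next
  case eval_Leaf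
  then show ?case by (auto elim: eval_elims(2))
next
  case eval_Node
  from eval_Node.prems show ?case
    by (rule eval_elims(3)) (metis eval_Node Suc_eq_plus1)+
next
  case eval_Left
  from eval_Left.prems show ?case
    by (rule eval_elims(4)) (metis eval_Left Suc_eq_plus1)+
next
  case eval_Right
  from eval_Right.prems show ?case
    by (rule eval_elims(5)) (metis eval_Right Suc_eq_plus1)+
next
  case eval_If_Node
  from eval_If_Node.prems show ?case
    by (rule eval_elims(6)) (metis eval_If_Node Suc_eq_plus1)+
next
  case eval_If_Leaf
  from eval_If_Leaf.prems show ?case
    by (rule eval_elims(6)) (metis eval_If_Leaf Suc_eq_plus1)+
next
  case eval_Call
  from eval_Call.prems show ?case
    by (rule eval_elims(7)) (metis eval_Call Suc_eq_plus1)+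
next
  case evals_Nil
  then show ?case by (auto elim: eval_elims(8))
next
  case evals_Cons
  from evals_Cons.prems show ?case
    by (rule eval_elims(9)) (metis evals_Cons Suc_eq_plus1)+
qed

lemma computes_in_deterministic:
  "computes_in P x y t \<Longrightarrow> computes_in P x y' t' \<Longrightarrow> y' = y \<and> t' = t"
  unfolding computes_in_def by (rule eval_deterministic)


section \<open>Encoding of inputs and outputs\<close>

text \<open>Numbers are encoded in binary, least significant bit first.  The size of an encoding
  is measured by the datatype's own \<^const>\<open>size\<close>, i.e. the number of its \<open>Node\<close> cells.\<close>

fun enc_nat :: "nat \<Rightarrow> data" where
  "enc_nat n =
     (if n = 0 then Leaf
      else Node (if even n then Leaf else Node Leaf Leaf) (enc_nat (n div 2)))"

declare enc_nat.simps [simp del]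

fun enc_list :: "('a \<Rightarrow> data) \<Rightarrow> 'a list \<Rightarrow> data" where
  "enc_list enc [] = Leaf"
| "enc_list enc (x # xs) = Node (enc x) (enc_list enc xs)"

definition enc_arc :: "nat \<times> nat \<Rightarrow> data" where
  "enc_arc e = Node (enc_nat (fst e)) (enc_nat (snd e))"

text \<open>A finite set is given to a program as a list of its elements, in arbitrary order and
  without repetition.\<close>

definition lists_set :: "'a list \<Rightarrow> 'a set \<Rightarrow> bool" where
  "lists_set xs A \<longleftrightarrow> distinct xs \<and> set xs = A"

definition enc_digraph :: "nat list \<Rightarrow> (nat \<times> nat) list \<Rightarrow> data" where
  "enc_digraph vs es = Node (enc_list enc_nat vs) (enc_list enc_arc es)"

definition represents_digraph :: "data \<Rightarrow> nat pair_pre_digraph \<Rightarrow> bool" where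
  "represents_digraph d D \<longleftrightarrow>
     (\<exists>vs es. lists_set vs (pverts D) \<and> lists_set es (parcs D) \<and> d = enc_digraph vs es)"

definition represents_set :: "data \<Rightarrow> nat set \<Rightarrow> bool" where
  "represents_set d A \<longleftrightarrow> (\<exists>xs. lists_set xs A \<and> d = enc_list enc_nat xs)"

definition represents_family :: "data \<Rightarrow> nat set set \<Rightarrow> bool" where
  "represents_family d \<X> \<longleftrightarrow>
     (\<exists>xss. (\<forall>xs\<in>set xss. distinct xs) \<and> lists_set (map set xss) \<X> \<and>
            d = enc_list (enc_list enc_nat) xss)"

end

theory Submission
  imports Defs "HOL-Library.Multiset"
begin

text \<open>
  A set \<open>I\<close> is linked into \<open>Z\<close> iff there is an injection \<open>f\<close> from \<open>V - Z\<close> into \<open>V - I\<close> with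
  \<open>f v = v\<close> or \<open>(v, f v)\<close> an arc: follow the paths, and fix the vertices that lie on none.  So a
  \<open>k\<close>-colouring yields, by adding up \<open>k\<close> such injections, a bipartite weighting between the left
  vertices \<open>V - Z\<close> and the right vertices \<open>V\<close> in which every left vertex has degree \<open>k\<close>, every
  right vertex has degree at most \<open>k\<close>, and every element of \<open>S\<close> has degree at most \<open>k - 1\<close>.

  Right vertices are now merged into groups, a group with \<open>w\<close> elements of \<open>S\<close> having capacity
  \<open>k - w\<close>.  A left vertex \<open>l\<close> is removed either by merging two adjacent groups of positive
  capacity (so that at most \<open>2 (k - 1)\<close> elements of \<open>S\<close> come together), or together with one
  adjacent group that is disjoint from \<open>S\<close>.  In either case, if the previous left vertices can be
  matched so as to avoid any prescribed transversal of the groups, so can \<open>l\<close> in addition.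

  Such a step that keeps a weighting always exists.  Take a weighting of minimal support.  If \<open>l\<close>
  has one neighbour in the support, remove both; if it has two, merge them, which adds up their
  loads and saves \<open>k\<close>.  If all left vertices have at least three neighbours, some \<open>l\<close> has two
  neighbours used by no other left vertex, and merging these loses nothing that is needed; otherwise
  the support would contain a subgraph of minimum degree two, and a circulation on it would lead to
  a smaller support.

  The existence of a weighting is decided by an auction: a left vertex without a place bids for the
  cheapest adjacent slot and evicts its occupant, and every bid raises the price by one.  Thus the
  algorithm just tries all steps, and it tries \<open>k = 2, 3, \<dots>\<close> until a weighting exists.
\<close>

section \<open>Polynomial-time functions on encoded values\<close>

lemma poly_nat_mono: "m \<le> n \<Longrightarrow> poly (q :: nat poly) m \<le> poly q n"
  by (induction q) (auto intro!: add_mono mult_mono)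

text \<open>Functions are addressed by position, so a program placed after \<open>n\<close> other
  bodies must have all its call targets moved by \<open>n\<close>. This plays the role of a
  linker.\<close>

fun shift :: "nat \<Rightarrow> expr \<Rightarrow> expr" where
  "shift n (EVar i) = EVar i"
| "shift n ELeaf = ELeaf"
| "shift n (ENode a b) = ENode (shift n a) (shift n b)"
| "shift n (ELeft e) = ELeft (shift n e)"
| "shift n (ERight e) = ERight (shift n e)"
| "shift n (EIf c a b) = EIf (shift n c) (shift n a) (shift n b)"
| "shift n (ECall f es) = ECall (n + f) (map (shift n) es)"

text \<open>Only the call case looks at the program, and there the shifted index finds the shifted
  body whatever surrounds the block. Step counts are unchanged, so time bounds carry over to larger
  programs.\<close>

lemma eval_shift:
  "eval P env e v t \<Longrightarrow>
     eval (A @ map (shift (length A)) P @ B) env (shift (length A) e) v t"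
  "evals P env es vs t \<Longrightarrow>
     evals (A @ map (shift (length A)) P @ B) env (map (shift (length A)) es) vs t"
proof (induction rule: eval_evals.inducts)
  case (eval_Call env es vs s f v t)
  have "eval (A @ map (shift (length A)) P @ B) vs
          ((A @ map (shift (length A)) P @ B) ! (length A + f)) v t"
    using eval_Call by (simp add: nth_append)
  with eval_Call show ?case
    using eval_evals.eval_Call[of "A @ map (shift (length A)) P @ B" env "map (shift (length A)) es" vs s
      "length A + f" v t] by simp
qed (auto intro: eval_evals.intros simp del: One_nat_def)

text \<open>Evaluates a body without the surrounding call, so that costs compose;
  \<open>computes_in\<close> adds two steps for its call of function \<open>0\<close>.\<close>

definition runs :: "program \<Rightarrow> nat \<Rightarrow> data \<Rightarrow> data \<Rightarrow> nat \<Rightarrow> bool" where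
  "runs P f x y t \<longleftrightarrow> f < length P \<and> eval P [x] (P ! f) y t"

lemma runs_call: "eval P env e x s \<Longrightarrow> runs P f x y t \<Longrightarrow> eval P env (ECall f [e]) y (s + t + 1)"
  unfolding runs_def using eval_Call[of P env "[e]" "[x]" s f y t] evals_Cons[of P env e x s "[]" "[]" 0]
  by (auto intro: evals_Nil)

lemma runs_shift:
  assumes "runs P f x y t"
  shows "runs (A @ map (shift (length A)) P @ B) (length A + f) x y t"
  using assms eval_shift(1)[of P "[x]" "P ! f" y t A B] unfolding runs_def by (simp add: nth_append)

text \<open>The bound on the size of the result is not implied by the bound on the time, as values are
  measured as trees but built with sharing.\<close>

definition polytime :: "('a \<Rightarrow> data) \<Rightarrow> ('b \<Rightarrow> data) \<Rightarrow> ('a \<Rightarrow> 'b) \<Rightarrow> bool" where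
  "polytime ea eb f \<longleftrightarrow> (\<exists>P q. \<forall>a. \<exists>t. runs P 0 (ea a) (eb (f a)) t \<and>
     t \<le> poly q (size (ea a)) \<and> size (eb (f a)) \<le> poly q (size (ea a)))"

section \<open>Closure of polynomial time under composition, pairing, selection and
  comparison\<close>

lemma polytimeE:
  assumes "polytime ea eb f"
  obtains P q where "\<And>a. \<exists>t. runs P 0 (ea a) (eb (f a)) t \<and> t \<le> poly q (size (ea a))"
    "\<And>a. size (eb (f a)) \<le> poly q (size (ea a))"
  using assms unfolding polytime_def by metis

lemma polytimeI:
  assumes "\<And>a. \<exists>t\<le>poly q (size (ea a)). runs P 0 (ea a) (eb (f a)) t"
    "\<And>a. size (eb (f a)) \<le> poly q (size (ea a))"
  shows "polytime ea eb f"
  using assms unfolding polytime_def by metis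

lemma polytime_size:
  assumes "polytime ea eb f"
  obtains q where "\<And>a. size (eb (f a)) \<le> poly q (size (ea a))"
  using assms unfolding polytime_def by metis

text \<open>Meant for programs that consist of one expression without calls: a single constant
  \<open>c\<close> bounds both the steps and the growth of the result.\<close>

lemma polytime_prim:
  assumes "\<And>a. \<exists>t\<le>c. eval [e] [ea a] e (eb (f a)) t" "\<And>a. size (eb (f a)) \<le> size (ea a) + c"
  shows "polytime ea eb f"
  unfolding polytime_def runs_def using assms
  by (intro exI[of _ "[e]"] exI[of _ "[:c, 1:]"]) (force simp: add.commute intro: trans_le_add1)

lemma eval_quote: "\<exists>e t. \<forall>P env. eval P env e d t"
  by (induction d) (blast intro: eval_evals.intros)+

lemma polytime_const: "polytime ea eb (\<lambda>_. c)"
proof -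
  obtain e t where "\<And>P env. eval P env e (eb c) t" using eval_quote by blast
  then show ?thesis by (intro polytime_prim[where e = e and c = "max t (size (eb c))"]) (auto intro!: exI[of _ t])
qed

lemma eval_Var0: "eval P (x # xs) (EVar 0) x 1"
  using eval_Var[of 0 "x # xs" P] by simp

lemma polytime_id: "polytime ea ea (\<lambda>a. a)"
  by (rule polytime_prim[where e = "EVar 0" and c = 1]) (use eval_Var0 in auto)

lemma polytime_comp:
  assumes "polytime eb ec g" "polytime ea eb f"
  shows "polytime ea ec (\<lambda>a. g (f a))"
proof -
  obtain P p where P: "\<And>a. \<exists>t. runs P 0 (eb a) (ec (g a)) t \<and> t \<le> poly p (size (eb a))"
    "\<And>a. size (ec (g a)) \<le> poly p (size (eb a))" using polytimeE[OF assms(1)] by blast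
  obtain Q q where Q: "\<And>a. \<exists>t. runs Q 0 (ea a) (eb (f a)) t \<and> t \<le> poly q (size (ea a))"
    "\<And>a. size (eb (f a)) \<le> poly q (size (ea a))" using polytimeE[OF assms(2)] by blast
  \<comment> \<open>Layout of the combined program: the main body at \<open>0\<close>, the block of
    \<open>P\<close> from \<open>1\<close> on, the block of \<open>Q\<close> after it. The inner
    call runs \<open>Q\<close>.\<close>
  define m where "m = ECall 1 [ECall (1 + length P) [EVar 0]]"
  define P' where "P' = map (shift 1) P"
  define R where "R = m # P' @ map (shift (1 + length P)) Q"
  have len: "length P' = length P" by (simp add: P'_def)
  have R1: "runs R 1 x y t" if "runs P 0 x y t" for x y t
    using runs_shift[OF that, of "[m]" "map (shift (1 + length P)) Q"] by (simp add: R_def P'_def)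
  have R2: "runs R (1 + length P) x y t" if "runs Q 0 x y t" for x y t
    using runs_shift[OF that, of "m # P'" "[]"] by (simp add: R_def len)
  show ?thesis
  proof (rule polytimeI)
    fix a
    obtain t where t: "runs Q 0 (ea a) (eb (f a)) t" "t \<le> poly q (size (ea a))" using Q by blast
    obtain s where s: "runs P 0 (eb (f a)) (ec (g (f a))) s" "s \<le> poly p (size (eb (f a)))" using P by blast
    have *: "poly p (size (eb (f a))) \<le> poly p (poly q (size (ea a)))" by (rule poly_nat_mono[OF Q(2)])
    have "eval R [ea a] m (ec (g (f a))) ((1 + t + 1) + s + 1)"
      unfolding m_def by (intro runs_call[OF runs_call[OF eval_Var0 R2[OF t(1)]] R1[OF s(1)]])
    then show "\<exists>t\<le>poly (pcompose p q + q + [:3:]) (size (ea a)). runs R 0 (ea a) (ec (g (f a))) t"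
      using t(2) s(2) * by (intro exI[of _ "(1 + t + 1) + s + 1"]) (simp add: runs_def R_def poly_pcompose)
    show "size (ec (g (f a))) \<le> poly (pcompose p q + q + [:3:]) (size (ea a))"
      using * P(2)[of "f a"] by (simp add: poly_pcompose)
  qed
qed

definition enc_prod :: "('a \<Rightarrow> data) \<Rightarrow> ('b \<Rightarrow> data) \<Rightarrow> 'a \<times> 'b \<Rightarrow> data" where
  "enc_prod ea eb p = Node (ea (fst p)) (eb (snd p))"

definition enc_bool :: "bool \<Rightarrow> data" where
  "enc_bool b = (if b then Node Leaf Leaf else Leaf)"

lemma size_enc_prod [simp]: "size (enc_prod ea eb p) = size (ea (fst p)) + size (eb (snd p)) + 1"
  by (simp add: enc_prod_def)

lemma polytime_pair:
  assumes "polytime ea eb f" "polytime ea ec g"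
  shows "polytime ea (enc_prod eb ec) (\<lambda>a. (f a, g a))"
proof -
  obtain P p where P: "\<And>a. \<exists>t. runs P 0 (ea a) (eb (f a)) t \<and> t \<le> poly p (size (ea a))"
    "\<And>a. size (eb (f a)) \<le> poly p (size (ea a))" using polytimeE[OF assms(1)] by blast
  obtain Q q where Q: "\<And>a. \<exists>t. runs Q 0 (ea a) (ec (g a)) t \<and> t \<le> poly q (size (ea a))"
    "\<And>a. size (ec (g a)) \<le> poly q (size (ea a))" using polytimeE[OF assms(2)] by blast
  define m where "m = ENode (ECall 1 [EVar 0]) (ECall (1 + length P) [EVar 0])"
  define P' where "P' = map (shift 1) P"
  define R where "R = m # P' @ map (shift (1 + length P)) Q"
  have len: "length P' = length P" by (simp add: P'_def)
  have R1: "runs R 1 x y t" if "runs P 0 x y t" for x y t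
    using runs_shift[OF that, of "[m]" "map (shift (1 + length P)) Q"] by (simp add: R_def P'_def)
  have R2: "runs R (1 + length P) x y t" if "runs Q 0 x y t" for x y t
    using runs_shift[OF that, of "m # P'" "[]"] by (simp add: R_def len)
  show ?thesis
  proof (rule polytimeI)
    fix a
    obtain t where t: "runs Q 0 (ea a) (ec (g a)) t" "t \<le> poly q (size (ea a))" using Q by blast
    obtain s where s: "runs P 0 (ea a) (eb (f a)) s" "s \<le> poly p (size (ea a))" using P by blast
    have "eval R [ea a] m (Node (eb (f a)) (ec (g a))) ((1 + s + 1) + (1 + t + 1) + 1)"
      unfolding m_def by (intro eval_Node runs_call[OF eval_Var0] R1[OF s(1)] R2[OF t(1)])
    then show "\<exists>t\<le>poly (p + q + [:5:]) (size (ea a)). runs R 0 (ea a) (enc_prod eb ec (f a, g a)) t"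
      using t(2) s(2) by (intro exI[of _ "(1 + s + 1) + (1 + t + 1) + 1"]) (simp add: runs_def R_def enc_prod_def)
    show "size (enc_prod eb ec (f a, g a)) \<le> poly (p + q + [:5:]) (size (ea a))"
      using P(2)[of a] Q(2)[of a] by simp
  qed
qed

lemma polytime_fst:
  assumes "polytime ee (enc_prod ea eb) f" shows "polytime ee ea (\<lambda>e. fst (f e))"
proof -
  have "eval P [enc_prod ea eb p] (ELeft (EVar 0)) (ea (fst p)) 2" for P p
    using eval_Left[OF eval_Var0, of P "enc_prod ea eb p" "[]"] by (simp add: enc_prod_def numeral_2_eq_2)
  then have "polytime (enc_prod ea eb) ea fst"
    by (intro polytime_prim[where e = "ELeft (EVar 0)" and c = 2]) auto
  from polytime_comp[OF this assms] show ?thesis .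
qed

lemma polytime_snd:
  assumes "polytime ee (enc_prod ea eb) f" shows "polytime ee eb (\<lambda>e. snd (f e))"
proof -
  have "eval P [enc_prod ea eb p] (ERight (EVar 0)) (eb (snd p)) 2" for P p
    using eval_Right[OF eval_Var0, of P "enc_prod ea eb p" "[]"] by (simp add: enc_prod_def numeral_2_eq_2)
  then have "polytime (enc_prod ea eb) eb snd"
    by (intro polytime_prim[where e = "ERight (EVar 0)" and c = 2]) auto
  from polytime_comp[OF this assms] show ?thesis .
qed

text \<open>Both branches are computed and packed into a triple before one is selected, so both
  functions must be polynomial on every input.\<close>

lemma polytime_if:
  assumes "polytime ee enc_bool c" "polytime ee ea f" "polytime ee ea g"
  shows "polytime ee ea (\<lambda>e. if c e then f e else g e)"
proof -
  have "polytime (enc_prod enc_bool (enc_prod ea ea)) ea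
          (\<lambda>p. if fst p then fst (snd p) else snd (snd p))" (is "polytime ?e _ ?f")
  proof (rule polytime_prim[where c = 10 and
        e = "EIf (ELeft (EVar 0)) (ELeft (ERight (EVar 0))) (ERight (ERight (EVar 0)))"])
    fix p :: "bool \<times> 'b \<times> 'b"
    obtain b x y where p: "p = (b, x, y)" by (cases p)
    let ?E = "EIf (ELeft (EVar 0)) (ELeft (ERight (EVar 0))) (ERight (ERight (EVar 0)))"
    have 1: "eval [?E] [?e p] (ELeft (EVar 0)) (enc_bool b) 2"
      using eval_Left[OF eval_Var0, of "[?E]" "?e p" "[]"] by (simp add: enc_prod_def p numeral_2_eq_2)
    have 2: "eval [?E] [?e p] (ELeft (ERight (EVar 0))) (ea x) 3"
      using eval_Left[OF eval_Right[OF eval_Var0], of "[?E]" "?e p" "[]"]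
      by (simp add: enc_prod_def p numeral_3_eq_3)
    have 3: "eval [?E] [?e p] (ERight (ERight (EVar 0))) (ea y) 3"
      using eval_Right[OF eval_Right[OF eval_Var0], of "[?E]" "?e p" "[]"]
      by (simp add: enc_prod_def p numeral_3_eq_3)
    show "\<exists>t\<le>10. eval [?E] [?e p] ?E (ea (?f p)) t"
    proof (cases b)
      case True
      then have "eval [?E] [?e p] ?E (ea x) (2 + 3 + 1)"
        by (intro eval_If_Node[OF 1 _ 2]) (simp add: enc_bool_def)
      then show ?thesis by (intro exI[of _ "2 + 3 + 1"]) (simp add: p True)
    next
      case False
      then have "eval [?E] [?e p] ?E (ea y) (2 + 3 + 1)"
        using 1 by (intro eval_If_Leaf[OF _ 3]) (simp add: enc_bool_def)
      then show ?thesis by (intro exI[of _ "2 + 3 + 1"]) (simp add: p False)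
    qed
  qed auto
  from polytime_comp[OF this polytime_pair[OF assms(1) polytime_pair[OF assms(2,3)]]]
  show ?thesis by (simp only: fst_conv snd_conv)
qed

text \<open>A nonempty list has the same encoding as the pair of its head and tail, so the program
  is the identity after pairing.\<close>

lemma polytime_Cons:
  assumes "polytime ee ex x" "polytime ee (enc_list ex) xs"
  shows "polytime ee (enc_list ex) (\<lambda>e. x e # xs e)"
proof -
  have "polytime (enc_prod ex (enc_list ex)) (enc_list ex) (\<lambda>p. fst p # snd p)"
    by (rule polytime_prim[where e = "EVar 0" and c = 1]) (use eval_Var0 in \<open>force simp: enc_prod_def\<close>)+
  from polytime_comp[OF this polytime_pair[OF assms]] show ?thesis by simp
qed

lemma polytime_tl:
  assumes "polytime ee (enc_list ex) xs" shows "polytime ee (enc_list ex) (\<lambda>e. tl (xs e))"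
proof -
  have 1: "eval P [enc_list ex xs] (ERight (EVar 0)) (enc_list ex (tl xs)) 2" for P xs
    using eval_Right[OF eval_Var0, of P "enc_list ex xs" "[]"] by (cases xs) (auto simp: numeral_2_eq_2)
  have 2: "size (enc_list ex (tl xs)) \<le> size (enc_list ex xs) + 2" for xs by (cases xs) auto
  have "polytime (enc_list ex) (enc_list ex) tl"
    by (rule polytime_prim[where e = "ERight (EVar 0)" and c = 2]) (use 1 2 in auto)
  from polytime_comp[OF this assms] show ?thesis .
qed

lemma polytime_null:
  assumes "polytime ee (enc_list ex) xs" shows "polytime ee enc_bool (\<lambda>e. xs e = [])"
proof -
  have "polytime (enc_list ex) enc_bool (\<lambda>xs. xs = [])"
  proof (rule polytime_prim[where e = "EIf (EVar 0) ELeaf (ENode ELeaf ELeaf)" and c = 10])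
    fix xs
    let ?e = "EIf (EVar 0) ELeaf (ENode ELeaf ELeaf)"
    show "\<exists>t\<le>10. eval [?e] [enc_list ex xs] ?e (enc_bool (xs = [])) t"
    proof (cases xs)
      case Nil
      have 1: "eval P [enc_list ex xs] (EVar 0) Leaf 1" for P
        using eval_Var0[of P Leaf] by (simp add: Nil)
      have "eval [?e] [enc_list ex xs] ?e (Node Leaf Leaf) (1 + (1 + 1 + 1) + 1)"
        by (rule eval_If_Leaf[OF 1 eval_Node[OF eval_Leaf eval_Leaf]])
      then show ?thesis by (intro exI[of _ "1 + (1 + 1 + 1) + 1"]) (simp add: Nil enc_bool_def)
    next
      case (Cons y ys)
      have "eval [?e] [enc_list ex xs] ?e Leaf (1 + 1 + 1)"
        by (rule eval_If_Node[OF eval_Var0 _ eval_Leaf]) (simp add: Cons)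
      then show ?thesis by (intro exI[of _ "1 + 1 + 1"]) (simp add: Cons enc_bool_def)
    qed
  qed (auto simp: enc_bool_def)
  from polytime_comp[OF this assms] show ?thesis by simp
qed

text \<open>Trees can only be tested for \<open>Leaf\<close>, so equality is decided by a recursive
  program on pairs of encodings; injectivity transfers the answer to the values.\<close>

lemma polytime_eq:
  fixes ea :: "'b \<Rightarrow> data"
  assumes "inj ea" "polytime ee ea f" "polytime ee ea g"
  shows "polytime ee enc_bool (\<lambda>e. f e = g e)"
proof -
  define A where "A = ELeft (EVar 0)"
  define B where "B = ERight (EVar 0)"
  define m where "m = EIf A (EIf B (EIf (ECall 0 [ENode (ELeft A) (ELeft B)])
     (ECall 0 [ENode (ERight A) (ERight B)]) ELeaf) ELeaf) (EIf B ELeaf (ENode ELeaf ELeaf))"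
  have A: "eval [m] [Node a b] A a 2" and B: "eval [m] [Node a b] B b 2" for a b
    using eval_Left[OF eval_Var0, of "[m]" "Node a b" "[]"] eval_Right[OF eval_Var0, of "[m]" "Node a b" "[]"]
    by (auto simp: A_def B_def numeral_2_eq_2)
  \<comment> \<open>The recursion descends both trees in parallel, hence the time is linear in the
    first tree.\<close>
  have main: "\<exists>t\<le>50 * size a + 20. runs [m] 0 (Node a b) (enc_bool (a = b)) t" for a b
  proof (induction a arbitrary: b)
    case Leaf
    show ?case
    proof (cases b)
      case Leaf
      have "eval [m] [Node Leaf b] m (Node Leaf Leaf) (2 + (2 + (1 + 1 + 1) + 1) + 1)"
        unfolding m_def
        by (intro eval_If_Leaf eval_Node eval_Leaf; (fold m_def)?; use A B Leaf in metis)
      then show ?thesis by (intro exI[of _ "2 + (2 + (1 + 1 + 1) + 1) + 1"]) (simp add: runs_def Leaf enc_bool_def)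
    next
      case (Node b1 b2)
      have "eval [m] [Node Leaf b] m Leaf (2 + (2 + 1 + 1) + 1)"
        unfolding m_def
        by (rule eval_If_Leaf, fold m_def, rule A, rule eval_If_Node, rule B, simp add: Node, rule eval_Leaf)
      then show ?thesis by (intro exI[of _ "2 + (2 + 1 + 1) + 1"]) (simp add: runs_def Node enc_bool_def)
    qed
  next
    case (Node a1 a2)
    show ?case
    proof (cases b)
      case Leaf
      have "eval [m] [Node (Node a1 a2) b] m Leaf (2 + (2 + 1 + 1) + 1)"
        unfolding m_def
        by (rule eval_If_Node, fold m_def, rule A, simp, rule eval_If_Leaf, use B Leaf in metis, rule eval_Leaf)
      then show ?thesis by (intro exI[of _ "2 + (2 + 1 + 1) + 1"]) (simp add: runs_def Leaf enc_bool_def)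
    next
      case b: (Node b1 b2)
      obtain t1 where t1: "t1 \<le> 50 * size a1 + 20" "runs [m] 0 (Node a1 b1) (enc_bool (a1 = b1)) t1"
        using Node.IH(1) by blast
      obtain t2 where t2: "t2 \<le> 50 * size a2 + 20" "runs [m] 0 (Node a2 b2) (enc_bool (a2 = b2)) t2"
        using Node.IH(2) by blast
      let ?env = "[Node (Node a1 a2) b]"
      have L: "eval [m] ?env (ENode (ELeft A) (ELeft B)) (Node a1 b1) ((2 + 1) + (2 + 1) + 1)"
        using eval_Node[OF eval_Left[OF A] eval_Left[OF B], of "Node a1 a2" b] by (simp add: b)
      have R: "eval [m] ?env (ENode (ERight A) (ERight B)) (Node a2 b2) ((2 + 1) + (2 + 1) + 1)"
        using eval_Node[OF eval_Right[OF A] eval_Right[OF B], of "Node a1 a2" b] by (simp add: b)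
      note C1 = runs_call[OF L t1(2)] and C2 = runs_call[OF R t2(2)]
      let ?E = "EIf (ECall 0 [ENode (ELeft A) (ELeft B)]) (ECall 0 [ENode (ERight A) (ERight B)]) ELeaf"
      have "\<exists>t\<le>t1 + t2 + 20. eval [m] ?env ?E (enc_bool (Node a1 a2 = b)) t"
      proof (cases "a1 = b1")
        case True
        show ?thesis
          by (rule exI, rule conjI[rotated], rule eval_If_Node[OF C1 _ ], simp add: True enc_bool_def,
              use C2 in \<open>simp add: b True\<close>) simp
      next
        case False
        show ?thesis
          by (rule exI, rule conjI[rotated], rule eval_If_Leaf[OF C1[simplified False enc_bool_def if_False]])
            (use eval_Leaf in \<open>auto simp: b False enc_bool_def\<close>)
      qed
      then obtain t where t: "t \<le> t1 + t2 + 20" "eval [m] ?env ?E (enc_bool (Node a1 a2 = b)) t" by blast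
      have "eval [m] ?env m (enc_bool (Node a1 a2 = b)) (2 + (2 + t + 1) + 1)"
        apply (subst (2) m_def)
        by (rule eval_If_Node, rule A, simp, rule eval_If_Node, rule B, simp add: b, rule t(2))
      then show ?thesis using t(1) t1(1) t2(1)
        by (intro exI[of _ "2 + (2 + t + 1) + 1"]) (auto simp add: runs_def)
    qed
  qed
  have "polytime (enc_prod ea ea) enc_bool (\<lambda>p. fst p = snd p)"
  proof (rule polytimeI)
    fix p :: "'b \<times> 'b"
    have "ea (fst p) = ea (snd p) \<longleftrightarrow> fst p = snd p" using assms(1) by (auto dest: injD)
    then obtain t where "t \<le> 50 * size (ea (fst p)) + 20"
      "runs [m] 0 (enc_prod ea ea p) (enc_bool (fst p = snd p)) t"
      using main[of "ea (fst p)" "ea (snd p)"] unfolding enc_prod_def by auto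
    then show "\<exists>t\<le>poly [:20, 50:] (size (enc_prod ea ea p)). runs [m] 0 (enc_prod ea ea p) (enc_bool (fst p = snd p)) t"
      by (intro exI[of _ t]) auto
  qed (auto simp: enc_bool_def)
  from polytime_comp[OF this polytime_pair[OF assms(2,3)]] show ?thesis by simp
qed

section \<open>Bounded recursion over lists\<close>

lemma size_enc_list_append [simp]:
  "size (enc_list ex (xs @ ys)) = size (enc_list ex xs) + size (enc_list ex ys)"
  by (induction xs) auto

lemma size_enc_list_mem: "x \<in> set xs \<Longrightarrow> size (ex x) < size (enc_list ex xs)"
  by (induction xs) auto

lemma length_le_size_enc_list: "length xs \<le> size (enc_list ex xs)"
  by (induction xs) auto

text \<open>Composing size polynomials once per list element would give no polynomial bound.
  Hypothesis \<open>b\<close> therefore bounds every intermediate accumulator; the folds over the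
  suffixes \<open>drop n\<close> are exactly these.\<close>

lemma polytime_foldr_bound:
  fixes g :: "'e \<Rightarrow> 'x \<Rightarrow> 'a \<Rightarrow> 'a"
  assumes "polytime ee (enc_list ex) xs" "polytime ee ea init"
    "polytime (enc_prod ee (enc_prod ex ea)) ea (\<lambda>p. g (fst p) (fst (snd p)) (snd (snd p)))"
    and b: "\<And>e n. size (ea (foldr (g e) (drop n (xs e)) (init e))) \<le> poly b (size (ee e))"
  shows "polytime ee ea (\<lambda>e. foldr (g e) (xs e) (init e))"
proof -
  let ?eh = "enc_prod ee (enc_prod ea (enc_list ex))" and ?h = "\<lambda>e. (e, init e, xs e)"
  let ?eg = "enc_prod ee (enc_prod ex ea)"
  have h: "polytime ee ?eh ?h" by (rule polytime_pair[OF polytime_id polytime_pair[OF assms(2,1)]])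
  obtain P p where P: "\<And>e. \<exists>t. runs P 0 (ee e) (?eh (?h e)) t \<and> t \<le> poly p (size (ee e))"
    "\<And>e. size (?eh (?h e)) \<le> poly p (size (ee e))" by (rule polytimeE[OF h], rule that)
  obtain Q q where Q: "\<And>a. \<exists>t. runs Q 0 (?eg a) (ea (g (fst a) (fst (snd a)) (snd (snd a)))) t
      \<and> t \<le> poly q (size (?eg a))" by (rule polytimeE[OF assms(3)], rule that)
  \<comment> \<open>The main body sits at position \<open>0\<close>, the loop at \<open>1\<close>,
    the preparation \<open>P\<close> of its argument at \<open>2\<close> and the body
    \<open>Q\<close> of the fold at \<open>G\<close>.\<close>
  define m where "m = ECall 1 [ECall 2 [EVar 0]]"
  define G where "G = 2 + length P"
  define E where "E = ELeft (EVar 0)"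
  define I where "I = ELeft (ERight (EVar 0))"
  define L where "L = ERight (ERight (EVar 0))"
  \<comment> \<open>The argument is a triple of environment, initial value and remaining list. The
    recursive call on the tail is an argument of the call of \<open>G\<close>, as in a right
    fold.\<close>
  define loop where "loop = EIf L (ECall G [ENode E (ENode (ELeft L) (ECall 1 [ENode E (ENode I (ERight L))]))]) I"
  define P' where "P' = map (shift 2) P"
  define R where "R = m # loop # P' @ map (shift G) Q"
  have len: "length P' = length P" by (simp add: P'_def)
  have R2: "runs R 2 x y t" if "runs P 0 x y t" for x y t
    using runs_shift[OF that, of "[m, loop]" "map (shift G) Q"] by (simp add: R_def P'_def numeral_2_eq_2)
  have RG: "runs R G x y t" if "runs Q 0 x y t" for x y t
    using runs_shift[OF that, of "m # loop # P'" "[]"] by (simp add: R_def len G_def)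
  have E: "eval R [Node u (Node v w)] E u 2" for u v w
    using eval_Left[OF eval_Var0, of R "Node u (Node v w)" "[]"] by (simp add: E_def numeral_2_eq_2)
  have I: "eval R [Node u (Node v w)] I v 3" for u v w
    using eval_Left[OF eval_Right[OF eval_Var0], of R "Node u (Node v w)" "[]"]
    by (simp add: I_def numeral_3_eq_3)
  have L: "eval R [Node u (Node v w)] L w 3" for u v w
    using eval_Right[OF eval_Right[OF eval_Var0], of R "Node u (Node v w)" "[]"]
    by (simp add: L_def numeral_3_eq_3)
  have loop: "\<exists>t. runs R 1 (Node (ee e) (Node (ea a) (enc_list ex ys))) (ea (foldr (g e) ys a)) t \<and>
      t \<le> length ys * (poly q (size (ee e) + size (enc_list ex ys) + B + 2) + 40) + 40"
    if "\<And>n. size (ea (foldr (g e) (drop n ys) a)) \<le> B" for e a ys B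
    using that
  proof (induction ys)
    case Nil
    have "eval R [Node (ee e) (Node (ea a) (enc_list ex []))] loop (ea a) (3 + 3 + 1)"
      unfolding loop_def using L[of "ee e" "ea a" Leaf] I[of "ee e" "ea a" Leaf]
      by (intro eval_If_Leaf) auto
    then show ?case by (intro exI[of _ "3 + 3 + 1"]) (simp add: runs_def R_def)
  next
    case (Cons y ys)
    let ?K = "\<lambda>ys. poly q (size (ee e) + size (enc_list ex ys) + B + 2)"
    have K: "?K ys \<le> ?K (y # ys)" by (rule poly_nat_mono) simp
    have B: "size (ea (foldr (g e) (drop n ys) a)) \<le> B" for n using Cons.prems[of "Suc n"] by simp
    let ?r = "foldr (g e) ys a"
    obtain t where t: "runs R 1 (Node (ee e) (Node (ea a) (enc_list ex ys))) (ea ?r) t"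
      "t \<le> length ys * (?K ys + 40) + 40" using Cons.IH[OF B] by blast
    obtain s where s: "runs Q 0 (?eg (e, y, ?r)) (ea (g e y ?r)) s" "s \<le> poly q (size (?eg (e, y, ?r)))"
      using Q[of "(e, y, ?r)"] by auto
    have "poly q (size (?eg (e, y, ?r))) \<le> ?K (y # ys)"
      using B[of 0] by (intro poly_nat_mono) simp
    with s have s': "s \<le> ?K (y # ys)" by simp
    let ?env = "[Node (ee e) (Node (ea a) (enc_list ex (y # ys)))]"
    have l1: "eval R ?env (ELeft L) (ex y) (3 + 1)" and l2: "eval R ?env (ERight L) (enc_list ex ys) (3 + 1)"
      using eval_Left[OF L, of "ee e" "ea a" "enc_list ex (y # ys)"]
       eval_Right[OF L, of "ee e" "ea a" "enc_list ex (y # ys)"] by auto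
    have "eval R ?env (ECall 1 [ENode E (ENode I (ERight L))]) (ea ?r)
        ((2 + (3 + (3 + 1) + 1) + 1) + t + 1)"
      by (intro runs_call[OF _ t(1)] eval_Node E I l2)
    then have "eval R ?env (ENode E (ENode (ELeft L) (ECall 1 [ENode E (ENode I (ERight L))])))
       (?eg (e, y, ?r)) (2 + ((3 + 1) + ((2 + (3 + (3 + 1) + 1) + 1) + t + 1) + 1) + 1)"
      unfolding enc_prod_def fst_conv snd_conv by (intro eval_Node E l1)
    from runs_call[OF this RG[OF s(1)]]
    have "eval R ?env loop (ea (g e y ?r))
      (3 + (2 + ((3 + 1) + ((2 + (3 + (3 + 1) + 1) + 1) + t + 1) + 1) + 1 + s + 1) + 1)"
      unfolding loop_def by (intro eval_If_Node[OF L]) auto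
    moreover have "3 + (2 + ((3 + 1) + ((2 + (3 + (3 + 1) + 1) + 1) + t + 1) + 1) + 1 + s + 1) + 1 = t + s + 25"
      by simp
    ultimately have "eval R ?env loop (ea (g e y ?r)) (t + s + 25)" by metis
    then have f: "runs R 1 (Node (ee e) (Node (ea a) (enc_list ex (y # ys)))) (ea (g e y ?r)) (t + s + 25)"
      by (simp add: runs_def R_def)
    have "length ys * (?K ys + 40) \<le> length ys * (?K (y # ys) + 40)" using K by simp
    moreover have "length (y # ys) * (?K (y # ys) + 40) = ?K (y # ys) + 40 + length ys * (?K (y # ys) + 40)"
      by simp
    ultimately have "t + s + 25 \<le> length (y # ys) * (?K (y # ys) + 40) + 40" using t(2) s' by linarith
    with f show ?case by auto
  qed
  define c where "c = p + p * (pcompose q ([:2, 1:] + b + p) + [:40:]) + [:50:] + b"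
  show ?thesis
  proof (rule polytimeI)
    fix e
    obtain t where t: "runs P 0 (ee e) (Node (ee e) (Node (ea (init e)) (enc_list ex (xs e)))) t"
      "t \<le> poly p (size (ee e))" using P(1)[of e] by (auto simp: enc_prod_def)
    let ?K = "poly q (size (ee e) + size (enc_list ex (xs e)) + poly b (size (ee e)) + 2)"
    obtain s where s: "runs R 1 (Node (ee e) (Node (ea (init e)) (enc_list ex (xs e)))) (ea (foldr (g e) (xs e) (init e))) s"
      "s \<le> length (xs e) * (?K + 40) + 40"
      using loop[of e "xs e" "init e", OF b] by blast
    have xs: "size (enc_list ex (xs e)) \<le> poly p (size (ee e))" using P(2)[of e] by simp
    have "?K \<le> poly (pcompose q ([:2, 1:] + b + p)) (size (ee e))"
      unfolding poly_pcompose using xs by (intro poly_nat_mono) simp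
    then have "length (xs e) * (?K + 40) \<le> poly p (size (ee e)) * (poly (pcompose q ([:2, 1:] + b + p)) (size (ee e)) + 40)"
      using xs length_le_size_enc_list[of "xs e" ex] by (intro mult_mono) auto
    then have le: "(1 + t + 1) + s + 1 \<le> poly c (size (ee e))"
      using t(2) s(2) by (simp add: c_def)
    have "eval R [ee e] m (ea (foldr (g e) (xs e) (init e))) ((1 + t + 1) + s + 1)"
      unfolding m_def by (intro runs_call[OF runs_call[OF eval_Var0 R2[OF t(1)]] s(1)])
    then have "runs R 0 (ee e) (ea (foldr (g e) (xs e) (init e))) ((1 + t + 1) + s + 1)"
      by (simp add: runs_def R_def)
    with le show "\<exists>t\<le>poly c (size (ee e)). runs R 0 (ee e) (ea (foldr (g e) (xs e) (init e))) t"
      by blast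
    show "size (ea (foldr (g e) (xs e) (init e))) \<le> poly c (size (ee e))"
      using b[of e 0] by (simp add: c_def)
  qed
qed

text \<open>Additive growth per element suffices, as the list has polynomial length. The invariant
  \<open>Inv\<close> restricts the growth condition to accumulators with a preserved
  property.\<close>

lemma polytime_foldr:
  fixes g :: "'e \<Rightarrow> 'x \<Rightarrow> 'a \<Rightarrow> 'a"
  assumes xs: "polytime ee (enc_list ex) xs" and init: "polytime ee ea init"
    and g: "polytime (enc_prod ee (enc_prod ex ea)) ea (\<lambda>p. g (fst p) (fst (snd p)) (snd (snd p)))"
    and I: "\<And>e. Inv e (init e)" "\<And>e x a. x \<in> set (xs e) \<Longrightarrow> Inv e a \<Longrightarrow> Inv e (g e x a)"
    and b: "\<And>e x a. x \<in> set (xs e) \<Longrightarrow> Inv e a \<Longrightarrow> size (ea (g e x a)) \<le> size (ea a) + poly b (size (ee e))"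
  shows "polytime ee ea (\<lambda>e. foldr (g e) (xs e) (init e))"
proof -
  obtain p where p: "\<And>e. size (enc_list ex (xs e)) \<le> poly p (size (ee e))" using polytime_size[OF xs] by blast
  obtain q where q: "\<And>e. size (ea (init e)) \<le> poly q (size (ee e))" using polytime_size[OF init] by blast
  have *: "Inv e (foldr (g e) ys (init e)) \<and>
      size (ea (foldr (g e) ys (init e))) \<le> size (ea (init e)) + length ys * poly b (size (ee e))"
    if "set ys \<subseteq> set (xs e)" for e ys
    using that
  proof (induction ys)
    case Nil
    then show ?case using I by simp
  next
    case (Cons y ys)
    then show ?case using I(2)[of y e] b[of y e "foldr (g e) ys (init e)"] by simp
  qed
  show ?thesis
  proof (rule polytime_foldr_bound[OF xs init g])
    fix e n
    have "length (drop n (xs e)) \<le> poly p (size (ee e))"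
      using p[of e] length_le_size_enc_list[of "xs e" ex] by simp
    then have "length (drop n (xs e)) * poly b (size (ee e)) \<le> poly (p * b) (size (ee e))"
      unfolding poly_mult by (intro mult_mono) auto
    then show "size (ea (foldr (g e) (drop n (xs e)) (init e))) \<le> poly (q + p * b) (size (ee e))"
      using *[of "drop n (xs e)" e] q[of e] set_drop_subset[of n "xs e"] unfolding poly_add by linarith
  qed
qed

lemma polytime_case_list:
  assumes xs: "polytime ee (enc_list ex) xs" and A: "polytime ee ea A"
    and B: "polytime (enc_prod ee (enc_prod ex (enc_list ex))) ea (\<lambda>p. B (fst p) (fst (snd p)) (snd (snd p)))"
  shows "polytime ee ea (\<lambda>e. case xs e of [] \<Rightarrow> A e | x # r \<Rightarrow> B e x r)"
proof -
  obtain p where p: "\<And>e. size (enc_list ex (xs e)) \<le> poly p (size (ee e))" using polytime_size[OF xs] by blast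
  let ?eb = "enc_prod ee (enc_prod ex (enc_list ex))"
  obtain q where q: "\<And>b. size (ea (B (fst b) (fst (snd b)) (snd (snd b)))) \<le> poly q (size (?eb b))"
    by (rule polytime_size[OF B], rule that)
  have tl: "size (enc_list ex (tl ys)) \<le> size (enc_list ex ys)" for ys by (cases ys) auto
  \<comment> \<open>A fold that ignores its accumulator returns the value for the head; unlike an evaluation of both
    branches of a conditional, it applies \<open>B\<close> to well-formed encodings only.\<close>
  have "polytime ee ea (\<lambda>e. foldr (\<lambda>x _. B e x (tl (xs e))) (xs e) (A e))"
  proof (rule polytime_foldr[OF xs A, where Inv = "\<lambda>_ _. True" and b = "pcompose q ([:2, 1:] + p + p)"])
    show "polytime (enc_prod ee (enc_prod ex ea)) ea (\<lambda>p. B (fst p) (fst (snd p)) (tl (xs (fst p))))"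
    proof -
      have "polytime (enc_prod ee (enc_prod ex ea)) ?eb (\<lambda>p. (fst p, fst (snd p), tl (xs (fst p))))"
        by (rule polytime_pair[OF polytime_fst[OF polytime_id] polytime_pair[OF polytime_fst[OF polytime_snd[OF polytime_id]]
          polytime_comp[OF polytime_tl[OF xs] polytime_fst[OF polytime_id]]]])
      from polytime_comp[OF B this] show ?thesis by simp
    qed
    fix e x a assume x: "x \<in> set (xs e)"
    have "size (ea (B e x (tl (xs e)))) \<le> poly q (size (?eb (e, x, tl (xs e))))"
      using q[of "(e, x, tl (xs e))"] by simp
    also have "\<dots> \<le> poly (pcompose q ([:2, 1:] + p + p)) (size (ee e))"
      unfolding poly_pcompose
      using size_enc_list_mem[OF x, of ex] p[of e] tl[of "xs e"] by (intro poly_nat_mono) simp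
    finally show "size (ea (B e x (tl (xs e)))) \<le> size (ea a) + poly (pcompose q ([:2, 1:] + p + p)) (size (ee e))"
      by simp
  qed auto
  moreover have "foldr (\<lambda>x _. B e x (tl (xs e))) (xs e) (A e) = (case xs e of [] \<Rightarrow> A e | x # r \<Rightarrow> B e x r)" for e
    by (cases "xs e") auto
  ultimately show ?thesis by simp
qed

lemma polytime_append:
  assumes "polytime ee (enc_list ex) xs" "polytime ee (enc_list ex) ys"
  shows "polytime ee (enc_list ex) (\<lambda>e. xs e @ ys e)"
proof -
  obtain p where p: "\<And>e. size (enc_list ex (xs e)) \<le> poly p (size (ee e))" using polytime_size[OF assms(1)] by blast
  have "polytime ee (enc_list ex) (\<lambda>e. foldr (#) (xs e) (ys e))"
  proof (rule polytime_foldr[OF assms, where Inv = "\<lambda>_ _. True" and b = "p"])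
    fix e x and a :: "'b list" assume x: "x \<in> set (xs e)"
    show "size (enc_list ex (x # a)) \<le> size (enc_list ex a) + poly p (size (ee e))"
      using size_enc_list_mem[OF x, of ex] p[of e] by simp
  qed (auto intro: polytime_Cons[OF polytime_fst[OF polytime_snd[OF polytime_id]] polytime_snd[OF polytime_snd[OF polytime_id]]])
  moreover have "foldr (#) xs ys = xs @ ys" for xs ys :: "'b list" by (induction xs) auto
  ultimately show ?thesis by simp
qed

text \<open>The common source of \<open>polytime_map\<close> and \<open>polytime_filter\<close>, and
  through the latter of bounded quantification and membership.\<close>

lemma polytime_concat_map:
  assumes xs: "polytime ee (enc_list ex) xs" and f: "polytime (enc_prod ee ex) (enc_list ey) (\<lambda>p. f (fst p) (snd p))"
  shows "polytime ee (enc_list ey) (\<lambda>e. concat (map (f e) (xs e)))"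
proof -
  obtain p where p: "\<And>e. size (enc_list ex (xs e)) \<le> poly p (size (ee e))" using polytime_size[OF xs] by blast
  obtain q where q: "\<And>b. size (enc_list ey (f (fst b) (snd b))) \<le> poly q (size (enc_prod ee ex b))"
    by (rule polytime_size[OF f], rule that)
  have "polytime ee (enc_list ey) (\<lambda>e. foldr (\<lambda>x acc. f e x @ acc) (xs e) [])"
  proof (rule polytime_foldr[OF xs polytime_const, where Inv = "\<lambda>_ _. True" and b = "pcompose q ([:1, 1:] + p)"])
    show "polytime (enc_prod ee (enc_prod ex (enc_list ey))) (enc_list ey)
            (\<lambda>p. f (fst p) (fst (snd p)) @ snd (snd p))"
      using polytime_comp[OF f, of "enc_prod ee (enc_prod ex (enc_list ey))" "\<lambda>p. (fst p, fst (snd p))"]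
      by (intro polytime_append polytime_snd[OF polytime_snd[OF polytime_id]])
       (use polytime_pair[OF polytime_fst[OF polytime_id] polytime_fst[OF polytime_snd[OF polytime_id]]] in auto)
    fix e x and a :: "'c list" assume x: "x \<in> set (xs e)"
    have "size (enc_list ey (f e x)) \<le> poly q (size (enc_prod ee ex (e, x)))"
      using q[of "(e, x)"] by simp
    also have "\<dots> \<le> poly (pcompose q ([:1, 1:] + p)) (size (ee e))"
      unfolding poly_pcompose using size_enc_list_mem[OF x, of ex] p[of e] by (intro poly_nat_mono) simp
    finally show "size (enc_list ey (f e x @ a)) \<le> size (enc_list ey a) + poly (pcompose q ([:1, 1:] + p)) (size (ee e))"
      by simp
  qed auto
  moreover have "foldr (\<lambda>x acc. f e x @ acc) xs [] = concat (map (f e) xs)" for e xs by (induction xs) auto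
  ultimately show ?thesis by simp
qed

lemma polytime_map:
  assumes "polytime ee (enc_list ex) xs" "polytime (enc_prod ee ex) ey (\<lambda>p. f (fst p) (snd p))"
  shows "polytime ee (enc_list ey) (\<lambda>e. map (f e) (xs e))"
  using polytime_concat_map[OF assms(1) polytime_Cons[OF assms(2) polytime_const[of _ _ "[]"]]] by (simp add: concat_map_singleton)

lemma polytime_filter:
  assumes "polytime ee (enc_list ex) xs" "polytime (enc_prod ee ex) enc_bool (\<lambda>p. f (fst p) (snd p))"
  shows "polytime ee (enc_list ex) (\<lambda>e. filter (f e) (xs e))"
proof -
  have "concat (map (\<lambda>x. if f e x then [x] else []) xs) = filter (f e) xs" for e xs
    by (induction xs) auto
  with polytime_concat_map[OF assms(1) polytime_if[OF assms(2) polytime_Cons[OF polytime_snd[OF polytime_id] polytime_const[of _ _ "[]"]]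
    polytime_const[of _ _ "[]"]]] show ?thesis by simp
qed

lemma polytime_not: "polytime ee enc_bool f \<Longrightarrow> polytime ee enc_bool (\<lambda>e. \<not> f e)"
  by (drule polytime_if[OF _ polytime_const[of _ enc_bool False] polytime_const[of _ _ True]], erule back_subst) auto

lemma polytime_conj:
  assumes "polytime ee enc_bool f" "polytime ee enc_bool g" shows "polytime ee enc_bool (\<lambda>e. f e \<and> g e)"
proof -
  have "(\<lambda>e. f e \<and> g e) = (\<lambda>e. if f e then g e else False)" by auto
  then show ?thesis using polytime_if[OF assms polytime_const] by simp
qed

lemma polytime_disj:
  assumes "polytime ee enc_bool f" "polytime ee enc_bool g" shows "polytime ee enc_bool (\<lambda>e. f e \<or> g e)"
proof -
  have "(\<lambda>e. f e \<or> g e) = (\<lambda>e. if f e then True else g e)" by auto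
  then show ?thesis using polytime_if[OF assms(1) polytime_const assms(2)] by simp
qed

lemma polytime_Bex:
  assumes "polytime ee (enc_list ex) xs" "polytime (enc_prod ee ex) enc_bool (\<lambda>p. f (fst p) (snd p))"
  shows "polytime ee enc_bool (\<lambda>e. \<exists>x\<in>set (xs e). f e x)"
  using polytime_not[OF polytime_null[OF polytime_filter[OF assms]]] by (simp add: filter_empty_conv)

lemma polytime_mem:
  assumes "inj ex" "polytime ee ex x" "polytime ee (enc_list ex) xs"
  shows "polytime ee enc_bool (\<lambda>e. x e \<in> set (xs e))"
  using polytime_Bex[OF assms(3) polytime_eq[OF assms(1) polytime_snd[OF polytime_id] polytime_comp[OF assms(2) polytime_fst[OF polytime_id]]]]
  by simp

text \<open>Truncated subtraction of numbers in unary, represented by list lengths; it gives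
  comparisons of lengths and the capacities of groups.\<close>

lemma polytime_drop:
  assumes "polytime ee (enc_list ex) xs" "polytime ee (enc_list ey) ys"
  shows "polytime ee (enc_list ey) (\<lambda>e. drop (length (xs e)) (ys e))"
proof -
  have tl: "size (enc_list ey (tl ys)) \<le> size (enc_list ey ys)" for ys by (cases ys) auto
  have "polytime ee (enc_list ey) (\<lambda>e. foldr (\<lambda>_ r. tl r) (xs e) (ys e))"
    by (rule polytime_foldr[OF assms, where Inv = "\<lambda>_ _. True" and b = 0])
      (use tl in \<open>auto intro: polytime_tl[OF polytime_snd[OF polytime_snd[OF polytime_id]]]\<close>)
  moreover have "foldr (\<lambda>_ r. tl r) xs ys = drop (length xs) ys" for xs :: "'b list" and ys :: "'c list"
    by (induction xs) (auto simp: drop_Suc tl_drop)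
  ultimately show ?thesis by simp
qed

section \<open>Injectivity of the encodings\<close>

lemma enc_nat_inj: "inj enc_nat"
proof (rule injI)
  show "enc_nat m = enc_nat n \<Longrightarrow> m = n" for m n
  proof (induction m arbitrary: n rule: less_induct)
    case (less m)
    show ?case
    proof (cases "m = 0 \<or> n = 0")
      case True
      then show ?thesis using less.prems by (subst (asm) (1 2) enc_nat.simps) (auto split: if_splits)
    next
      case False
      then have "even m = even n" "enc_nat (m div 2) = enc_nat (n div 2)"
        using less.prems by (subst (asm) (1 2) enc_nat.simps, auto split: if_splits)+
      with less.IH[of "m div 2" "n div 2"] False have "even m = even n" "m div 2 = n div 2" by auto
      then show ?thesis by (metis dvd_mult_div_cancel odd_two_times_div_two_succ)
    qed
  qed
qed

lemma enc_prod_inj: "inj ea \<Longrightarrow> inj eb \<Longrightarrow> inj (enc_prod ea eb)"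
  by (auto simp: inj_def enc_prod_def)

lemma enc_list_inj: "inj ex \<Longrightarrow> inj (enc_list ex)"
proof (rule injI)
  assume "inj ex"
  then show "enc_list ex xs = enc_list ex ys \<Longrightarrow> xs = ys" for xs ys
  proof (induction xs arbitrary: ys)
    case Nil
    then show ?case by (cases ys) auto
  next
    case (Cons x xs)
    then show ?case by (cases ys) (auto dest: injD)
  qed
qed

section \<open>Linkings and injections\<close>

text \<open>The domain \<open>L\<close> is a parameter because the correctness argument adds the
  vertices of \<open>V - Z\<close> one at a time; linkings correspond to
  \<open>L = V - Z\<close>.\<close>

definition escape :: "'a pair_pre_digraph \<Rightarrow> 'a set \<Rightarrow> 'a set \<Rightarrow> ('a \<Rightarrow> 'a) \<Rightarrow> bool" where
  "escape D L Y f \<longleftrightarrow> inj_on f L \<and>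
     (\<forall>v\<in>L. f v \<in> pverts D \<and> f v \<notin> Y \<and> (f v = v \<or> (v, f v) \<in> parcs D))"

lemma vwalk_arcs_nth: "Suc i < length p \<Longrightarrow> (p ! i, p ! Suc i) \<in> set (vwalk_arcs p)"
  by (induction p arbitrary: i rule: vwalk_arcs.induct) (auto simp: nth_Cons split: nat.split)

lemma set_vwalk_arcs: "e \<in> set (vwalk_arcs p) \<Longrightarrow> \<exists>i. Suc i < length p \<and> e = (p ! i, p ! Suc i)"
proof (induction p rule: vwalk_arcs.induct)
  case (3 x y xs)
  show ?case
  proof (cases "e = (x, y)")
    case True
    then show ?thesis by (intro exI[of _ 0]) auto
  next
    case False
    with 3 obtain i where "Suc i < length (y # xs)" "e = ((y # xs) ! i, (y # xs) ! Suc i)" by auto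
    then show ?thesis by (intro exI[of _ "Suc i"]) auto
  qed
qed auto

lemma arcs_ends_with_proj: "arcs_ends (with_proj D) = parcs D"
  by (auto simp: arcs_ends_def arc_to_ends_def)

text \<open>Each vertex on a path moves to its successor and all other vertices stay put. A path
  vertex outside \<open>Z\<close> has a successor because the path ends in \<open>Z\<close>, and
  starting vertices are nobody's successor.\<close>

lemma linked_imp_escape:
  assumes "linked D I Z"
  shows "\<exists>f. escape D (pverts D - Z) I f"
proof -
  obtain p where p: "\<And>v. v \<in> I \<Longrightarrow> vpath (p v) (with_proj D) \<and> hd (p v) = v \<and> last (p v) \<in> Z"
    and disj: "\<And>u v. u \<in> I \<Longrightarrow> v \<in> I \<Longrightarrow> u \<noteq> v \<Longrightarrow> set (p u) \<inter> set (p v) = {}"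
    using assms unfolding linked_def by blast
  define nxt where "nxt v w \<longleftrightarrow> (\<exists>u\<in>I. \<exists>i. Suc i < length (p u) \<and> p u ! i = v \<and> p u ! Suc i = w)" for v w
  have dist: "distinct (p u)" "p u \<noteq> []" "set (p u) \<subseteq> pverts D" "set (vwalk_arcs (p u)) \<subseteq> parcs D" if "u \<in> I" for u
    using p[OF that] by (auto simp: vpath_def vwalk_def arcs_ends_with_proj)
  \<comment> \<open>Disjointness of the paths and distinctness along each path: a vertex occurs at
    one position of one path only, which makes \<open>nxt\<close> injective.\<close>
  have same: "u = u' \<and> i = j" if "u \<in> I" "u' \<in> I" "i < length (p u)" "j < length (p u')" "p u ! i = p u' ! j"
    for u u' i j
  proof -
    have "p u ! i \<in> set (p u)" "p u ! i \<in> set (p u')" using that by (auto simp: in_set_conv_nth)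
    then have "u = u'" using disj that(1,2) by blast
    then show ?thesis using that dist(1)[of u] nth_eq_iff_index_eq by blast
  qed
  have nxt_inj: "v = v'" if "nxt v w" "nxt v' w" for v v' w
    using that same unfolding nxt_def by (metis Suc_inject)
  have nxt_arc: "(v, w) \<in> parcs D \<and> w \<in> pverts D" if n: "nxt v w" for v w
  proof -
    obtain u i where "u \<in> I" "Suc i < length (p u)" "p u ! i = v" "p u ! Suc i = w"
      using n unfolding nxt_def by blast
    then show ?thesis using vwalk_arcs_nth[of i "p u"] dist[of u] nth_mem[of "Suc i" "p u"] by auto
  qed
  have nxt_I: "w \<notin> I" if n: "nxt v w" for v w
  proof
    assume w: "w \<in> I"
    obtain u i where u: "u \<in> I" "Suc i < length (p u)" "p u ! i = v" "p u ! Suc i = w"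
      using n unfolding nxt_def by blast
    have "p w ! 0 = w" using p[OF w] dist(2)[OF w] by (simp add: hd_conv_nth)
    then show False using same[OF u(1) w u(2), of 0] dist(2)[OF w] u(4) by simp
  qed
  have ex: "\<exists>w. nxt v w" if a: "u \<in> I" "v \<in> set (p u)" "v \<notin> Z" for u v
  proof -
    obtain i where i: "i < length (p u)" "p u ! i = v" using a(2) by (auto simp: in_set_conv_nth)
    have "Suc i \<noteq> length (p u)"
      using p[OF a(1)] a(3) i dist(2)[OF a(1)] by (metis diff_Suc_1 last_conv_nth)
    then have "Suc i < length (p u)" using i by simp
    then show ?thesis using a(1) i unfolding nxt_def by blast
  qed
  have tgt: "\<exists>u\<in>I. w \<in> set (p u)" if n: "nxt v w" for v w
    using n unfolding nxt_def by (metis nth_mem)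
  define f where "f v = (if \<exists>u\<in>I. v \<in> set (p u) then SOME w. nxt v w else v)" for v
  have f1: "nxt v (f v)" if "u \<in> I" "v \<in> set (p u)" "v \<notin> Z" for u v
    unfolding f_def using someI_ex[OF ex[OF that]] that by auto
  have f2: "f v = v" if "\<not> (\<exists>u\<in>I. v \<in> set (p u))" for v using that by (simp add: f_def)
  have hdI: "u \<in> set (p u)" if "u \<in> I" for u using p[OF that] dist(2)[OF that] by (metis hd_in_set)
  have "escape D (pverts D - Z) I f" unfolding escape_def
  proof (intro conjI inj_onI ballI)
    fix v v' assume v: "v \<in> pverts D - Z" "v' \<in> pverts D - Z" "f v = f v'"
    \<comment> \<open>Path vertices move to path vertices by \<open>tgt\<close> and the others are
      fixed, so different arguments could only collide if both lie on paths, where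
      \<open>nxt_inj\<close> excludes it.\<close>
    show "v = v'"
      using v f1 f2 nxt_inj tgt by (metis DiffE)
  next
    fix v assume v: "v \<in> pverts D - Z"
    show "f v \<in> pverts D" "f v \<notin> I" "f v = v \<or> (v, f v) \<in> parcs D"
      using v f1 f2 nxt_arc nxt_I hdI by (metis DiffE)+
  qed
  then show ?thesis by blast
qed

text \<open>Iterate \<open>f\<close> from each element of \<open>I\<close> until \<open>Z\<close> is
  reached. No element of \<open>I\<close> is a value of \<open>f\<close>, so injectivity keeps the
  orbits from meeting or closing up, and finiteness forces them into \<open>Z\<close>.\<close>

lemma escape_imp_linked:
  assumes fin: "finite (pverts D)" and f: "escape D (pverts D - Z) I f" and I: "I \<subseteq> pverts D"
  shows "linked D I Z"
proof -
  let ?L = "pverts D - Z"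
  have inj: "inj_on f ?L" and fV: "\<And>v. v \<in> ?L \<Longrightarrow> f v \<in> pverts D"
    and fI: "\<And>v. v \<in> ?L \<Longrightarrow> f v \<notin> I" and fa: "\<And>v. v \<in> ?L \<Longrightarrow> f v = v \<or> (v, f v) \<in> parcs D"
    using f unfolding escape_def by auto
  \<comment> \<open>Cancel \<open>f\<close> on both sides by injectivity; if one side is exhausted
    before the other, an element of \<open>I\<close> would be a value of \<open>f\<close>.\<close>
  have same: "s = t \<and> i = j" if "s \<in> I" "t \<in> I" "(f ^^ i) s = (f ^^ j) t"
    "\<And>m. m < i \<Longrightarrow> (f ^^ m) s \<in> ?L" "\<And>m. m < j \<Longrightarrow> (f ^^ m) t \<in> ?L" for s t i j
    using that
  proof (induction i arbitrary: j)
    case 0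
    show ?case
    proof (cases j)
      case (Suc j')
      then have "(f ^^ j) t \<notin> I" using fI[of "(f ^^ j') t"] 0(5)[of j'] by simp
      with 0 show ?thesis by simp
    qed (use 0 in simp)
  next
    case (Suc i)
    show ?case
    proof (cases j)
      case 0
      then have "(f ^^ Suc i) s \<notin> I" using fI[of "(f ^^ i) s"] Suc.prems(4)[of i] by simp
      with Suc 0 show ?thesis by simp
    next
      case (Suc j')
      have "(f ^^ i) s = (f ^^ j') t"
        using Suc.prems(3) Suc Suc.prems(4)[of i] Suc.prems(5)[of j'] inj by (auto dest: inj_onD)
      then show ?thesis using Suc.IH[of j'] Suc.prems Suc by simp
    qed
  qed
  have ex: "\<exists>n. (f ^^ n) s \<in> Z" if s: "s \<in> I" for s
  proof (rule ccontr)
    assume "\<not> ?thesis"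
    then have nz: "(f ^^ n) s \<notin> Z" for n by blast
    have L: "(f ^^ n) s \<in> ?L" for n
    proof (induction n)
      case 0
      then show ?case using nz[of 0] s I by auto
    next
      case (Suc n)
      then show ?case using nz[of "Suc n"] fV by auto
    qed
    then have "inj (\<lambda>n. (f ^^ n) s)" using same[OF s s] by (auto intro!: injI)
    moreover have "finite (range (\<lambda>n. (f ^^ n) s))"
      using L by (intro finite_subset[OF _ fin]) auto
    ultimately show False using finite_imageD infinite_UNIV_nat by blast
  qed
  define n where "n s = (LEAST n. (f ^^ n) s \<in> Z)" for s
  define p where "p s = map (\<lambda>i. (f ^^ i) s) [0..<Suc (n s)]" for s
  have nZ: "(f ^^ n s) s \<in> Z" if "s \<in> I" for s unfolding n_def using LeastI_ex[OF ex[OF that]] .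
  have nL: "m \<le> n s \<Longrightarrow> (f ^^ m) s \<in> pverts D" "m < n s \<Longrightarrow> (f ^^ m) s \<in> ?L" if s: "s \<in> I" for s m
  proof -
    have nz: "(f ^^ m) s \<notin> Z" if "m < n s" for m using that not_less_Least unfolding n_def by blast
    show 1: "(f ^^ m) s \<in> pverts D" if "m \<le> n s" for m using that
    proof (induction m)
      case 0
      then show ?case using s I by auto
    next
      case (Suc m)
      then show ?case using fV[of "(f ^^ m) s"] nz[of m] by simp
    qed
    show "m < n s \<Longrightarrow> (f ^^ m) s \<in> ?L" using 1[of m] nz[of m] by simp
  qed
  have uniq: "s = t \<and> i = j" if "s \<in> I" "t \<in> I" "i \<le> n s" "j \<le> n t" "(f ^^ i) s = (f ^^ j) t" for s t i j
    using same[OF that(1,2,5)] nL(2)[OF that(1)] nL(2)[OF that(2)] that(3,4) by auto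
  show ?thesis unfolding linked_def
  proof (intro exI[of _ p] conjI ballI impI)
    fix s assume s: "s \<in> I"
    \<comment> \<open>By \<open>uniq\<close> the vertex differs from its successor, which rules out
      the alternative \<open>f v = v\<close>.\<close>
    have arc: "((f ^^ i) s, (f ^^ Suc i) s) \<in> parcs D" if "i < n s" for i
      using fa[OF nL(2)[OF s that]] uniq[OF s s, of "Suc i" i] that by auto
    have "set (vwalk_arcs (p s)) \<subseteq> parcs D"
    proof
      fix e assume "e \<in> set (vwalk_arcs (p s))"
      then obtain i where "Suc i < length (p s)" "e = (p s ! i, p s ! Suc i)" using set_vwalk_arcs by blast
      then show "e \<in> parcs D" using arc[of i] by (simp add: p_def del: upt_Suc)
    qed
    moreover have "set (p s) \<subseteq> pverts D" using nL(1)[OF s] by (auto simp: p_def simp del: upt_Suc)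
    moreover have "distinct (p s)"
      unfolding p_def distinct_map using uniq[OF s s] by (auto intro!: inj_onI simp del: upt_Suc)
    ultimately show "vpath (p s) (with_proj D)"
      by (auto simp: vpath_def vwalk_def arcs_ends_with_proj p_def)
    show "hd (p s) = s" by (simp add: p_def hd_map del: upt_Suc)
    show "last (p s) \<in> Z" using nZ[OF s] by (simp add: p_def)
  next
    fix s t assume st: "s \<in> I" "t \<in> I" "s \<noteq> t"
    show "set (p s) \<inter> set (p t) = {}"
      using uniq[OF st(1,2)] st(3) by (fastforce simp: p_def less_Suc_eq_le simp del: upt_Suc)
  qed
qed

section \<open>Fractional matchings of minimal support\<close>

text \<open>Gaussian elimination, by induction on the set of equations: one equation is solved for
  an unknown \<open>j0\<close> with nonzero coefficient and substituted into the others.\<close>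

lemma homogeneous_system_nontrivial_solution:
  fixes a :: "'i \<Rightarrow> 'j \<Rightarrow> real"
  assumes "finite I" "finite J" "card I < card J"
  shows "\<exists>y. (\<exists>j\<in>J. y j \<noteq> 0) \<and> (\<forall>i\<in>I. (\<Sum>j\<in>J. a i j * y j) = 0)"
  using assms
proof (induction I arbitrary: a J rule: finite_induct)
  case empty
  then have "J \<noteq> {}" by auto
  then show ?case by (intro exI[of _ "\<lambda>_. 1"]) auto
next
  case (insert i I)
  show ?case
  proof (cases "\<forall>j\<in>J. a i j = 0")
    case True
    obtain y where "\<exists>j\<in>J. y j \<noteq> 0" "\<forall>i\<in>I. (\<Sum>j\<in>J. a i j * y j) = 0"
      using insert.IH[of J a] insert.prems insert.hyps by auto
    then show ?thesis using True by (intro exI[of _ y]) auto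
  next
    case False
    then obtain j0 where j0: "j0 \<in> J" "a i j0 \<noteq> 0" by blast
    let ?J = "J - {j0}"
    have "card I < card ?J" using insert j0 by simp
    then obtain y where y: "\<exists>j\<in>?J. y j \<noteq> 0"
      "\<forall>i'\<in>I. (\<Sum>j\<in>?J. (a i' j - a i' j0 * a i j / a i j0) * y j) = 0"
      using insert.IH[of ?J "\<lambda>i' j. a i' j - a i' j0 * a i j / a i j0"] insert.prems(1) by auto
    \<comment> \<open>The value of the eliminated unknown that equation \<open>i\<close>
      forces.\<close>
    define c where "c = - (\<Sum>j\<in>?J. a i j * y j) / a i j0"
    define y' where "y' = y(j0 := c)"
    have split: "(\<Sum>j\<in>J. a i' j * y' j) = a i' j0 * c + (\<Sum>j\<in>?J. a i' j * y j)" for i'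
      using j0(1) insert.prems(1) by (subst sum.remove[of _ j0]) (auto simp: y'_def intro!: sum.cong)
    have "(\<Sum>j\<in>J. a i j * y' j) = 0" unfolding split using j0(2) by (simp add: c_def)
    moreover have "(\<Sum>j\<in>J. a i' j * y' j) = 0" if "i' \<in> I" for i'
    proof -
      have "(\<Sum>j\<in>?J. (a i' j - a i' j0 * a i j / a i j0) * y j)
        = (\<Sum>j\<in>?J. a i' j * y j) - a i' j0 / a i j0 * (\<Sum>j\<in>?J. a i j * y j)"
        by (simp add: algebra_simps sum_subtractf sum_distrib_left)
      then show ?thesis unfolding split using y(2) that by (simp add: c_def)
    qed
    moreover have "\<exists>j\<in>J. y' j \<noteq> 0" using y(1) by (auto simp: y'_def)
    ultimately show ?thesis by (intro exI[of _ y']) auto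
  qed
qed

text \<open>Counting edges from both sides gives \<open>card L + card H \<le> card E\<close>. A
  circulation satisfies one linear equation per vertex, of which one is redundant, so there are more
  unknowns than equations.\<close>

lemma nonzero_circulation_of_min_degree_two:
  assumes fin: "finite L" "finite H" and E: "E \<subseteq> L \<times> H" and L: "L \<noteq> {}"
    and degL: "\<And>l. l \<in> L \<Longrightarrow> 2 \<le> card {h \<in> H. (l, h) \<in> E}"
    and degH: "\<And>h. h \<in> H \<Longrightarrow> 2 \<le> card {l \<in> L. (l, h) \<in> E}"
  obtains z :: "'l \<Rightarrow> 'h \<Rightarrow> real" where
    "\<exists>l\<in>L. \<exists>h\<in>H. z l h \<noteq> 0" "\<And>l h. z l h \<noteq> 0 \<Longrightarrow> (l, h) \<in> E"
    "\<And>l. l \<in> L \<Longrightarrow> (\<Sum>h\<in>H. z l h) = 0" "\<And>h. h \<in> H \<Longrightarrow> (\<Sum>l\<in>L. z l h) = 0"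
proof -
  have finE: "finite E" using finite_subset[OF E] fin by simp
  have "E = (SIGMA l:L. {h \<in> H. (l, h) \<in> E})" using E by auto
  from arg_cong[OF this, of card] have "card E = (\<Sum>l\<in>L. card {h \<in> H. (l, h) \<in> E})"
    using fin by (simp add: card_SigmaI)
  then have 1: "2 * card L \<le> card E" using sum_bounded_below[of L 2 "\<lambda>l. card {h \<in> H. (l, h) \<in> E}"] degL by simp
  have "bij_betw (\<lambda>(h, l). (l, h)) (SIGMA h:H. {l \<in> L. (l, h) \<in> E}) E"
    using E by (auto simp: bij_betw_def inj_on_def image_iff)
  then have "card E = (\<Sum>h\<in>H. card {l \<in> L. (l, h) \<in> E})"
    using fin bij_betw_same_card by (fastforce simp: card_SigmaI)
  then have 2: "2 * card H \<le> card E" using sum_bounded_below[of H 2 "\<lambda>h. card {l \<in> L. (l, h) \<in> E}"] degH by simp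
  obtain l0 where l0: "l0 \<in> L" using L by blast
  \<comment> \<open>The equation of \<open>l0\<close> is left out; it follows at the end because row
    sums and column sums have the same total.\<close>
  let ?I = "Inl ` (L - {l0}) \<union> Inr ` H"
  have "card ?I = card (L - {l0}) + card H"
    using fin by (subst card_Un_disjoint) (auto simp: card_image)
  also have "\<dots> < card L + card H" using l0 fin by (simp add: card_gt_0_iff L)
  finally have "card ?I < card E" using 1 2 by simp
  moreover have "finite ?I" using fin by simp
  ultimately have sys: "\<exists>y. (\<exists>e\<in>E. y e \<noteq> 0) \<and> (\<forall>i\<in>?I. (\<Sum>e\<in>E. a i e * y e) = 0)"
    for a :: "'l + 'h \<Rightarrow> 'l \<times> 'h \<Rightarrow> real"
    using homogeneous_system_nontrivial_solution[of ?I E a] finE by blast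
  define a :: "'l + 'h \<Rightarrow> 'l \<times> 'h \<Rightarrow> real" where
    "a i e = (case i of Inl l \<Rightarrow> if fst e = l then 1 else 0 | Inr h \<Rightarrow> if snd e = h then 1 else 0)" for i e
  obtain y where y: "\<exists>e\<in>E. y e \<noteq> 0" "\<And>i. i \<in> ?I \<Longrightarrow> (\<Sum>e\<in>E. a i e * y e) = 0"
    using sys[of a] by blast
  define z where "z l h = (if (l, h) \<in> E then y (l, h) else 0)" for l h
  have sumE: "(\<Sum>e\<in>E. f e * y e) = (\<Sum>l\<in>L. \<Sum>h\<in>H. f (l, h) * z l h)" for f
  proof -
    have "(\<Sum>e\<in>E. f e * y e) = (\<Sum>e\<in>L \<times> H. f e * z (fst e) (snd e))"
      using E fin by (intro sum.mono_neutral_cong_left) (auto simp: z_def)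
    then show ?thesis by (simp add: sum.cartesian_product case_prod_beta)
  qed
  have row: "(\<Sum>e\<in>E. a (Inl l) e * y e) = (\<Sum>h\<in>H. z l h)" if "l \<in> L" for l
  proof -
    have "(\<Sum>l'\<in>L. \<Sum>h\<in>H. a (Inl l) (l', h) * z l' h) = (\<Sum>l'\<in>L. if l' = l then \<Sum>h\<in>H. z l' h else 0)"
      by (intro sum.cong) (auto simp: a_def)
    then show ?thesis unfolding sumE using that fin by simp
  qed
  have col: "(\<Sum>e\<in>E. a (Inr h) e * y e) = (\<Sum>l\<in>L. z l h)" if "h \<in> H" for h
  proof -
    have "(\<Sum>l\<in>L. \<Sum>h'\<in>H. a (Inr h) (l, h') * z l h') = (\<Sum>l\<in>L. \<Sum>h'\<in>H. if h' = h then z l h' else 0)"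
      by (intro sum.cong) (auto simp: a_def)
    then show ?thesis unfolding sumE using that fin by simp
  qed
  have cols: "(\<Sum>l\<in>L. z l h) = 0" if "h \<in> H" for h using y(2)[of "Inr h"] col that by simp
  have rows': "(\<Sum>h\<in>H. z l h) = 0" if "l \<in> L - {l0}" for l using y(2)[of "Inl l"] row that by simp
  have "(\<Sum>l\<in>L. \<Sum>h\<in>H. z l h) = 0" by (subst sum.swap) (simp add: cols)
  then have "(\<Sum>h\<in>H. z l0 h) = 0" using sum.remove[OF fin(1) l0, of "\<lambda>l. \<Sum>h\<in>H. z l h"] rows' by simp
  with rows' have rows: "(\<Sum>h\<in>H. z l h) = 0" if "l \<in> L" for l using that by (cases "l = l0") auto
  show ?thesis
  proof (rule that)
    show "\<exists>l\<in>L. \<exists>h\<in>H. z l h \<noteq> 0" using y(1) E by (force simp: z_def)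
  qed (use rows cols in \<open>auto simp: z_def split: if_splits\<close>)
qed

section \<open>Extremal fractional matchings and the reduction step\<close>

text \<open>The weights are real because the perturbation in \<open>smaller_support\<close> uses
  real step lengths.\<close>

definition fractional_matching ::
  "('l \<Rightarrow> 'g \<Rightarrow> bool) \<Rightarrow> ('g \<Rightarrow> nat) \<Rightarrow> nat \<Rightarrow> 'l set \<Rightarrow> 'g set \<Rightarrow> ('l \<Rightarrow> 'g \<Rightarrow> real) \<Rightarrow> bool" where
  "fractional_matching adj cap k L G x \<longleftrightarrow>
     (\<forall>l\<in>L. \<forall>g\<in>G. 0 \<le> x l g \<and> (x l g \<noteq> 0 \<longrightarrow> adj l g)) \<and>
     (\<forall>l\<in>L. (\<Sum>g\<in>G. x l g) = real k) \<and> (\<forall>g\<in>G. (\<Sum>l\<in>L. x l g) \<le> real (cap g))"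

definition feasible :: "('l \<Rightarrow> 'g \<Rightarrow> bool) \<Rightarrow> ('g \<Rightarrow> nat) \<Rightarrow> nat \<Rightarrow> 'l set \<Rightarrow> 'g set \<Rightarrow> bool" where
  "feasible adj cap k L G \<longleftrightarrow> (\<exists>x. fractional_matching adj cap k L G x)"

definition support :: "'l set \<Rightarrow> 'g set \<Rightarrow> ('l \<Rightarrow> 'g \<Rightarrow> real) \<Rightarrow> ('l \<times> 'g) set" where
  "support L G x = {(l, g) \<in> L \<times> G. x l g \<noteq> 0}"

text \<open>Moving from \<open>x\<close> in the direction \<open>z\<close> keeps all sums, and the
  first entry to reach zero leaves the support. Nothing enters it, as \<open>z\<close> vanishes
  outside.\<close>

lemma smaller_support:
  fixes z :: "'l \<Rightarrow> 'g \<Rightarrow> real"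
  assumes fin: "finite L" "finite G" and x: "fractional_matching adj cap k L G x"
    and z: "\<exists>l\<in>L. \<exists>g\<in>G. z l g \<noteq> 0" "\<And>l g. l \<in> L \<Longrightarrow> g \<in> G \<Longrightarrow> z l g \<noteq> 0 \<Longrightarrow> x l g \<noteq> 0"
    "\<And>l. l \<in> L \<Longrightarrow> (\<Sum>g\<in>G. z l g) = 0" "\<And>g. g \<in> G \<Longrightarrow> (\<Sum>l\<in>L. z l g) = 0"
  shows "\<exists>x'. fractional_matching adj cap k L G x' \<and> card (support L G x') < card (support L G x)"
proof -
  note x' = x[unfolded fractional_matching_def]
  define N where "N = {(l, g) \<in> L \<times> G. z l g < 0}"
  have finN: "finite N" unfolding N_def using fin by (auto intro: finite_subset[of _ "L \<times> G"])
  \<comment> \<open>A nonzero entry of \<open>z\<close> lies in a row of sum zero, so some entry is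
    negative.\<close>
  have "N \<noteq> {}"
  proof
    assume "N = {}"
    then have nn: "0 \<le> z l g" if "l \<in> L" "g \<in> G" for l g using that by (force simp: N_def)
    obtain l g where lg: "l \<in> L" "g \<in> G" "z l g \<noteq> 0" using z(1) by blast
    then show False using sum_nonneg_eq_0_iff[OF fin(2), of "z l"] nn z(3)[OF lg(1)] by auto
  qed
  define r where "r e = x (fst e) (snd e) / - z (fst e) (snd e)" for e
  \<comment> \<open>The longest step for which no entry becomes negative; a minimiser
    \<open>(l0, g0)\<close> is an entry that drops to zero.\<close>
  define t where "t = Min (r ` N)"
  have "t \<in> r ` N" unfolding t_def using finN \<open>N \<noteq> {}\<close> by (intro Min_in) auto
  then obtain l0 g0 where e0: "l0 \<in> L" "g0 \<in> G" "z l0 g0 < 0" "t = x l0 g0 / - z l0 g0"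
    by (auto simp: N_def r_def)
  have t_le: "t \<le> x l g / - z l g" if "l \<in> L" "g \<in> G" "z l g < 0" for l g
  proof -
    have "r (l, g) \<in> r ` N" using that by (auto simp: N_def)
    then have "t \<le> r (l, g)" unfolding t_def using finN by (intro Min_le) auto
    then show ?thesis by (simp add: r_def)
  qed
  have t0: "0 \<le> t" using e0 x' by (auto intro!: divide_nonneg_neg)
  define w where "w l g = x l g + t * z l g" for l g
  have w0: "0 \<le> w l g" if "l \<in> L" "g \<in> G" for l g
  proof (cases "z l g < 0")
    case True
    then show ?thesis using t_le[OF that True] by (simp add: w_def field_simps)
  next
    case False
    then show ?thesis using t0 x' that by (simp add: w_def)
  qed
  have wx: "x l g \<noteq> 0" if "l \<in> L" "g \<in> G" "w l g \<noteq> 0" for l g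
    using that z(2)[OF that(1,2)] by (cases "z l g = 0") (auto simp: w_def)
  have "fractional_matching adj cap k L G w"
    unfolding fractional_matching_def
  proof (intro conjI ballI impI)
    fix l assume l: "l \<in> L"
    show "(\<Sum>g\<in>G. w l g) = real k"
      using z(3)[OF l] x' l by (simp add: w_def sum.distrib flip: sum_distrib_left)
  next
    fix g assume g: "g \<in> G"
    show "(\<Sum>l\<in>L. w l g) \<le> real (cap g)"
      using z(4)[OF g] x' g by (simp add: w_def sum.distrib flip: sum_distrib_left)
  qed (use w0 wx x' in auto)
  moreover have "support L G w \<subset> support L G x"
  proof
    show "support L G w \<subseteq> support L G x" using wx by (auto simp: support_def)
    have "x l0 g0 \<noteq> 0" using z(2) e0 by auto
    moreover have "w l0 g0 = 0" using e0 by (simp add: w_def)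
    ultimately show "support L G w \<noteq> support L G x" using e0 by (auto simp: support_def)
  qed
  then have "card (support L G w) < card (support L G x)"
    by (intro psubset_card_mono) (auto simp: support_def intro: finite_subset[OF _ finite_cartesian_product[OF fin]])
  ultimately show ?thesis by blast
qed

text \<open>The merged group enters only through an abstract \<open>m\<close>, of capacity at least
  \<open>cap g + cap g' - k\<close> and adjacent to whatever \<open>g\<close> or \<open>g'\<close>
  is adjacent to; concatenated groups will have both properties. The condition
  \<open>cap g = k\<close> will mean that \<open>g\<close> is disjoint from
  \<open>S\<close>.\<close>

lemma feasible_step:
  assumes fin: "finite L" "finite G" and feas: "feasible adj cap k L G" and k: "k > 0"
    and L: "L \<noteq> {}" and cap: "\<And>g. g \<in> G \<Longrightarrow> cap g \<le> k"
  shows "(\<exists>l\<in>L. \<exists>g\<in>G. adj l g \<and> cap g = k \<and> feasible adj cap k (L - {l}) (G - {g})) \<or>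
    (\<exists>l\<in>L. \<exists>g\<in>G. \<exists>g'\<in>G. g \<noteq> g' \<and> adj l g \<and> adj l g' \<and> cap g > 0 \<and> cap g' > 0 \<and>
      (\<forall>m. m \<notin> G - {g, g'} \<longrightarrow> (\<forall>l. adj l g \<or> adj l g' \<longrightarrow> adj l m) \<longrightarrow> cap g + cap g' \<le> cap m + k \<longrightarrow>
        feasible adj cap k (L - {l}) (insert m (G - {g, g'}))))"
proof -
  \<comment> \<open>Minimality of the support is what rules out a circulation inside it in the last
    case below.\<close>
  obtain x where x: "fractional_matching adj cap k L G x"
    and min: "\<And>y. fractional_matching adj cap k L G y \<Longrightarrow> card (support L G x) \<le> card (support L G y)"
    using feas ex_has_least_nat[of "fractional_matching adj cap k L G" _ "\<lambda>x. card (support L G x)"]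
    unfolding feasible_def by blast
  have x0: "0 \<le> x l g" and xadj: "x l g \<noteq> 0 \<Longrightarrow> adj l g" if "l \<in> L" "g \<in> G" for l g
    using x that unfolding fractional_matching_def by auto
  have row: "(\<Sum>g\<in>G. x l g) = real k" if "l \<in> L" for l
    using x that unfolding fractional_matching_def by auto
  have col: "(\<Sum>l\<in>L. x l g) \<le> real (cap g)" if "g \<in> G" for g
    using x that unfolding fractional_matching_def by auto
  have le_col: "x l g \<le> (\<Sum>l\<in>L. x l g)" if "l \<in> L" "g \<in> G" for l g
    using x0 that fin by (intro member_le_sum) auto
  have cap_pos: "cap g > 0" if "l \<in> L" "g \<in> G" "x l g \<noteq> 0" for l g
    using le_col[OF that(1,2)] col[OF that(2)] x0[OF that(1,2)] that(3) by (cases "cap g") auto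
  define N where "N l = {g \<in> G. x l g \<noteq> 0}" for l
  define U where "U g = {l \<in> L. x l g \<noteq> 0}" for g
  have finN: "finite (N l)" and finU: "finite (U g)" for l g using fin by (auto simp: N_def U_def)
  have rowN: "(\<Sum>g\<in>N l. x l g) = real k" if "l \<in> L" for l
    unfolding row[OF that, symmetric] N_def by (intro sum.mono_neutral_left) (auto simp: fin)
  \<comment> \<open>Both merging cases reduce to one claim: without \<open>l\<close>, the joint load
    of \<open>g\<close> and \<open>g'\<close> fits every nonnegative capacity \<open>c\<close> with
    \<open>cap g + cap g' \<le> c + k\<close>.\<close>
  have merge: ?thesis if l: "l \<in> L" and gs: "g \<in> N l" "g' \<in> N l" "g \<noteq> g'"
    and le: "\<And>c. real (cap g + cap g') \<le> c + real k \<Longrightarrow> 0 \<le> c \<Longrightarrow> (\<Sum>l'\<in>L - {l}. x l' g + x l' g') \<le> c" for l g g'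
  proof -
    have gG: "g \<in> G" "g' \<in> G" "x l g \<noteq> 0" "x l g' \<noteq> 0" using gs by (auto simp: N_def)
    have "feasible adj cap k (L - {l}) (insert m (G - {g, g'}))"
      if m: "m \<notin> G - {g, g'}" and am: "\<And>l. adj l g \<or> adj l g' \<Longrightarrow> adj l m" and cm: "cap g + cap g' \<le> cap m + k" for m
    proof -
      define y where "y l' h = (if h = m then x l' g + x l' g' else x l' h)" for l' h
      have ym: "y l' h = x l' h" if "h \<in> G - {g, g'}" for l' h using that m by (auto simp: y_def)
      have "fractional_matching adj cap k (L - {l}) (insert m (G - {g, g'})) y"
        unfolding fractional_matching_def
      proof (intro conjI ballI)
        fix l' assume l': "l' \<in> L - {l}"
        have "(\<Sum>h\<in>G. x l' h) = x l' g + (x l' g' + (\<Sum>h\<in>G - {g} - {g'}. x l' h))"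
          using gG gs(3) fin by (simp add: sum.remove[of G g] sum.remove[of "G - {g}" g'])
        moreover have "G - {g} - {g'} = G - {g, g'}" by auto
        ultimately show "(\<Sum>h\<in>insert m (G - {g, g'}). y l' h) = real k"
          using row[of l'] l' m fin ym by (simp add: y_def[of _ m])
      next
        fix h assume h: "h \<in> insert m (G - {g, g'})"
        show "(\<Sum>l'\<in>L - {l}. y l' h) \<le> real (cap h)"
        proof (cases "h = m")
          case True
          then show ?thesis using le[of "real (cap m)"] cm by (simp add: y_def)
        next
          case False
          then have hG: "h \<in> G" using h by auto
          have "(\<Sum>l'\<in>L - {l}. y l' h) = (\<Sum>l'\<in>L - {l}. x l' h)" using False by (simp add: y_def)
          also have "\<dots> \<le> (\<Sum>l'\<in>L. x l' h)" using fin x0 hG by (intro sum_mono2) auto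
          finally show ?thesis using col[OF hG] by simp
        qed
      next
        fix l' h assume "l' \<in> L - {l}" "h \<in> insert m (G - {g, g'})"
        then show "0 \<le> y l' h" "y l' h \<noteq> 0 \<longrightarrow> adj l' h"
          using x0[of l'] xadj[of l' h] xadj[of l' g] xadj[of l' g'] gG am[of l']
          by (auto simp: y_def) (metis add.left_neutral)+
      qed
      then show ?thesis unfolding feasible_def by blast
    qed
    then show ?thesis using l gG gs(3) xadj[OF l] cap_pos[OF l]
      by (intro disjI2 bexI[of _ l] bexI[of _ g] bexI[of _ g'] conjI allI impI) auto
  qed
  consider (one) l where "l \<in> L" "card (N l) \<le> 1" | (two) l where "l \<in> L" "card (N l) = 2"
    | (leaves) l g g' where "l \<in> L" "g \<in> N l" "g' \<in> N l" "g \<noteq> g'" "U g = {l}" "U g' = {l}"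
    | (cyclic) "\<And>l. l \<in> L \<Longrightarrow> 3 \<le> card (N l)"
      "\<And>l g g'. l \<in> L \<Longrightarrow> g \<in> N l \<Longrightarrow> g' \<in> N l \<Longrightarrow> U g = {l} \<Longrightarrow> U g' = {l} \<Longrightarrow> g = g'"
  proof (cases "\<forall>l\<in>L. 3 \<le> card (N l)")
    case True
    then show ?thesis using leaves cyclic by blast
  next
    case False
    then obtain l where l: "l \<in> L" "card (N l) < 3" by force
    then have "card (N l) \<le> 1 \<or> card (N l) = 2" by linarith
    then show ?thesis using one two l(1) by blast
  qed
  then show ?thesis
  proof cases
    case one
    have "N l \<noteq> {}" using rowN[OF one(1)] k by auto
    then have "card (N l) = 1" using one(2) finN[of l] by (metis One_nat_def card_0_eq le_SucE le_zero_eq)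
    then obtain g where g: "N l = {g}" using card_1_singletonE by blast
    have gG: "g \<in> G" and xk: "x l g = real k" using g rowN[OF one(1)] by (auto simp: N_def)
    \<comment> \<open>The single neighbour carries all \<open>k\<close> units of \<open>l\<close>;
      as its capacity is at most \<open>k\<close>, it is saturated by \<open>l\<close> and used by
      no other left vertex.\<close>
    have capk: "cap g = k" using le_col[OF one(1) gG] col[OF gG] xk cap[OF gG] by simp
    have "(\<Sum>l'\<in>L. x l' g) = x l g + (\<Sum>l'\<in>L - {l}. x l' g)" using one(1) fin by (simp add: sum.remove)
    then have "(\<Sum>l'\<in>L - {l}. x l' g) \<le> 0" using col[OF gG] capk xk by simp
    moreover have nn: "\<And>l'. l' \<in> L - {l} \<Longrightarrow> 0 \<le> x l' g" using x0 gG by auto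
    ultimately have "(\<Sum>l'\<in>L - {l}. x l' g) = 0" using sum_nonneg[of "L - {l}" "\<lambda>l'. x l' g"] by fastforce
    then have z: "x l' g = 0" if "l' \<in> L - {l}" for l'
      using sum_nonneg_eq_0_iff[of "L - {l}" "\<lambda>l'. x l' g"] nn fin that by auto
    have "fractional_matching adj cap k (L - {l}) (G - {g}) x"
      unfolding fractional_matching_def
    proof (intro conjI ballI)
      fix l' assume l': "l' \<in> L - {l}"
      have "(\<Sum>h\<in>G. x l' h) = x l' g + (\<Sum>h\<in>G - {g}. x l' h)" using gG fin by (simp add: sum.remove)
      then show "(\<Sum>h\<in>G - {g}. x l' h) = real k" using z[OF l'] row[of l'] l' by simp
    next
      fix h assume h: "h \<in> G - {g}"
      have "(\<Sum>l'\<in>L - {l}. x l' h) \<le> (\<Sum>l'\<in>L. x l' h)" using fin x0 h by (intro sum_mono2) auto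
      then show "(\<Sum>l'\<in>L - {l}. x l' h) \<le> real (cap h)" using col[of h] h by simp
    qed (use x0 xadj in auto)
    then show ?thesis using one(1) gG capk xadj[OF one(1) gG] xk k unfolding feasible_def by auto
  next
    case two
    obtain g g' where g: "N l = {g, g'}" "g \<noteq> g'" using two(2) by (auto simp: card_2_iff)
    have gG: "g \<in> G" "g' \<in> G" using g by (auto simp: N_def)
    \<comment> \<open>All units of \<open>l\<close> lie on \<open>g\<close> and \<open>g'\<close>,
      so removing \<open>l\<close> lowers their joint load by \<open>k\<close>.\<close>
    have s: "x l g + x l g' = real k" using rowN[OF two(1)] g by simp
    show ?thesis
    proof (rule merge[OF two(1), of g g'])
      fix c assume c: "real (cap g + cap g') \<le> c + real k"
      have "(\<Sum>l'\<in>L. x l' h) = x l h + (\<Sum>l'\<in>L - {l}. x l' h)" for h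
        using two(1) fin by (simp add: sum.remove)
      then show "(\<Sum>l'\<in>L - {l}. x l' g + x l' g') \<le> c"
        using col[OF gG(1)] col[OF gG(2)] s c by (simp add: sum.distrib)
    qed (use g in auto)
  next
    case leaves
    \<comment> \<open>Only \<open>l\<close> uses \<open>g\<close> and \<open>g'\<close>, so the
      joint load left is zero and any nonnegative capacity will do.\<close>
    show ?thesis
    proof (rule merge[OF leaves(1-4)])
      fix c :: real assume "0 \<le> c"
      moreover have "x l' g = 0 \<and> x l' g' = 0" if "l' \<in> L - {l}" for l'
        using leaves(5,6) that by (auto simp: U_def)
      then have "(\<Sum>l'\<in>L - {l}. x l' g + x l' g') = 0" by (intro sum.neutral) auto
      ultimately show "(\<Sum>l'\<in>L - {l}. x l' g + x l' g') \<le> c" by simp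
    qed
  next
    case cyclic
    \<comment> \<open>Groups used by at least two left vertices. Each left vertex has at least three
      neighbours and at most one that it alone uses, hence at least two in \<open>H\<close>.\<close>
    define H where "H = {g \<in> G. 2 \<le> card (U g)}"
    define E where "E = {(l, g). l \<in> L \<and> g \<in> H \<and> x l g \<noteq> 0}"
    have finH: "finite H" using fin by (simp add: H_def)
    have "2 \<le> card {h \<in> H. (l, h) \<in> E}" if l: "l \<in> L" for l
    proof -
      have eq: "{h \<in> H. (l, h) \<in> E} = N l \<inter> H" using l by (auto simp: E_def N_def H_def)
      have leaf: "U g = {l}" if g: "g \<in> N l - H" for g
      proof -
        have "l \<in> U g" using l g by (auto simp: U_def N_def)
        moreover have "card (U g) \<le> 1" using g by (auto simp: H_def N_def)
        ultimately show ?thesis using finU[of g] by (metis One_nat_def card_le_Suc0_iff_eq empty_iff insertI1 insert_absorb subsetI subset_antisym subset_singletonD)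
      qed
      have "card (N l - H) \<le> 1"
        using cyclic(2)[OF l] leaf finN[of l] by (auto simp: card_le_Suc0_iff_eq)
      then show ?thesis
        using cyclic(1)[OF l] card_Int_Diff[OF finN, of l H] eq by simp
    qed
    moreover have "2 \<le> card {l \<in> L. (l, h) \<in> E}" if "h \<in> H" for h
    proof -
      have "{l \<in> L. (l, h) \<in> E} = U h" using that by (auto simp: E_def U_def)
      then show ?thesis using that by (simp add: H_def)
    qed
    moreover have "E \<subseteq> L \<times> H" by (auto simp: E_def)
    ultimately obtain z :: "'a \<Rightarrow> 'b \<Rightarrow> real" where z: "\<exists>l\<in>L. \<exists>h\<in>H. z l h \<noteq> 0" "\<And>l h. z l h \<noteq> 0 \<Longrightarrow> (l, h) \<in> E"
      "\<And>l. l \<in> L \<Longrightarrow> (\<Sum>h\<in>H. z l h) = 0" "\<And>h. h \<in> H \<Longrightarrow> (\<Sum>l\<in>L. z l h) = 0"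
      using nonzero_circulation_of_min_degree_two[OF fin(1) finH _ L, of E] by blast
    have HG: "H \<subseteq> G" by (auto simp: H_def)
    have zH: "z l g = 0" if "g \<notin> H" for l g using z(2)[of l g] that by (auto simp: E_def)
    have "\<exists>x'. fractional_matching adj cap k L G x' \<and> card (support L G x') < card (support L G x)"
    proof (rule smaller_support[OF fin x])
      show "\<exists>l\<in>L. \<exists>g\<in>G. z l g \<noteq> 0" using z(1) HG by blast
      show "x l g \<noteq> 0" if "z l g \<noteq> 0" for l g using z(2)[OF that] by (simp add: E_def)
      show "(\<Sum>g\<in>G. z l g) = 0" if "l \<in> L" for l
        using z(3)[OF that] sum.mono_neutral_left[OF fin(2) HG, of "z l"] zH by auto
      show "(\<Sum>l\<in>L. z l g) = 0" if "g \<in> G" for g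
        using z(4)[of g] zH[of g] by (cases "g \<in> H") auto
    qed
    then show ?thesis using min by (meson not_le)
  qed
qed

section \<open>Deciding the existence of a fractional matching\<close>

text \<open>A slot records its group and all bids that it received, latest first: the head of the list is
  the occupant and the length of the list is the price.\<close>

type_synonym ('l, 'g) slot = "'g \<times> 'l list"

section \<open>An auction that assigns units to slots\<close>

text \<open>The first component of the accumulator is an optional value: a list holding at most the
  cheapest adjacent slot seen so far. The second collects all other slots.\<close>

definition pick :: "('l \<Rightarrow> 'g \<Rightarrow> bool) \<Rightarrow> 'l \<Rightarrow> ('l, 'g) slot \<Rightarrow>
    ('l, 'g) slot list \<times> ('l, 'g) slot list \<Rightarrow> ('l, 'g) slot list \<times> ('l, 'g) slot list" where
  "pick adj l s a = (if adj l (fst s) then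
     (case fst a of [] \<Rightarrow> ([s], snd a)
      | b # bs \<Rightarrow> if length (snd s) < length (snd b) then ([s], b # snd a) else (fst a, s # snd a))
     else (fst a, s # snd a))"

definition extract_min :: "('l \<Rightarrow> 'g \<Rightarrow> bool) \<Rightarrow> 'l \<Rightarrow> ('l, 'g) slot list \<Rightarrow> ('l, 'g) slot list \<times> ('l, 'g) slot list" where
  "extract_min adj l slots = foldr (pick adj l) slots ([], [])"

text \<open>A first pending vertex without any adjacent slot leaves the state unchanged, so the
  failure stays visible in the list of pending vertices.\<close>

definition bid :: "('l \<Rightarrow> 'g \<Rightarrow> bool) \<Rightarrow> 'l list \<times> ('l, 'g) slot list \<Rightarrow> 'l list \<times> ('l, 'g) slot list" where
  "bid adj st = (case fst st of [] \<Rightarrow> st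
     | l # ps \<Rightarrow> (case fst (extract_min adj l (snd st)) of [] \<Rightarrow> st
        | b # bs \<Rightarrow> ((case snd b of [] \<Rightarrow> ps | x # h \<Rightarrow> x # ps),
            (fst b, l # snd b) # snd (extract_min adj l (snd st)))))"

text \<open>The folded list serves as a counter: its length is the square of the number of slots,
  which \<open>auction_complete\<close> shows to be enough bids.\<close>

definition auction :: "('l \<Rightarrow> 'g \<Rightarrow> bool) \<Rightarrow> 'l list \<Rightarrow> ('l, 'g) slot list \<Rightarrow> 'l list \<times> ('l, 'g) slot list" where
  "auction adj ps slots = foldr (\<lambda>_. bid adj) (concat (map (\<lambda>_. slots) slots)) (ps, slots)"

definition occupants :: "('l, 'g) slot list \<Rightarrow> 'l list" where
  "occupants slots = concat (map (\<lambda>s. take 1 (snd s)) slots)"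

lemma extract_min_spec:
  "extract_min adj l slots = (bs, rest) \<Longrightarrow>
     (bs = [] \<and> mset rest = mset slots \<and> (\<forall>s\<in>set slots. \<not> adj l (fst s))) \<or>
     (\<exists>b. bs = [b] \<and> mset slots = add_mset b (mset rest) \<and> adj l (fst b) \<and>
        (\<forall>s\<in>set slots. adj l (fst s) \<longrightarrow> length (snd b) \<le> length (snd s)))"
proof (induction slots arbitrary: bs rest)
  case Nil
  then show ?case by (simp add: extract_min_def)
next
  case (Cons s slots)
  obtain bs' rest' where e: "extract_min adj l slots = (bs', rest')" by fastforce
  have "pick adj l s (bs', rest') = (bs, rest)" using Cons.prems e by (simp add: extract_min_def)
  then have p: "(if adj l (fst s) then
     (case bs' of [] \<Rightarrow> ([s], rest')
      | b # _ \<Rightarrow> if length (snd s) < length (snd b) then ([s], b # rest') else (bs', s # rest'))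
     else (bs', s # rest')) = (bs, rest)" by (simp only: pick_def fst_conv snd_conv)
  from Cons.IH[OF e] show ?case
  proof (elim disjE exE conjE)
    assume "bs' = []" "mset rest' = mset slots" "\<forall>s\<in>set slots. \<not> adj l (fst s)"
    with p show ?thesis by (cases s, cases "adj l (fst s)") auto
  next
    fix b assume b: "bs' = [b]" "mset slots = add_mset b (mset rest')" "adj l (fst b)"
      "\<forall>s\<in>set slots. adj l (fst s) \<longrightarrow> length (snd b) \<le> length (snd s)"
    show ?thesis
    proof (cases "adj l (fst s) \<and> length (snd s) < length (snd b)")
      case True
      then have "bs = [s]" "rest = b # rest'" using p b(1) by auto
      then show ?thesis using True b by (intro disjI2 exI[of _ s]) (auto intro: order.trans[OF less_imp_le])
    next
      case False
      then have "bs = [b]" "rest = s # rest'" using p b(1) by (auto split: if_splits)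
      then show ?thesis using False b by (intro disjI2 exI[of _ b]) auto
    qed
  qed
qed

text \<open>The last conjunct is complementary slackness up to an error of one: an occupant sits in
  a slot at most one unit dearer than any slot it could use.\<close>

definition auction_inv :: "('l \<Rightarrow> 'g \<Rightarrow> bool) \<Rightarrow> 'l multiset \<Rightarrow> 'g multiset \<Rightarrow>
    'l list \<times> ('l, 'g) slot list \<Rightarrow> bool" where
  "auction_inv adj U W st \<longleftrightarrow>
     mset (fst st) + mset (occupants (snd st)) = U \<and> mset (map fst (snd st)) = W \<and>
     (\<forall>s\<in>set (snd st). snd s \<noteq> [] \<longrightarrow> adj (hd (snd s)) (fst s) \<and>
        (\<forall>s'\<in>set (snd st). adj (hd (snd s)) (fst s') \<longrightarrow> length (snd s) \<le> Suc (length (snd s'))))"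

lemma mset_occupants: "mset (occupants slots) = (\<Sum>s\<in>#mset slots. mset (take 1 (snd s)))"
  by (induction slots) (auto simp: occupants_def)

lemma bid_cases:
  assumes "fst st = l # ps" "s \<in> set (snd st)" "adj l (fst s)"
  obtains g h rest where "mset (snd st) = add_mset (g, h) (mset rest)" "adj l g"
    "\<And>s. s \<in> set (snd st) \<Longrightarrow> adj l (fst s) \<Longrightarrow> length h \<le> length (snd s)"
    "bid adj st = (take 1 h @ ps, (g, l # h) # rest)"
proof -
  obtain bs rest where e: "extract_min adj l (snd st) = (bs, rest)" by fastforce
  from extract_min_spec[OF e] obtain b where b: "bs = [b]" "mset (snd st) = add_mset b (mset rest)" "adj l (fst b)"
        "\<forall>s\<in>set (snd st). adj l (fst s) \<longrightarrow> length (snd b) \<le> length (snd s)" using assms(2,3) by blast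
  obtain g h where gh: "b = (g, h)" by fastforce
  have "bid adj st = (take 1 h @ ps, (g, l # h) # rest)"
    by (simp add: bid_def assms(1) e b(1) gh split: list.split)
  then show ?thesis using that b gh by auto
qed

lemma bid_stuck:
  assumes "fst st = l # ps" "\<And>s. s \<in> set (snd st) \<Longrightarrow> \<not> adj l (fst s)"
  shows "bid adj st = st"
proof -
  obtain bs rest where e: "extract_min adj l (snd st) = (bs, rest)" by fastforce
  have "bs = []" using extract_min_spec[OF e] assms(2) by (metis set_mset_mset union_single_eq_member)
  then show ?thesis by (simp add: bid_def assms(1) e)
qed

text \<open>The bidder takes a cheapest slot and raises it by one, which is just the slack allowed
  to it; for all other occupants the alternatives only become dearer.\<close>

lemma auction_inv_bid:
  assumes I: "auction_inv adj U W st"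
  shows "auction_inv adj U W (bid adj st)"
proof (cases "fst st")
  case Nil
  then show ?thesis using I by (simp add: bid_def)
next
  case (Cons l ps)
  show ?thesis
  proof (cases "\<exists>s\<in>set (snd st). adj l (fst s)")
    case False
    then show ?thesis using bid_stuck[of st l ps adj] Cons I by metis
  next
    case True
    then obtain s where "s \<in> set (snd st)" "adj l (fst s)" by blast
    with Cons obtain g h rest where b: "mset (snd st) = add_mset (g, h) (mset rest)" "adj l g"
      "\<And>s. s \<in> set (snd st) \<Longrightarrow> adj l (fst s) \<Longrightarrow> length h \<le> length (snd s)"
      "bid adj st = (take 1 h @ ps, (g, l # h) # rest)" using bid_cases[of st l ps s adj] by blast
    have st: "set (snd st) = insert (g, h) (set rest)" using b(1) by (metis set_mset_add_mset_insert set_mset_mset)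
    have "mset (take 1 h @ ps) + mset (occupants ((g, l # h) # rest)) = U"
      using I unfolding auction_inv_def mset_occupants b(1) by (simp add: Cons ac_simps)
    moreover have "mset (map fst ((g, l # h) # rest)) = W"
      using I b(1) unfolding auction_inv_def by (simp only: mset_map) simp
    moreover have "adj (hd (snd s)) (fst s) \<and>
        (\<forall>s'\<in>set ((g, l # h) # rest). adj (hd (snd s)) (fst s') \<longrightarrow> length (snd s) \<le> Suc (length (snd s')))"
      if s: "s \<in> set ((g, l # h) # rest)" "snd s \<noteq> []" for s
    proof (cases "s = (g, l # h)")
      case True
      then show ?thesis using b(2,3) st by auto
    next
      case False
      then have "s \<in> set (snd st)" using s st by auto
      then have *: "adj (hd (snd s)) (fst s)"
        "\<And>s'. s' \<in> set (snd st) \<Longrightarrow> adj (hd (snd s)) (fst s') \<Longrightarrow> length (snd s) \<le> Suc (length (snd s'))"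
        using I s(2) unfolding auction_inv_def by auto
      show ?thesis using *(1) *(2)[of "(g, h)"] *(2) st by auto
    qed
    ultimately show ?thesis unfolding auction_inv_def b(4) by auto
  qed
qed

lemma sum_length_filter_eq:
  "finite G \<Longrightarrow> (\<Sum>g\<in>G. length (filter (\<lambda>s. f s = g \<and> Q s) xs)) = length (filter (\<lambda>s. f s \<in> G \<and> Q s) xs)"
proof (induction xs)
  case (Cons x xs)
  have "(\<Sum>g\<in>G. length (filter (\<lambda>s. f s = g \<and> Q s) (x # xs)))
     = (\<Sum>g\<in>G. (if f x = g then (if Q x then 1 else 0) else 0) + length (filter (\<lambda>s. f s = g \<and> Q s) xs))"
    by (intro sum.cong) auto
  then show ?case using Cons by (simp add: sum.distrib)
qed simp

lemma count_occupants:
  "count (mset (occupants slots)) l = length (filter (\<lambda>s. snd s \<noteq> [] \<and> hd (snd s) = l) slots)"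
proof (induction slots)
  case (Cons s slots)
  then show ?case by (cases "snd s") (auto simp: occupants_def)
qed (simp add: occupants_def)

text \<open>The weight of \<open>(l, g)\<close> is the number of slots of \<open>g\<close> occupied
  by \<open>l\<close>. With nothing pending, all \<open>k\<close> units of each left vertex are
  placed.\<close>

lemma auction_inv_Nil_imp_feasible:
  assumes I: "auction_inv adj U W ([], slots)" and fin: "finite L" "finite G"
    and U: "\<And>l. l \<in> L \<Longrightarrow> count U l = k"
    and W: "\<And>g. g \<in> G \<Longrightarrow> count W g = cap g" "set_mset W \<subseteq> G"
  shows "feasible adj cap k L G"
proof -
  define x where "x l g = real (length (filter (\<lambda>s. fst s = g \<and> snd s \<noteq> [] \<and> hd (snd s) = l) slots))" for l g
  have "fractional_matching adj cap k L G x" unfolding fractional_matching_def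
  proof (intro conjI ballI impI)
    fix l g assume lg: "l \<in> L" "g \<in> G" "x l g \<noteq> 0"
    then have "filter (\<lambda>s. fst s = g \<and> snd s \<noteq> [] \<and> hd (snd s) = l) slots \<noteq> []" by (auto simp: x_def)
    then obtain s where "s \<in> set slots" "fst s = g" "snd s \<noteq> []" "hd (snd s) = l"
      by (auto simp: filter_empty_conv)
    then show "adj l g" using I unfolding auction_inv_def by auto
  next
    fix l assume l: "l \<in> L"
    have G: "fst s \<in> G" if "s \<in> set slots" for s
      using I W(2) that unfolding auction_inv_def by fastforce
    have "(\<Sum>g\<in>G. x l g) = real (length (filter (\<lambda>s. fst s \<in> G \<and> snd s \<noteq> [] \<and> hd (snd s) = l) slots))"
      unfolding x_def of_nat_sum[symmetric] sum_length_filter_eq[OF fin(2), of fst] ..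
    also have "filter (\<lambda>s. fst s \<in> G \<and> snd s \<noteq> [] \<and> hd (snd s) = l) slots
        = filter (\<lambda>s. snd s \<noteq> [] \<and> hd (snd s) = l) slots" using G by (intro filter_cong) auto
    also have "length \<dots> = count U l" using I unfolding auction_inv_def by (auto simp: count_occupants)
    finally show "(\<Sum>g\<in>G. x l g) = real k" using U[OF l] by simp
  next
    fix g assume g: "g \<in> G"
    have "(\<Sum>l\<in>L. x l g) = real (\<Sum>l\<in>L. length (filter (\<lambda>s. hd (snd s) = l \<and> (fst s = g \<and> snd s \<noteq> [])) slots))"
      unfolding x_def of_nat_sum[symmetric] by (intro arg_cong[of _ _ real] sum.cong arg_cong[of _ _ length] filter_cong) auto
    also have "\<dots> = real (length (filter (\<lambda>s. hd (snd s) \<in> L \<and> fst s = g \<and> snd s \<noteq> []) slots))"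
      unfolding sum_length_filter_eq[OF fin(1), of "\<lambda>s. hd (snd s)"] ..
    also have "\<dots> \<le> real (length (filter (\<lambda>s. fst s = g) slots))"
    proof -
      have "filter (\<lambda>s. hd (snd s) \<in> L \<and> fst s = g \<and> snd s \<noteq> []) slots
         = filter (\<lambda>s. hd (snd s) \<in> L \<and> snd s \<noteq> []) (filter (\<lambda>s. fst s = g) slots)"
        unfolding filter_filter by (intro filter_cong) auto
      then show ?thesis by (simp only: length_filter_le of_nat_le_iff)
    qed
    also have "length (filter (\<lambda>s. fst s = g) slots) = count (mset (map fst slots)) g"
      by (induction slots) auto
    also have "\<dots> = cap g" using I W(1)[OF g] unfolding auction_inv_def by simp
    finally show "(\<Sum>l\<in>L. x l g) \<le> real (cap g)" .
  qed (simp add: x_def)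
  then show ?thesis unfolding feasible_def by blast
qed

text \<open>Ensures progress: while a unit is pending, the next bid goes to a slot priced below the
  number of slots, so no price ever exceeds that number.\<close>

lemma cheap_slot:
  assumes I: "auction_inv adj U W st" and fin: "finite L" "finite G"
    and U: "\<And>l. count U l = (if l \<in> L then k else 0)"
    and W: "\<And>g. g \<in> G \<Longrightarrow> count W g = cap g"
    and feas: "feasible adj cap k L G" and ps: "fst st = l # ps"
  shows "\<exists>s\<in>set (snd st). adj l (fst s) \<and> length (snd s) < length (snd st)"
proof (rule ccontr)
  define slots where "slots = snd st"
  define N where "N = length slots"
  assume "\<not> ?thesis"
  then have exp: "N \<le> length (snd s)" if "s \<in> set slots" "adj l (fst s)" for s
    using that by (auto simp: slots_def N_def not_less)
  define lev where "lev = (\<lambda>s. length (snd s)) ` set slots"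
  \<comment> \<open>By the pigeonhole principle some price level below all offers to \<open>l\<close> is empty; the slots
    above it then form a Hall obstruction.\<close>
  have "\<exists>j. j \<notin> lev \<and> (\<forall>s\<in>set slots. adj l (fst s) \<longrightarrow> j < length (snd s))"
  proof (cases "{..<N} \<subseteq> lev")
    case True
    have "card lev \<le> N" unfolding lev_def N_def using card_image_le card_length le_trans by blast
    then have "lev = {..<N}" using True card_subset_eq[of lev "{..<N}"] card_mono[OF _ True]
      by (simp add: lev_def)
    then show ?thesis using exp by (intro exI[of _ N]) (force simp: lev_def)
  next
    case False
    then obtain j where "j < N" "j \<notin> lev" by auto
    then show ?thesis using exp by (intro exI[of _ j]) (auto intro: less_le_trans)
  qed
  then obtain j where j: "j \<notin> lev" "\<And>s. s \<in> set slots \<Longrightarrow> adj l (fst s) \<Longrightarrow> j < length (snd s)" by blast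
  define Hi where "Hi = filter (\<lambda>s. j < length (snd s)) slots"
  define A where "A = insert l (set (occupants Hi))"
  define B where "B = {g \<in> G. \<exists>l'\<in>A. adj l' g}"
  have finB: "finite B" using fin by (simp add: B_def)
  have occ_len: "length (occupants Hi) = length Hi"
  proof -
    have "length (occupants xs) = length xs" if "\<forall>s\<in>set xs. snd s \<noteq> []" for xs :: "('a, 'b) slot list"
      using that by (induction xs) (auto simp: occupants_def Suc_le_eq)
    moreover have "\<forall>s\<in>set Hi. snd s \<noteq> []" by (auto simp: Hi_def)
    ultimately show ?thesis by blast
  qed
  have occ_mem: "\<exists>s\<in>set Hi. snd s \<noteq> [] \<and> hd (snd s) = l'" if l': "l' \<in> set (occupants Hi)" for l'
  proof -
    obtain s where "s \<in> set Hi" "l' \<in> set (take 1 (snd s))" using l' by (auto simp: occupants_def)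
    then show ?thesis by (intro bexI[of _ s]) (cases "snd s"; auto)+
  qed
  \<comment> \<open>\<open>Hi\<close> is closed: a slot adjacent to an occupant of a slot dearer
    than \<open>j\<close> has price at least \<open>j\<close> by slackness, and price
    \<open>j\<close> does not occur.\<close>
  have up: "s \<in> set Hi" if s: "s \<in> set slots" "l' \<in> A" "adj l' (fst s)" for s l'
  proof (cases "l' = l")
    case True
    then show ?thesis using s j(2) by (auto simp: Hi_def)
  next
    case False
    then have "l' \<in> set (occupants Hi)" using s(2) by (simp add: A_def)
    from occ_mem[OF this] obtain r where r: "r \<in> set Hi" "snd r \<noteq> []" "hd (snd r) = l'" by blast
    then have "length (snd r) \<le> Suc (length (snd s))"
      using I s(1,3) unfolding auction_inv_def slots_def[symmetric] by (auto simp: Hi_def)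
    moreover have "j < length (snd r)" using r(1) by (simp add: Hi_def)
    moreover have "length (snd s) \<noteq> j" using j(1) s(1) by (auto simp: lev_def)
    ultimately show ?thesis using s(1) by (simp add: Hi_def)
  qed
  have "mset Hi \<subseteq># mset slots" by (simp add: Hi_def)
  then have "mset (occupants Hi) \<subseteq># mset (occupants slots)"
    unfolding mset_occupants by (metis mset_subset_eq_exists_conv image_mset_union sum_mset.union)
  then have "add_mset l (mset (occupants Hi)) \<subseteq># U"
    using I ps unfolding auction_inv_def slots_def[symmetric]
    by (auto simp: subset_mset.add_increasing)
  note sub = this
  then have cnt: "count (add_mset l (mset (occupants Hi))) l' \<le> count U l'" for l' by (rule mset_subset_eq_count)
  have AL: "A \<subseteq> L"
  proof
    fix l' assume "l' \<in> A"
    then have "l' \<in># add_mset l (mset (occupants Hi))" by (auto simp: A_def)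
    then have "l' \<in># U" using sub by (rule mset_subset_eqD[rotated])
    then show "l' \<in> L" using U[of l'] by (auto simp flip: count_greater_zero_iff split: if_splits)
  qed
  \<comment> \<open>The pending unit of \<open>l\<close> and one unit per slot of \<open>Hi\<close>
    all belong to vertices of \<open>A\<close>, whose total demand is \<open>card A * k\<close>; the
    pending unit makes the inequality strict.\<close>
  have "size (add_mset l (mset (occupants Hi))) = (\<Sum>l'\<in>A. count (add_mset l (mset (occupants Hi))) l')"
    unfolding size_multiset_overloaded_eq by (simp add: A_def)
  also have "\<dots> \<le> (\<Sum>l'\<in>A. count U l')" by (intro sum_mono cnt)
  also have "\<dots> = (\<Sum>l'\<in>A. k)" using U AL by (intro sum.cong) auto
  finally have up_bound: "length Hi < card A * k" using occ_len by simp
  obtain x where x: "fractional_matching adj cap k L G x" using feas unfolding feasible_def by blast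
  note x = x[unfolded fractional_matching_def]
  \<comment> \<open>Conversely, the fractional matching needs at least \<open>card A * k\<close>
    slots in groups adjacent to \<open>A\<close>, and all of these slots lie in
    \<open>Hi\<close>.\<close>
  have "real (card A * k) = (\<Sum>l'\<in>A. \<Sum>g\<in>G. x l' g)" using x AL by (simp add: subset_iff)
  also have "\<dots> = (\<Sum>l'\<in>A. \<Sum>g\<in>B. x l' g)"
  proof (rule sum.cong[OF refl])
    fix l' assume l': "l' \<in> A"
    have "x l' g = 0" if "g \<in> G - B" for g
    proof -
      have "\<not> adj l' g" using that l' by (auto simp: B_def)
      then show ?thesis using x l' AL that by blast
    qed
    then show "(\<Sum>g\<in>G. x l' g) = (\<Sum>g\<in>B. x l' g)"
      by (intro sum.mono_neutral_right) (auto simp: fin B_def)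
  qed
  also have "\<dots> = (\<Sum>g\<in>B. \<Sum>l'\<in>A. x l' g)" by (rule sum.swap)
  also have "\<dots> \<le> (\<Sum>g\<in>B. real (cap g))"
  proof (rule sum_mono)
    fix g assume g: "g \<in> B"
    then have gG: "g \<in> G" by (simp add: B_def)
    have "(\<Sum>l'\<in>A. x l' g) \<le> (\<Sum>l'\<in>L. x l' g)" using x gG AL fin(1) by (intro sum_mono2) auto
    also have "\<dots> \<le> real (cap g)" using x gG by blast
    finally show "(\<Sum>l'\<in>A. x l' g) \<le> real (cap g)" .
  qed
  also have "\<dots> = real (\<Sum>g\<in>B. length (filter (\<lambda>s. fst s = g \<and> True) slots))"
  proof -
    have "cap g = length (filter (\<lambda>s. fst s = g \<and> True) slots)" if "g \<in> B" for g
    proof -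
      have "count (mset (map fst slots)) g = length (filter (\<lambda>s. fst s = g) slots)"
        by (induction slots) auto
      then show ?thesis using W[of g] that I unfolding auction_inv_def slots_def[symmetric] by (simp add: B_def)
    qed
    then show ?thesis by (simp flip: of_nat_sum)
  qed
  also have "\<dots> = real (length (filter (\<lambda>s. fst s \<in> B \<and> True) slots))"
    unfolding sum_length_filter_eq[OF finB] ..
  also have "\<dots> \<le> real (length Hi)"
  proof -
    have "filter (\<lambda>s. fst s \<in> B \<and> True) slots = filter (\<lambda>s. fst s \<in> B) Hi"
      using up unfolding Hi_def filter_filter by (intro filter_cong) (auto simp: B_def)
    then show ?thesis by simp
  qed
  finally show False using up_bound by linarith
qed

text \<open>Every bid raises the total price by one. While a unit is pending, no slot costs more
  than \<open>N\<close> and some slot costs less, so the total stays below \<open>N * N\<close>, the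
  number of bids.\<close>

lemma auction_complete:
  assumes fin: "finite L" "finite G"
    and U: "\<And>l. count (mset ps) l = (if l \<in> L then k else 0)"
    and W: "\<And>g. g \<in> G \<Longrightarrow> count (mset (map fst slots)) g = cap g"
    and empty: "\<And>s. s \<in> set slots \<Longrightarrow> snd s = []"
    and feas: "feasible adj cap k L G"
  shows "fst (auction adj ps slots) = []"
proof -
  define N where "N = length slots"
  define price where "price st = (\<Sum>s\<in>#mset (snd st). length (snd s))" for st :: "'a list \<times> ('a, 'b) slot list"
  define Inv where "Inv st \<longleftrightarrow> auction_inv adj (mset ps) (mset (map fst slots)) st \<and>
     (\<forall>s\<in>set (snd st). length (snd s) \<le> N)" for st
  have occ0: "occupants slots = []" using empty by (auto simp: occupants_def)
  have Inv0: "Inv (ps, slots)" using empty by (auto simp: Inv_def auction_inv_def occ0)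
  have len: "length (snd st) = N" if "Inv st" for st
  proof -
    have "mset (map fst (snd st)) = mset (map fst slots)" using that unfolding Inv_def auction_inv_def by blast
    from arg_cong[OF this, of size] show ?thesis by (simp add: N_def)
  qed
  have step: "Inv (bid adj st) \<and> (fst st = [] \<longrightarrow> fst (bid adj st) = []) \<and> (fst st \<noteq> [] \<longrightarrow> price (bid adj st) = Suc (price st))"
    if I: "Inv st" for st
  proof (cases "fst st")
    case Nil
    then show ?thesis using I by (simp add: bid_def)
  next
    case (Cons l ps')
    obtain s where s: "s \<in> set (snd st)" "adj l (fst s)" "length (snd s) < N"
      using cheap_slot[OF _ fin U W feas Cons] I len[OF I] unfolding Inv_def by auto
    obtain g h rest where b: "mset (snd st) = add_mset (g, h) (mset rest)" "adj l g"
      "\<And>s. s \<in> set (snd st) \<Longrightarrow> adj l (fst s) \<Longrightarrow> length h \<le> length (snd s)"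
      "bid adj st = (take 1 h @ ps', (g, l # h) # rest)" using bid_cases[of st l ps' s adj] Cons s by blast
    have "length h < N" using b(3)[OF s(1,2)] s(3) by simp
    moreover have st: "set (snd st) = insert (g, h) (set rest)" using b(1) by (metis set_mset_add_mset_insert set_mset_mset)
    ultimately have "Inv (bid adj st)" using auction_inv_bid[of adj _ _ st] I unfolding Inv_def
      by (auto simp: b(4))
    moreover have "price (bid adj st) = Suc (price st)" unfolding price_def b(1) by (simp add: b(4))
    ultimately show ?thesis using Cons by simp
  qed
  have iter: "Inv (foldr (\<lambda>_. bid adj) xs (ps, slots)) \<and>
      (fst (foldr (\<lambda>_. bid adj) xs (ps, slots)) = [] \<or> length xs \<le> price (foldr (\<lambda>_. bid adj) xs (ps, slots)))"
    for xs :: "'c list"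
  proof (induction xs)
    case (Cons x xs)
    then show ?case using step[of "foldr (\<lambda>_. bid adj) xs (ps, slots)"] by fastforce
  qed (use Inv0 in auto)
  define st where "st = auction adj ps slots"
  have "length (concat (map (\<lambda>_. slots) slots)) = N * N"
    by (simp add: length_concat comp_def sum_list_triv N_def)
  then have *: "Inv st" "fst st = [] \<or> N * N \<le> price st"
    using iter[of "concat (map (\<lambda>_. slots) slots)"] unfolding st_def auction_def by auto
  show ?thesis
  proof (rule ccontr)
    assume "fst (auction adj ps slots) \<noteq> []"
    then obtain l ps' where lp: "fst st = l # ps'" unfolding st_def by (meson neq_Nil_conv)
    then obtain s where s: "s \<in> set (snd st)" "length (snd s) < N"
      using cheap_slot[OF _ fin U W feas lp] * len[of st] unfolding Inv_def by auto
    have "price st = sum_list (map (\<lambda>s. length (snd s)) (snd st))"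
      unfolding price_def by (simp add: sum_mset_sum_list[symmetric] flip: mset_map)
    also have "\<dots> < sum_list (map (\<lambda>_. N) (snd st))"
    proof -
      obtain xs ys where sp: "snd st = xs @ s # ys" using s(1) by (meson split_list)
      have le: "length (snd r) \<le> N" if "r \<in> set (snd st)" for r using * that unfolding Inv_def by auto
      show ?thesis unfolding sp using s(2) sum_list_mono[of xs "\<lambda>s. length (snd s)" "\<lambda>_. N"]
          sum_list_mono[of ys "\<lambda>s. length (snd s)" "\<lambda>_. N"] le[unfolded sp]
        by fastforce
    qed
    also have "\<dots> = N * N" using len[OF *(1)] by (simp add: sum_list_triv)
    finally show False using *(2) lp by simp
  qed
qed

lemma auction_sound:
  assumes fin: "finite L" "finite G"
    and U: "\<And>l. l \<in> L \<Longrightarrow> count (mset ps) l = k"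
    and W: "\<And>g. g \<in> G \<Longrightarrow> count (mset (map fst slots)) g = cap g" "fst ` set slots \<subseteq> G"
    and empty: "\<And>s. s \<in> set slots \<Longrightarrow> snd s = []"
    and success: "fst (auction adj ps slots) = []"
  shows "feasible adj cap k L G"
proof -
  have "occupants slots = []" using empty by (auto simp: occupants_def)
  then have 0: "auction_inv adj (mset ps) (mset (map fst slots)) (ps, slots)"
    using empty by (auto simp: auction_inv_def)
  have "auction_inv adj (mset ps) (mset (map fst slots)) (foldr (\<lambda>_. bid adj) xs (ps, slots))" for xs :: "'c list"
    by (induction xs) (use 0 in \<open>auto intro: auction_inv_bid\<close>)
  then have "auction_inv adj (mset ps) (mset (map fst slots)) (auction adj ps slots)"
    unfolding auction_def .
  then have "auction_inv adj (mset ps) (mset (map fst slots)) ([], snd (auction adj ps slots))"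
    using success by (metis prod.collapse)
  from auction_inv_Nil_imp_feasible[OF this fin U W(1)] W(2) show ?thesis by auto
qed

section \<open>The algorithm\<close>

text \<open>The case \<open>l = v\<close> corresponds to a vertex that stays in place under
  \<open>escape\<close>.\<close>

definition adjacent :: "(nat \<times> nat) list \<Rightarrow> nat \<Rightarrow> nat list \<Rightarrow> bool" where
  "adjacent es l g \<longleftrightarrow> (\<exists>v\<in>set g. l = v \<or> (l, v) \<in> set es)"

definition marked :: "nat list \<Rightarrow> nat list \<Rightarrow> nat list" where
  "marked ss g = filter (\<lambda>v. v \<in> set ss) g"

type_synonym state = "nat list \<times> nat list list"

text \<open>The number \<open>k\<close> is represented in unary, as the length of a list \<open>ks\<close>.\<close>

definition units :: "nat list \<Rightarrow> nat list \<Rightarrow> nat list" where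
  "units ks L = concat (map (\<lambda>l. map (\<lambda>_. l) ks) L)"

text \<open>One slot per unit of capacity, with no bids yet; \<open>drop\<close> computes the
  truncated difference in unary.\<close>

definition slots_of :: "nat list \<Rightarrow> nat list \<Rightarrow> nat list list \<Rightarrow> (nat, nat list) slot list" where
  "slots_of ss ks G = concat (map (\<lambda>g. map (\<lambda>_. (g, [])) (drop (length (marked ss g)) ks)) G)"

definition accepts :: "(nat \<times> nat) list \<Rightarrow> nat list \<Rightarrow> nat list \<Rightarrow> state \<Rightarrow> bool" where
  "accepts es ss ks st \<longleftrightarrow> fst (auction (adjacent es) (units ks (fst st)) (slots_of ss ks (snd st))) = []"

text \<open>In a state \<open>(L, G)\<close>, \<open>L\<close> lists the left vertices that have not been removed and \<open>G\<close> the groups.\<close>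

definition matches :: "(nat \<times> nat) list \<Rightarrow> nat list \<Rightarrow> state \<Rightarrow> state list" where
  "matches es ss st = concat (map (\<lambda>l. concat (map (\<lambda>g.
     if adjacent es l g \<and> marked ss g = [] then [(filter (\<lambda>x. x \<noteq> l) (fst st), filter (\<lambda>h. h \<noteq> g) (snd st))] else [])
     (snd st))) (fst st))"

text \<open>The length conditions say that each group holds at most \<open>k - 1\<close> elements of
  \<open>S\<close>; this is the source of the bound \<open>2k - 2\<close>.\<close>

definition merges :: "(nat \<times> nat) list \<Rightarrow> nat list \<Rightarrow> nat list \<Rightarrow> state \<Rightarrow> state list" where
  "merges es ss ks st = concat (map (\<lambda>l. concat (map (\<lambda>g. concat (map (\<lambda>g'.
     if g \<noteq> g' \<and> adjacent es l g \<and> adjacent es l g' \<and>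
        length (marked ss g) < length ks \<and> length (marked ss g') < length ks
     then [(filter (\<lambda>x. x \<noteq> l) (fst st), (g @ g') # filter (\<lambda>h. h \<noteq> g \<and> h \<noteq> g') (snd st))] else [])
     (snd st))) (snd st))) (fst st))"

text \<open>Without an accepted candidate the state is kept; for sound states this happens only when
  no left vertex remains, by \<open>sound_state_move\<close>.\<close>

definition move :: "(nat \<times> nat) list \<Rightarrow> nat list \<Rightarrow> nat list \<Rightarrow> state \<Rightarrow> state" where
  "move es ss ks st = (case filter (accepts es ss ks) (matches es ss st @ merges es ss ks st) of
     [] \<Rightarrow> st | c # cs \<Rightarrow> c)"

definition initial :: "nat list \<Rightarrow> nat list \<Rightarrow> state" where
  "initial vs zs = (filter (\<lambda>v. v \<notin> set zs) vs, map (\<lambda>v. [v]) vs)"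

text \<open>Tries the lengths from \<open>2\<close> to \<open>length ss + 2\<close>, since
  \<open>k\<close> is not part of the input. The list \<open>ss\<close> only bounds the number of
  rounds, and the entries \<open>0\<close> are dummies.\<close>

definition find_k :: "(nat \<times> nat) list \<Rightarrow> nat list \<Rightarrow> state \<Rightarrow> nat list" where
  "find_k es ss st = foldr (\<lambda>_ ks. if accepts es ss ks st then ks else 0 # ks) ss [0, 0]"

text \<open>Each move removes a left vertex, so one round per vertex is enough. At the end the
  groups are restricted to \<open>S\<close> and empty ones discarded.\<close>

definition solve :: "nat list \<Rightarrow> (nat \<times> nat) list \<Rightarrow> nat list \<Rightarrow> nat list \<Rightarrow> nat list list" where
  "solve vs es ss zs = filter (\<lambda>g. g \<noteq> []) (map (marked ss)
     (snd (foldr (\<lambda>_. move es ss (find_k es ss (initial vs zs))) vs (initial vs zs))))"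

section \<open>Polynomial running time of the algorithm\<close>

abbreviation "enc_nats \<equiv> enc_list enc_nat"
abbreviation "enc_arcs \<equiv> enc_list (enc_prod enc_nat enc_nat)"
abbreviation "enc_state \<equiv> enc_prod enc_nats (enc_list enc_nats)"
abbreviation "enc_slots \<equiv> enc_list (enc_prod enc_nats enc_nats)"

lemmas polytime_proj = polytime_id polytime_fst polytime_snd

lemma polytime_length_less:
  assumes "polytime ee (enc_list ex) xs" "polytime ee (enc_list ey) ys"
  shows "polytime ee enc_bool (\<lambda>e. length (xs e) < length (ys e))"
proof -
  have "(\<lambda>e. length (xs e) < length (ys e)) = (\<lambda>e. \<not> drop (length (xs e)) (ys e) = [])" by auto
  then show ?thesis using polytime_not[OF polytime_null[OF polytime_drop[OF assms]]] by simp
qed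

lemmas polytime_nat_eq = polytime_eq[OF enc_nat_inj]
lemmas polytime_nats_eq = polytime_eq[OF enc_list_inj[OF enc_nat_inj]]
lemmas polytime_nat_mem = polytime_mem[OF enc_nat_inj]
lemmas polytime_arc_mem = polytime_mem[OF enc_prod_inj[OF enc_nat_inj enc_nat_inj]]

text \<open>The function is first treated on a tuple of its arguments, where the closure rules apply
  along its definition, and then composed with arbitrary argument functions. The rules below follow
  the same pattern.\<close>

lemma polytime_nadj:
  assumes "polytime ee enc_arcs es" "polytime ee enc_nat l" "polytime ee enc_nats g"
  shows "polytime ee enc_bool (\<lambda>e. adjacent (es e) (l e) (g e))"
proof -
  have "polytime (enc_prod enc_arcs (enc_prod enc_nat enc_nats)) enc_bool
     (\<lambda>p. adjacent (fst p) (fst (snd p)) (snd (snd p)))"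
    unfolding adjacent_def
    by (rule polytime_Bex polytime_disj polytime_nat_eq polytime_arc_mem polytime_pair polytime_proj)+
  from polytime_comp[OF this polytime_pair[OF assms(1) polytime_pair[OF assms(2,3)]]] show ?thesis by simp
qed

lemma polytime_marked:
  assumes "polytime ee enc_nats ss" "polytime ee enc_nats g"
  shows "polytime ee enc_nats (\<lambda>e. marked (ss e) (g e))"
proof -
  have "polytime (enc_prod enc_nats enc_nats) enc_nats (\<lambda>p. marked (fst p) (snd p))"
    unfolding marked_def by (rule polytime_filter polytime_nat_mem polytime_proj)+
  from polytime_comp[OF this polytime_pair[OF assms]] show ?thesis by simp
qed

lemma polytime_pick:
  assumes "polytime ee enc_arcs es" "polytime ee enc_nat l" "polytime ee (enc_prod enc_nats enc_nats) s"
    "polytime ee (enc_prod enc_slots enc_slots) a"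
  shows "polytime ee (enc_prod enc_slots enc_slots) (\<lambda>e. pick (adjacent (es e)) (l e) (s e) (a e))"
proof -
  have "polytime (enc_prod enc_arcs (enc_prod enc_nat (enc_prod (enc_prod enc_nats enc_nats) (enc_prod enc_slots enc_slots))))
     (enc_prod enc_slots enc_slots)
     (\<lambda>p. pick (adjacent (fst p)) (fst (snd p)) (fst (snd (snd p))) (snd (snd (snd p))))"
    unfolding pick_def
    by (rule polytime_if polytime_case_list polytime_nadj polytime_pair polytime_Cons polytime_const polytime_length_less polytime_proj)+
  from polytime_comp[OF this polytime_pair[OF assms(1) polytime_pair[OF assms(2) polytime_pair[OF assms(3,4)]]]]
  show ?thesis by simp
qed

text \<open>A \<open>pick\<close> step adds one slot to the accumulator and otherwise rearranges it,
  so the growth is bounded by the size of one input entry.\<close>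

lemma polytime_extract_min:
  assumes "polytime ee enc_arcs es" "polytime ee enc_nat l" "polytime ee enc_slots slots"
  shows "polytime ee (enc_prod enc_slots enc_slots) (\<lambda>e. extract_min (adjacent (es e)) (l e) (slots e))"
proof -
  have "polytime (enc_prod enc_arcs (enc_prod enc_nat enc_slots)) (enc_prod enc_slots enc_slots)
     (\<lambda>p. foldr (pick (adjacent (fst p)) (fst (snd p))) (snd (snd p)) ([], []))"
  proof (rule polytime_foldr[where Inv = "\<lambda>_ _. True" and b = "[:5, 1:]" and ex = "enc_prod enc_nats enc_nats"])
    fix e :: "(nat \<times> nat) list \<times> nat \<times> (nat, nat list) slot list" and x a
    assume "x \<in> set (snd (snd e))"
    from size_enc_list_mem[OF this, of "enc_prod enc_nats enc_nats"]
    show "size (enc_prod enc_slots enc_slots (pick (adjacent (fst e)) (fst (snd e)) x a))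
         \<le> size (enc_prod enc_slots enc_slots a) +
            poly [:5, 1:] (size (enc_prod enc_arcs (enc_prod enc_nat enc_slots) e))"
      by (auto simp: pick_def split: list.split)
  qed (rule polytime_pick polytime_const polytime_proj TrueI)+
  from polytime_comp[OF this polytime_pair[OF assms(1) polytime_pair[OF assms(2,3)]]]
  show ?thesis by (simp add: extract_min_def)
qed

lemma polytime_bid:
  assumes "polytime ee enc_arcs es" "polytime ee (enc_prod enc_nats enc_slots) st"
  shows "polytime ee (enc_prod enc_nats enc_slots) (\<lambda>e. bid (adjacent (es e)) (st e))"
proof -
  have "polytime (enc_prod enc_arcs (enc_prod enc_nats enc_slots)) (enc_prod enc_nats enc_slots)
     (\<lambda>p. bid (adjacent (fst p)) (snd p))"
    unfolding bid_def
    by (rule polytime_case_list polytime_extract_min polytime_pair polytime_Cons polytime_proj)+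
  from polytime_comp[OF this polytime_pair[OF assms]] show ?thesis by simp
qed

lemma size_enc_list_mset: "size (enc_list ex xs) = (\<Sum>x\<in>#mset xs. size (ex x) + 1)"
  by (induction xs) auto

text \<open>A bid adds a copy of the bidder to the history of one slot. No new vertices appear in
  the state, so one bound \<open>M\<close> on their sizes serves throughout the auction.\<close>

lemma size_bid:
  assumes M: "\<And>l. l \<in> set (fst st) \<union> (\<Union>s\<in>set (snd st). set (snd s)) \<Longrightarrow> size (enc_nat l) \<le> M"
  shows "size (enc_prod enc_nats enc_slots (bid adj st)) \<le> size (enc_prod enc_nats enc_slots st) + (2 * M + 5)"
    "set (fst (bid adj st)) \<union> (\<Union>s\<in>set (snd (bid adj st)). set (snd s))
       \<subseteq> set (fst st) \<union> (\<Union>s\<in>set (snd st). set (snd s))"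
proof -
  have "size (enc_prod enc_nats enc_slots (bid adj st)) \<le> size (enc_prod enc_nats enc_slots st) + (2 * M + 5) \<and>
    set (fst (bid adj st)) \<union> (\<Union>s\<in>set (snd (bid adj st)). set (snd s))
       \<subseteq> set (fst st) \<union> (\<Union>s\<in>set (snd st). set (snd s))"
  proof (cases "fst st")
    case Nil
    then show ?thesis by (simp add: bid_def)
  next
    case (Cons l ps)
    show ?thesis
    proof (cases "\<exists>s\<in>set (snd st). adj l (fst s)")
      case False
      then have "bid adj st = st" using bid_stuck[of st l ps adj] Cons by metis
      then show ?thesis by simp
    next
      case True
      then obtain s where "s \<in> set (snd st)" "adj l (fst s)" by blast
      with Cons obtain g h rest where b: "mset (snd st) = add_mset (g, h) (mset rest)"
        "bid adj st = (take 1 h @ ps, (g, l # h) # rest)" using bid_cases[of st l ps s adj] by metis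
      have st: "set (snd st) = insert (g, h) (set rest)" using b(1) by (metis set_mset_add_mset_insert set_mset_mset)
      have "size (enc_nats (take 1 h)) \<le> M + 1" using M st by (cases h) auto
      moreover have "size (enc_nat l) \<le> M" using M Cons by simp
      moreover have "size (enc_slots (snd st)) = size (enc_nats g) + size (enc_nats h) + 2 + size (enc_slots rest)"
        unfolding size_enc_list_mset[of "enc_prod enc_nats enc_nats"] b(1) by simp
      moreover have "set (take 1 h) \<subseteq> set h" by (rule set_take_subset)
      ultimately show ?thesis using Cons st by (auto simp: b(2))
    qed
  qed
  then show "size (enc_prod enc_nats enc_slots (bid adj st)) \<le> size (enc_prod enc_nats enc_slots st) + (2 * M + 5)"
    "set (fst (bid adj st)) \<union> (\<Union>s\<in>set (snd (bid adj st)). set (snd s))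
       \<subseteq> set (fst st) \<union> (\<Union>s\<in>set (snd st). set (snd s))" by blast+
qed

lemma polytime_auction:
  assumes "polytime ee enc_arcs es" "polytime ee enc_nats ps" "polytime ee enc_slots slots"
  shows "polytime ee (enc_prod enc_nats enc_slots) (\<lambda>e. auction (adjacent (es e)) (ps e) (slots e))"
proof -
  let ?e = "enc_prod enc_arcs (enc_prod enc_nats enc_slots)"
  let ?els = "\<lambda>st :: nat list \<times> (nat, nat list) slot list. set (fst st) \<union> (\<Union>s\<in>set (snd st). set (snd s))"
  have init: "size (enc_nat l) \<le> size (?e e)" if "l \<in> ?els (snd e)" for l e
    using that
  proof
    assume "l \<in> set (fst (snd e))"
    from size_enc_list_mem[OF this, of enc_nat] show ?thesis by simp
  next
    assume "l \<in> (\<Union>s\<in>set (snd (snd e)). set (snd s))"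
    then obtain s where s: "s \<in> set (snd (snd e))" "l \<in> set (snd s)" by blast
    from size_enc_list_mem[OF s(1), of "enc_prod enc_nats enc_nats"] size_enc_list_mem[OF s(2), of enc_nat]
    show ?thesis by simp
  qed
  have "polytime ?e (enc_prod enc_nats enc_slots)
    (\<lambda>p. foldr (\<lambda>_. bid (adjacent (fst p))) (concat (map (\<lambda>_. snd (snd p)) (snd (snd p)))) (snd p))"
  \<comment> \<open>The invariant bounds the size of each vertex in the state by the input size,
    which \<open>size_bid\<close> preserves; this makes the growth per bid linear in the
    input.\<close>
  proof (rule polytime_foldr[where ex = "enc_prod enc_nats enc_nats" and b = "[:5, 2:]" and
        Inv = "\<lambda>e st. \<forall>l\<in>?els st. size (enc_nat l) \<le> size (?e e)"])
    show "polytime ?e enc_slots (\<lambda>p. concat (map (\<lambda>_. snd (snd p)) (snd (snd p))))"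
      by (rule polytime_concat_map polytime_proj)+
    show "polytime (enc_prod ?e (enc_prod (enc_prod enc_nats enc_nats) (enc_prod enc_nats enc_slots)))
      (enc_prod enc_nats enc_slots) (\<lambda>p. bid (adjacent (fst (fst p))) (snd (snd p)))"
      by (rule polytime_bid polytime_proj)+
    show "\<forall>l\<in>?els (snd e). size (enc_nat l) \<le> size (?e e)" for e using init by blast
    fix e st assume I: "\<forall>l\<in>?els st. size (enc_nat l) \<le> size (?e e)"
    then show "\<forall>l\<in>?els (bid (adjacent (fst e)) st). size (enc_nat l) \<le> size (?e e)"
      using size_bid(2)[of st "size (?e e)" "adjacent (fst e)"] by blast
    show "size (enc_prod enc_nats enc_slots (bid (adjacent (fst e)) st))
      \<le> size (enc_prod enc_nats enc_slots st) + poly [:5, 2:] (size (?e e))"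
      using size_bid(1)[of st "size (?e e)" "adjacent (fst e)"] I by simp
  qed (rule polytime_proj)+
  from polytime_comp[OF this polytime_pair[OF assms(1) polytime_pair[OF assms(2,3)]]]
  show ?thesis by (simp add: auction_def)
qed

lemma polytime_accepts:
  assumes "polytime ee enc_arcs es" "polytime ee enc_nats ss" "polytime ee enc_nats ks" "polytime ee enc_state st"
  shows "polytime ee enc_bool (\<lambda>e. accepts (es e) (ss e) (ks e) (st e))"
proof -
  have "polytime (enc_prod enc_arcs (enc_prod enc_nats (enc_prod enc_nats enc_state))) enc_bool
    (\<lambda>p. accepts (fst p) (fst (snd p)) (fst (snd (snd p))) (snd (snd (snd p))))"
    unfolding accepts_def units_def slots_of_def
    by (rule polytime_null[where ex = enc_nat] polytime_fst[where eb = enc_slots] polytime_auction polytime_concat_map polytime_map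
      polytime_drop polytime_marked polytime_pair polytime_const polytime_proj)+
  from polytime_comp[OF this polytime_pair[OF assms(1) polytime_pair[OF assms(2) polytime_pair[OF assms(3,4)]]]]
  show ?thesis by simp
qed

lemma polytime_move:
  assumes "polytime ee enc_arcs es" "polytime ee enc_nats ss" "polytime ee enc_nats ks" "polytime ee enc_state st"
  shows "polytime ee enc_state (\<lambda>e. move (es e) (ss e) (ks e) (st e))"
proof -
  have "polytime (enc_prod enc_arcs (enc_prod enc_nats (enc_prod enc_nats enc_state))) enc_state
    (\<lambda>p. move (fst p) (fst (snd p)) (fst (snd (snd p))) (snd (snd (snd p))))"
    unfolding move_def matches_def merges_def
    by (rule polytime_case_list polytime_filter polytime_append polytime_accepts polytime_concat_map polytime_if polytime_conj polytime_not
       polytime_nat_eq polytime_nats_eq polytime_nadj polytime_null[where ex = enc_nat] polytime_marked polytime_length_less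
      polytime_Cons polytime_pair polytime_const polytime_proj)+
  from polytime_comp[OF this polytime_pair[OF assms(1) polytime_pair[OF assms(2) polytime_pair[OF assms(3,4)]]]]
  show ?thesis by simp
qed

lemma polytime_find_k:
  assumes "polytime ee enc_arcs es" "polytime ee enc_nats ss" "polytime ee enc_state st"
  shows "polytime ee enc_nats (\<lambda>e. find_k (es e) (ss e) (st e))"
proof -
  have "polytime (enc_prod enc_arcs (enc_prod enc_nats enc_state)) enc_nats
    (\<lambda>p. foldr (\<lambda>_ ks. if accepts (fst p) (fst (snd p)) ks (snd (snd p)) then ks else 0 # ks) (fst (snd p)) [0, 0])"
    by (rule polytime_foldr[where ex = enc_nat and b = "[:1:]" and Inv = "\<lambda>_ _. True"])
      (rule polytime_if polytime_accepts polytime_Cons polytime_const polytime_proj | simp add: enc_nat.simps)+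
  from polytime_comp[OF this polytime_pair[OF assms(1) polytime_pair[OF assms(2,3)]]]
  show ?thesis by (simp add: find_k_def)
qed

lemma size_enc_list_filter: "size (enc_list ex (filter P xs)) \<le> size (enc_list ex xs)"
  by (induction xs) auto

lemma size_enc_list_filter_neq:
  assumes "g \<in> set G"
  shows "size (enc_list ex (filter (\<lambda>h. h \<noteq> g) G)) + size (ex g) + 1 \<le> size (enc_list ex G)"
  using assms
proof (induction G)
  case (Cons h G)
  show ?case
  proof (cases "h = g")
    case True
    then show ?thesis using size_enc_list_filter[of ex "\<lambda>h. h \<noteq> g" G] by simp
  next
    case False
    then show ?thesis using Cons by auto
  qed
qed simp

lemma in_matches:
  "c \<in> set (matches es ss (L, G)) \<longleftrightarrow> (\<exists>l\<in>set L. \<exists>g\<in>set G. adjacent es l g \<and> marked ss g = [] \<and>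
     c = (filter (\<lambda>x. x \<noteq> l) L, filter (\<lambda>h. h \<noteq> g) G))"
  by (auto simp: matches_def split: if_splits)

lemma in_merges:
  "c \<in> set (merges es ss ks (L, G)) \<longleftrightarrow> (\<exists>l\<in>set L. \<exists>g\<in>set G. \<exists>g'\<in>set G. g \<noteq> g' \<and> adjacent es l g \<and> adjacent es l g' \<and>
     length (marked ss g) < length ks \<and> length (marked ss g') < length ks \<and>
     c = (filter (\<lambda>x. x \<noteq> l) L, (g @ g') # filter (\<lambda>h. h \<noteq> g \<and> h \<noteq> g') G))"
  by (auto simp: merges_def split: if_splits)

text \<open>Merging concatenates two groups and saves the list cell of one of them, so states never
  grow; this is the growth bound \<open>0\<close> in \<open>polytime_solve\<close>.\<close>

lemma size_move: "size (enc_state (move es ss ks st)) \<le> size (enc_state st)"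
proof -
  obtain L G where st: "st = (L, G)" by fastforce
  have match: "size (enc_state c) \<le> size (enc_state st)" if "c \<in> set (matches es ss st)" for c
    using that unfolding st in_matches
    by (auto intro!: add_mono size_enc_list_filter)
  have merge: "size (enc_state c) \<le> size (enc_state st)" if c0: "c \<in> set (merges es ss ks st)" for c
  proof -
    obtain l g g' where c: "g \<in> set G" "g' \<in> set G" "g \<noteq> g'"
      "c = (filter (\<lambda>x. x \<noteq> l) L, (g @ g') # filter (\<lambda>h. h \<noteq> g \<and> h \<noteq> g') G)"
      using c0 unfolding st in_merges by blast
    have eq: "filter (\<lambda>h. h \<noteq> g \<and> h \<noteq> g') G = filter (\<lambda>h. h \<noteq> g') (filter (\<lambda>h. h \<noteq> g) G)"
      unfolding filter_filter by (intro filter_cong) auto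
    have "size (enc_list enc_nats (filter (\<lambda>h. h \<noteq> g) G)) + size (enc_nats g) + 1 \<le> size (enc_list enc_nats G)"
      using c(1) by (rule size_enc_list_filter_neq)
    moreover have "size (enc_list enc_nats (filter (\<lambda>h. h \<noteq> g \<and> h \<noteq> g') G)) + size (enc_nats g') + 1
       \<le> size (enc_list enc_nats (filter (\<lambda>h. h \<noteq> g) G))"
      unfolding eq using c(2,3) by (intro size_enc_list_filter_neq) auto
    ultimately show ?thesis using size_enc_list_filter[of enc_nat "\<lambda>x. x \<noteq> l" L] by (simp add: st c(4))
  qed
  have "move es ss ks st \<in> insert st (set (matches es ss st) \<union> set (merges es ss ks st))"
    unfolding move_def
  proof (cases "filter (accepts es ss ks) (matches es ss st @ merges es ss ks st)")
    case (Cons c cs)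
    then have "c \<in> set (filter (accepts es ss ks) (matches es ss st @ merges es ss ks st))" by simp
    then show "(case filter (accepts es ss ks) (matches es ss st @ merges es ss ks st) of [] \<Rightarrow> st | c # cs \<Rightarrow> c)
      \<in> insert st (set (matches es ss st) \<union> set (merges es ss ks st))" using Cons by auto
  qed auto
  then show ?thesis using match merge by auto
qed

lemma polytime_solve:
  "polytime (enc_prod (enc_prod enc_nats enc_arcs) (enc_prod enc_nats enc_nats)) (enc_list enc_nats)
     (\<lambda>i. solve (fst (fst i)) (snd (fst i)) (fst (snd i)) (snd (snd i)))"
proof -
  let ?e = "enc_prod (enc_prod enc_nats enc_arcs) (enc_prod enc_nats enc_nats)"
  have init: "polytime ?e enc_state (\<lambda>i. initial (fst (fst i)) (snd (snd i)))"
    unfolding initial_def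
    by (rule polytime_pair polytime_filter polytime_not polytime_nat_mem polytime_map polytime_Cons polytime_const polytime_proj)+
  have ks: "polytime ?e enc_nats (\<lambda>i. find_k (snd (fst i)) (fst (snd i)) (initial (fst (fst i)) (snd (snd i))))"
    by (rule polytime_find_k init polytime_proj)+
  have "polytime ?e enc_state (\<lambda>i. foldr (\<lambda>_. move (snd (fst i)) (fst (snd i))
    (find_k (snd (fst i)) (fst (snd i)) (initial (fst (fst i)) (snd (snd i))))) (fst (fst i))
     (initial (fst (fst i)) (snd (snd i))))"
  proof (rule polytime_foldr[where ex = enc_nat and b = 0 and Inv = "\<lambda>_ _. True"])
    \<comment> \<open>The value of \<open>find_k\<close> is recomputed in each round, because the
      loop body sees only the original input and the current state.\<close>
    show "polytime (enc_prod ?e (enc_prod enc_nat enc_state)) enc_state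
      (\<lambda>p. move (snd (fst (fst p))) (fst (snd (fst p)))
       (find_k (snd (fst (fst p))) (fst (snd (fst p))) (initial (fst (fst (fst p))) (snd (snd (fst p)))))
        (snd (snd p)))"
      by (rule polytime_move polytime_comp[OF ks polytime_fst[OF polytime_id]] polytime_proj)+
  qed (rule init polytime_proj TrueI | simp add: size_move del: size_enc_prod)+
  note loop = polytime_snd[OF this]
  show ?thesis unfolding solve_def
    by (rule polytime_filter polytime_map loop polytime_not polytime_null polytime_marked polytime_proj)+
qed

section \<open>Correctness\<close>

definition capacity :: "nat list \<Rightarrow> nat \<Rightarrow> nat list \<Rightarrow> nat" where
  "capacity ss k g = k - length (marked ss g)"

lemma count_concat_replicate:
  "distinct xs \<Longrightarrow> count (mset (concat (map (\<lambda>x. map (\<lambda>_. x) (f x)) xs))) x = (if x \<in> set xs then length (f x) else 0)"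
proof (induction xs)
  case (Cons y ys)
  have "count (mset (map (\<lambda>_. y) zs)) x = (if x = y then length zs else 0)" for zs :: "'b list"
    by (induction zs) auto
  then show ?case using Cons by auto
qed simp

text \<open>\<open>units\<close> holds each left vertex \<open>k\<close> times and
  \<open>slots_of\<close> each group as often as its capacity, so soundness and completeness of the
  auction apply.\<close>

lemma accepts_iff:
  assumes "distinct L" "distinct G"
  shows "accepts es ss ks (L, G) \<longleftrightarrow> feasible (adjacent es) (capacity ss (length ks)) (length ks) (set L) (set G)"
proof -
  have U: "count (mset (units ks L)) l = (if l \<in> set L then length ks else 0)" for l
    unfolding units_def using count_concat_replicate[OF assms(1), of "\<lambda>_. ks"] by simp
  have m: "map fst (slots_of ss ks G) = concat (map (\<lambda>g. map (\<lambda>_. g) (drop (length (marked ss g)) ks)) G)"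
    by (simp add: slots_of_def map_concat comp_def)
  have W: "count (mset (map fst (slots_of ss ks G))) g = capacity ss (length ks) g" if "g \<in> set G" for g
    unfolding m using count_concat_replicate[OF assms(2), of "\<lambda>g. drop (length (marked ss g)) ks"] that
    by (simp add: capacity_def)
  have e: "snd s = []" if "s \<in> set (slots_of ss ks G)" for s using that by (auto simp: slots_of_def)
  have sub: "fst ` set (slots_of ss ks G) \<subseteq> set G" by (auto simp: slots_of_def)
  show ?thesis unfolding accepts_def
  proof
    assume "fst (auction (adjacent es) (units ks (fst (L, G))) (slots_of ss ks (snd (L, G)))) = []"
    then show "feasible (adjacent es) (capacity ss (length ks)) (length ks) (set L) (set G)"
      using U W e sub by (intro auction_sound[of "set L" "set G" "units ks L" _ "slots_of ss ks G"]) auto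
  next
    assume "feasible (adjacent es) (capacity ss (length ks)) (length ks) (set L) (set G)"
    then show "fst (auction (adjacent es) (units ks (fst (L, G))) (slots_of ss ks (snd (L, G)))) = []"
      using auction_complete[of "set L" "set G" "units ks L" "length ks" "slots_of ss ks G" "capacity ss (length ks)" "adjacent es"]
       U W e by simp
  qed
qed

lemma set_marked: "set (marked ss g) = set g \<inter> set ss"
  by (auto simp: marked_def)

lemma adjacent_singleton: "adjacent es l [v] \<longleftrightarrow> l = v \<or> (l, v) \<in> set es"
  by (auto simp: adjacent_def)

text \<open>Putting \<open>v\<close> into the forbidden set reserves it, and \<open>l\<close> then
  takes it as its image.\<close>

lemma escape_insert:
  assumes "escape D A (insert v Y) f" "v \<in> pverts D" "v \<notin> Y" "l = v \<or> (l, v) \<in> parcs D" "l \<notin> A"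
  shows "escape D (insert l A) Y (f(l := v))"
  using assms unfolding escape_def by (auto simp: inj_on_def)

text \<open>The weight counts how many of the \<open>k\<close> injections send \<open>l\<close> to
  the vertex. Each injection adds at most one to a column, and at least one of them avoids a given
  element of \<open>S\<close>. The sets \<open>A i\<close> may repeat or overlap, which
  \<open>feasible_of_colorable\<close> uses.\<close>

lemma feasible_of_escapes:
  assumes D: "set es = parcs D" "set vs = pverts D" and vs: "distinct vs"
    and L: "L \<subseteq> pverts D"
    and esc: "\<And>i. i < k \<Longrightarrow> escape D L (A i) (\<phi> i)"
    and S: "\<And>s. s \<in> set ss \<Longrightarrow> \<exists>i<k. s \<in> A i"
  shows "feasible (adjacent es) (capacity ss k) k L (set (map (\<lambda>v. [v]) vs))"
proof -
  let ?V = "pverts D" and ?G = "set (map (\<lambda>v. [v]) vs)"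
  have finV: "finite ?V" using D(2) by (metis List.finite_set)
  have finL: "finite L" using finite_subset[OF L finV] .
  define x where "x l g = (\<Sum>i<k. if \<phi> i l = hd g then 1 else 0 :: real)" for l and g :: "nat list"
  have G: "?G = (\<lambda>v. [v]) ` ?V" using D by auto
  have sumG: "(\<Sum>g\<in>?G. f g) = (\<Sum>v\<in>?V. f [v])" for f :: "nat list \<Rightarrow> real"
    unfolding G by (subst sum.reindex) (auto simp: inj_on_def)
  have "fractional_matching (adjacent es) (capacity ss k) k L ?G x" unfolding fractional_matching_def
  proof (intro conjI ballI impI)
    fix l g assume lg: "l \<in> L" "g \<in> ?G"
    show "0 \<le> x l g" unfolding x_def by (intro sum_nonneg) auto
    assume "x l g \<noteq> 0"
    then obtain i where "i \<in> {..<k}" "(if \<phi> i l = hd g then 1 else 0 :: real) \<noteq> 0"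
      unfolding x_def by (rule sum.not_neutral_contains_not_neutral)
    then have i: "i < k" "\<phi> i l = hd g" by (auto split: if_splits)
    obtain v where v: "g = [v]" using lg(2) by auto
    show "adjacent es l g" using esc[OF i(1)] lg(1) i(2) unfolding escape_def v adjacent_singleton D(1) by auto
  next
    fix l assume l: "l \<in> L"
    have "(\<Sum>v\<in>?V. x l [v]) = (\<Sum>i<k. \<Sum>v\<in>?V. if \<phi> i l = v then 1 else 0)"
      unfolding x_def by (subst sum.swap) simp
    also have "\<dots> = (\<Sum>i<k. 1)"
      using esc l finV by (intro sum.cong) (auto simp: escape_def)
    finally show "(\<Sum>g\<in>?G. x l g) = real k" unfolding sumG by simp
  next
    fix g assume "g \<in> ?G"
    then obtain v where v: "g = [v]" "v \<in> ?V" using D by auto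
    have one: "(\<Sum>l\<in>L. if \<phi> i l = v then 1 else 0 :: real) \<le> (if v \<in> A i then 0 else 1)" if i: "i < k" for i
    proof -
      have c: "(\<Sum>l\<in>L. if \<phi> i l = v then 1 else 0 :: real) = real (card {l \<in> L. \<phi> i l = v})"
        using finL by (simp add: sum.If_cases Int_def)
      show ?thesis
      proof (cases "v \<in> A i")
        case True
        then have "{l \<in> L. \<phi> i l = v} = {}" using esc[OF i] by (auto simp: escape_def)
        then show ?thesis using True unfolding c by (simp del: Collect_empty_eq)
      next
        case False
        have "card {l \<in> L. \<phi> i l = v} \<le> Suc 0"
          using esc[OF i] finL by (subst card_le_Suc0_iff_eq) (auto simp: escape_def inj_on_def)
        then show ?thesis using False unfolding c by simp
      qed
    qed
    have "(\<Sum>l\<in>L. x l g) = (\<Sum>i<k. \<Sum>l\<in>L. if \<phi> i l = v then 1 else 0)"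
      unfolding x_def v by (subst sum.swap) simp
    also have "\<dots> \<le> (\<Sum>i<k. if v \<in> A i then 0 else 1)" using one by (intro sum_mono) auto
    also have "\<dots> \<le> real (capacity ss k g)"
    proof (cases "v \<in> set ss")
      case True
      then obtain j where j: "j < k" "v \<in> A j" using S by blast
      have "(\<Sum>i<k. if v \<in> A i then 0 else 1 :: real) = (\<Sum>i\<in>{..<k} - {j}. if v \<in> A i then 0 else 1)"
        using j by (subst sum.remove[of _ j]) auto
      also have "\<dots> \<le> (\<Sum>i\<in>{..<k} - {j}. 1)" by (intro sum_mono) auto
      also have "\<dots> = real (k - 1)" using j by simp
      finally show ?thesis using True by (simp add: capacity_def marked_def v)
    next
      case False
      have "(\<Sum>i<k. if v \<in> A i then 0 else 1 :: real) \<le> (\<Sum>i<k. 1)" by (intro sum_mono) auto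
      then show ?thesis using False by (simp add: capacity_def marked_def v)
    qed
    finally show "(\<Sum>l\<in>L. x l g) \<le> real (capacity ss k g)" .
  qed
  then show ?thesis unfolding feasible_def by blast
qed

text \<open>The search covers only values up to \<open>length ss + 2\<close>, so a larger
  \<open>k\<close> is replaced by that number: it is enough to keep for each source one class that
  contains it.\<close>

lemma feasible_of_colorable:
  assumes D: "set es = parcs D" "set vs = pverts D" "distinct vs"
    and col: "colorable (gammoid D (set ss) Z) k" and k: "k \<ge> 2"
  obtains k' where "2 \<le> k'" "k' \<le> k" "k' \<le> length ss + 2"
    "feasible (adjacent es) (capacity ss k') k' (pverts D - Z) (set (map (\<lambda>v. [v]) vs))"
proof -
  obtain C where C: "(\<Union>i<k. C i) = set ss" "\<And>i. i < k \<Longrightarrow> linked D (C i) Z"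
    using col unfolding colorable_def coloring_def gammoid_def by auto
  define \<phi> where "\<phi> i = (SOME f. escape D (pverts D - Z) (C i) f)" for i
  have \<phi>: "escape D (pverts D - Z) (C i) (\<phi> i)" if "i < k" for i
    unfolding \<phi>_def using someI_ex[OF linked_imp_escape[OF C(2)[OF that]]] .
  show ?thesis
  proof (cases "k \<le> length ss + 2")
    case True
    have "feasible (adjacent es) (capacity ss k) k (pverts D - Z) (set (map (\<lambda>v. [v]) vs))"
      using C(1) by (intro feasible_of_escapes[OF D _ \<phi>]) auto
    then show ?thesis using that[of k] True k by simp
  next
    case False
    define c where "c s = (SOME i. i < k \<and> s \<in> C i)" for s
    have c: "c s < k \<and> s \<in> C (c s)" if s: "s \<in> set ss" for s
    proof -
      have "\<exists>i. i < k \<and> s \<in> C i" using s C(1) by blast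
      then show ?thesis unfolding c_def by (rule someI_ex)
    qed
    \<comment> \<open>Indices from \<open>length ss\<close> on have no source and receive class
      \<open>0\<close> as a filler.\<close>
    define d where "d i = (if i < length ss then c (ss ! i) else 0)" for i
    have d: "d i < k" for i using c[of "ss ! i"] k by (auto simp: d_def)
    let ?k = "length ss + 2"
    have "feasible (adjacent es) (capacity ss ?k) ?k (pverts D - Z) (set (map (\<lambda>v. [v]) vs))"
    proof (rule feasible_of_escapes[OF D, where A = "\<lambda>i. C (d i)" and \<phi> = "\<lambda>i. \<phi> (d i)"])
      fix s assume s: "s \<in> set ss"
      then obtain i where i: "i < length ss" "ss ! i = s" by (auto simp: in_set_conv_nth)
      then show "\<exists>i<?k. s \<in> C (d i)" using c[OF s] by (intro exI[of _ i]) (auto simp: d_def)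
    qed (use \<phi> d in auto)
    then show ?thesis using that[of ?k] False by simp
  qed
qed

text \<open>The search cannot grow past length \<open>k\<close>, where acceptance holds. If it never
  accepts earlier, it counts up to \<open>length ss + 2\<close>, which is then exactly
  \<open>k\<close>.\<close>

lemma find_k_correct:
  assumes acc: "\<And>ks. length ks = k \<Longrightarrow> accepts es ss ks st" and k: "2 \<le> k" "k \<le> length ss + 2"
  shows "accepts es ss (find_k es ss st) st \<and> 2 \<le> length (find_k es ss st) \<and> length (find_k es ss st) \<le> k"
proof -
  let ?f = "\<lambda>xs. foldr (\<lambda>_ ks. if accepts es ss ks st then ks else 0 # ks) xs [0, 0]"
  have "2 \<le> length (?f xs) \<and> length (?f xs) \<le> k \<and> (accepts es ss (?f xs) st \<or> length (?f xs) = length xs + 2)" for xs :: "nat list"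
  proof (induction xs)
    case (Cons x xs)
    show ?case
    proof (cases "accepts es ss (?f xs) st")
      case False
      then have "length (?f xs) \<noteq> k" using acc by blast
      then show ?thesis using False Cons by auto
    qed (use Cons in auto)
  qed (use k in auto)
  from this[of ss] have *: "2 \<le> length (?f ss)" "length (?f ss) \<le> k"
    "accepts es ss (?f ss) st \<or> length (?f ss) = length ss + 2" by auto
  have "accepts es ss (?f ss) st" using *(3) acc[of "?f ss"] *(2) k(2) by linarith
  with * show ?thesis unfolding find_k_def by simp
qed

section \<open>The invariant of the main loop\<close>

text \<open>In the last clause, the left vertices removed so far can be moved clear of any
  transversal of the groups. It is trivial at the start, when nothing has been removed, and for
  empty \<open>L\<close> it gives linkings by \<open>escape_imp_linked\<close>.\<close>

definition sound_state :: "nat pair_pre_digraph \<Rightarrow> nat set \<Rightarrow> (nat \<times> nat) list \<Rightarrow> nat list \<Rightarrow> nat \<Rightarrow> state \<Rightarrow> bool" where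
  "sound_state D Z es ss k st \<longleftrightarrow> (case st of (L, G) \<Rightarrow>
     distinct L \<and> set L \<subseteq> pverts D - Z \<and> distinct G \<and>
     (\<forall>g\<in>set G. g \<noteq> [] \<and> distinct g \<and> set g \<subseteq> pverts D \<and> length (marked ss g) \<le> 2 * k - 2) \<and>
     (\<forall>g\<in>set G. \<forall>h\<in>set G. g \<noteq> h \<longrightarrow> set g \<inter> set h = {}) \<and>
     set ss \<subseteq> (\<Union>g\<in>set G. set g) \<and>
     feasible (adjacent es) (capacity ss k) k (set L) (set G) \<and>
     (\<forall>Y \<subseteq> (\<Union>g\<in>set G. set g). (\<forall>g\<in>set G. card (Y \<inter> set g) \<le> 1) \<longrightarrow>
        (\<exists>f. escape D (pverts D - Z - set L) Y f)))"

text \<open>Choose \<open>v\<close> in \<open>g\<close> adjacent to \<open>l\<close>. As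
  \<open>Y\<close> misses \<open>g\<close>, adding \<open>v\<close> to \<open>Y\<close> leaves a
  transversal, so the removed vertices can avoid \<open>v\<close> as well, which is then free for
  \<open>l\<close>.\<close>

lemma escape_extend:
  assumes I: "sound_state D Z es ss k (L, G)" and es: "set es = parcs D" and l: "l \<in> set L" and g: "g \<in> set G"
    and adj: "adjacent es l g" and Y: "Y \<subseteq> (\<Union>g\<in>set G. set g)" "\<And>h. h \<in> set G \<Longrightarrow> card (Y \<inter> set h) \<le> 1"
    "Y \<inter> set g = {}"
  shows "\<exists>f. escape D (pverts D - Z - (set L - {l})) Y f"
proof -
  obtain v where v: "v \<in> set g" "l = v \<or> (l, v) \<in> parcs D" using adj es unfolding adjacent_def by auto
  have disj: "\<And>h. h \<in> set G \<Longrightarrow> h \<noteq> g \<Longrightarrow> set h \<inter> set g = {}"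
    and gV: "set g \<subseteq> pverts D" and LV: "set L \<subseteq> pverts D - Z"
    using I g unfolding sound_state_def by auto
  have "card (insert v Y \<inter> set h) \<le> 1" if h: "h \<in> set G" for h
  proof (cases "h = g")
    case True
    then have "insert v Y \<inter> set h = {v}" using v Y(3) by auto
    then show ?thesis by simp
  next
    case False
    then have "insert v Y \<inter> set h = Y \<inter> set h" using v(1) disj[OF h] by auto
    then show ?thesis using Y(2)[OF h] by simp
  qed
  moreover have "insert v Y \<subseteq> (\<Union>g\<in>set G. set g)" using v g Y(1) by auto
  moreover have "\<exists>f. escape D (pverts D - Z - set L) Y f"
    if "Y \<subseteq> (\<Union>g\<in>set G. set g)" "\<And>g. g \<in> set G \<Longrightarrow> card (Y \<inter> set g) \<le> 1" for Y
    using I that unfolding sound_state_def by simp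
  ultimately obtain f where f: "escape D (pverts D - Z - set L) (insert v Y) f" by blast
  have "escape D (insert l (pverts D - Z - set L)) Y (f(l := v))"
    using v gV Y(3) l by (intro escape_insert[OF f]) auto
  moreover have "insert l (pverts D - Z - set L) = pverts D - Z - (set L - {l})" using l LV by auto
  ultimately show ?thesis by auto
qed

text \<open>The group \<open>g\<close> holds no element of \<open>S\<close>, so discarding it leaves
  \<open>S\<close> covered; every transversal of the remaining groups misses \<open>g\<close>, and
  \<open>escape_extend\<close> applies.\<close>

lemma sound_state_match:
  assumes I: "sound_state D Z es ss k (L, G)" and es: "set es = parcs D"
    and lg: "l \<in> set L" "g \<in> set G" "adjacent es l g" "marked ss g = []"
    and feas: "feasible (adjacent es) (capacity ss k) k (set L - {l}) (set G - {g})"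
  shows "sound_state D Z es ss k (filter (\<lambda>x. x \<noteq> l) L, filter (\<lambda>h. h \<noteq> g) G)"
proof -
  have sets: "set (filter (\<lambda>x. x \<noteq> l) L) = set L - {l}" "set (filter (\<lambda>h. h \<noteq> g) G) = set G - {g}" by auto
  have disj: "\<And>h. h \<in> set G \<Longrightarrow> h \<noteq> g \<Longrightarrow> set h \<inter> set g = {}"
    and ss: "set ss \<subseteq> (\<Union>g\<in>set G. set g)"
    using I lg(2) unfolding sound_state_def by auto
  have "set ss \<inter> set g = {}" using lg(4) set_marked[of ss g] by auto
  then have ss': "set ss \<subseteq> (\<Union>h\<in>set G - {g}. set h)" using ss by auto
  have "\<exists>f. escape D (pverts D - Z - (set L - {l})) Y f"
    if Y: "Y \<subseteq> (\<Union>h\<in>set G - {g}. set h)" "\<forall>h\<in>set G - {g}. card (Y \<inter> set h) \<le> 1" for Y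
  proof -
    have Yg: "Y \<inter> set g = {}" using Y(1) disj by blast
    have "card (Y \<inter> set h) \<le> 1" if "h \<in> set G" for h using Y(2) Yg that by (cases "h = g") auto
    then show ?thesis using Y(1) Yg by (intro escape_extend[OF I es lg(1-3)]) auto
  qed
  then show ?thesis using I feas ss' unfolding sound_state_def prod.case sets by auto
qed

text \<open>A transversal meets the merged group at most once, so it misses \<open>g\<close> or
  \<open>g'\<close>, and \<open>l\<close> escapes into the one that is missed.\<close>

lemma sound_state_merge:
  assumes I: "sound_state D Z es ss k (L, G)" and es: "set es = parcs D"
    and l: "l \<in> set L" and g: "g \<in> set G" "g' \<in> set G" "g \<noteq> g'" "adjacent es l g" "adjacent es l g'"
    and w: "length (marked ss g) < k" "length (marked ss g') < k"
    and feas: "feasible (adjacent es) (capacity ss k) k (set L - {l}) (insert (g @ g') (set G - {g, g'}))"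
  shows "sound_state D Z es ss k (filter (\<lambda>x. x \<noteq> l) L, (g @ g') # filter (\<lambda>h. h \<noteq> g \<and> h \<noteq> g') G)"
proof -
  have sets: "set (filter (\<lambda>x. x \<noteq> l) L) = set L - {l}"
    "set ((g @ g') # filter (\<lambda>h. h \<noteq> g \<and> h \<noteq> g') G) = insert (g @ g') (set G - {g, g'})" by auto
  have disj: "\<And>h h'. h \<in> set G \<Longrightarrow> h' \<in> set G \<Longrightarrow> h \<noteq> h' \<Longrightarrow> set h \<inter> set h' = {}"
    and ss: "set ss \<subseteq> (\<Union>g\<in>set G. set g)" and ne: "\<And>h. h \<in> set G \<Longrightarrow> h \<noteq> []"
    using I unfolding sound_state_def by auto
  have new: "g @ g' \<notin> set G"
  proof
    assume n: "g @ g' \<in> set G"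
    have "g @ g' \<noteq> g" using ne[OF g(2)] by simp
    from disj[OF n g(1) this] ne[OF g(1)] show False by simp
  qed
  have un: "(\<Union>h\<in>insert (g @ g') (set G - {g, g'}). set h) = (\<Union>h\<in>set G. set h)" using g by auto
  have esc: "\<exists>f. escape D (pverts D - Z - (set L - {l})) Y f"
    if Y: "Y \<subseteq> (\<Union>h\<in>set G. set h)" "\<forall>h\<in>insert (g @ g') (set G - {g, g'}). card (Y \<inter> set h) \<le> 1" for Y
  proof -
    have c: "card (Y \<inter> (set g \<union> set g')) \<le> 1" using Y(2) by simp
    have "card (Y \<inter> set g) \<le> 1" "card (Y \<inter> set g') \<le> 1"
      using c by (auto intro!: order.trans[OF card_mono c] simp del: One_nat_def)
    then have cs: "card (Y \<inter> set h) \<le> 1" if "h \<in> set G" for h using Y(2) that by (cases "h = g \<or> h = g'") auto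
    have "Y \<inter> set g = {} \<or> Y \<inter> set g' = {}"
    proof (rule ccontr)
      assume "\<not> ?thesis"
      then obtain a b where ab: "a \<in> Y \<inter> set g" "b \<in> Y \<inter> set g'" by blast
      then have "a \<noteq> b" using disj[OF g(1,2,3)] by auto
      moreover have "a = b" using c ab card_le_Suc0_iff_eq[of "Y \<inter> (set g \<union> set g')"] by auto
      ultimately show False by simp
    qed
    then show ?thesis
      using escape_extend[OF I es l g(1,4) Y(1) cs] escape_extend[OF I es l g(2,5) Y(1) cs] by blast
  qed
  have "length (marked ss (g @ g')) \<le> 2 * k - 2" using w by (simp add: marked_def)
  moreover have "distinct (g @ g')" "set (g @ g') \<subseteq> pverts D"
    using I g disj[OF g(1-3)] unfolding sound_state_def by auto
  moreover have "set (g @ g') \<inter> set h = {}" if "h \<in> set G - {g, g'}" for h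
    using disj[of g h] disj[of g' h] g that by auto
  ultimately show "sound_state D Z es ss k (filter (\<lambda>x. x \<noteq> l) L, (g @ g') # filter (\<lambda>h. h \<noteq> g \<and> h \<noteq> g') G)"
    using I feas new ss esc ne[OF g(1)] unfolding sound_state_def prod.case sets un by auto
qed

text \<open>An accepted candidate keeps the invariant. If none were accepted while \<open>L\<close>
  is nonempty, \<open>feasible_step\<close> would yield one that passes the test by
  \<open>accepts_iff\<close>.\<close>

lemma sound_state_move:
  assumes I: "sound_state D Z es ss (length ks) st" and es: "set es = parcs D" and k: "length ks > 0"
  shows "sound_state D Z es ss (length ks) (move es ss ks st) \<and>
    length (fst (move es ss ks st)) \<le> length (fst st) - 1"
proof -
  obtain L G where st: "st = (L, G)" by fastforce
  let ?k = "length ks"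
  let ?feas = "feasible (adjacent es) (capacity ss ?k) ?k"
  have dist: "distinct L" "distinct G" and feas: "?feas (set L) (set G)" using I st unfolding sound_state_def by auto
  have setL: "set (filter (\<lambda>x. x \<noteq> l) L) = set L - {l}" for l by auto
  have shorter: "length (filter (\<lambda>x. x \<noteq> l) L) < length L" if "l \<in> set L" for l
    using that by (simp add: length_filter_less)
  have good: "sound_state D Z es ss ?k c \<and> length (fst c) < length (fst st)"
    if c: "c \<in> set (matches es ss st @ merges es ss ks st)" "accepts es ss ks c" for c
  proof -
    consider (match) "c \<in> set (matches es ss st)" | (merge) "c \<in> set (merges es ss ks st)" using c(1) by auto
    then show ?thesis
    proof cases
      case match
      then obtain l g where lg: "l \<in> set L" "g \<in> set G" "adjacent es l g" "marked ss g = []"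
        and ceq: "c = (filter (\<lambda>x. x \<noteq> l) L, filter (\<lambda>h. h \<noteq> g) G)" unfolding st in_matches by blast
      have setG: "set (filter (\<lambda>h. h \<noteq> g) G) = set G - {g}" by auto
      have "?feas (set L - {l}) (set G - {g})"
        using c(2) dist unfolding ceq by (subst (asm) accepts_iff) (auto simp only: setL setG distinct_filter)
      from sound_state_match[OF I[unfolded st] es lg this] show ?thesis using shorter[OF lg(1)] by (simp add: ceq st)
    next
      case merge
      then obtain l g g' where l: "l \<in> set L" and g: "g \<in> set G" "g' \<in> set G" "g \<noteq> g'" "adjacent es l g" "adjacent es l g'"
        and w: "length (marked ss g) < ?k" "length (marked ss g') < ?k"
        and ceq: "c = (filter (\<lambda>x. x \<noteq> l) L, (g @ g') # filter (\<lambda>h. h \<noteq> g \<and> h \<noteq> g') G)"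
        unfolding st in_merges by blast
      have setG: "set ((g @ g') # filter (\<lambda>h. h \<noteq> g \<and> h \<noteq> g') G) = insert (g @ g') (set G - {g, g'})" by auto
      have ne: "g' \<noteq> []" "g \<noteq> []" and disj: "\<And>h. h \<in> set G \<Longrightarrow> h \<noteq> g \<Longrightarrow> set h \<inter> set g = {}"
        using I g(1,2) unfolding st sound_state_def by auto
      have "g @ g' \<notin> set G" using disj[of "g @ g'"] ne by auto
      then have "distinct ((g @ g') # filter (\<lambda>h. h \<noteq> g \<and> h \<noteq> g') G)" using dist by simp
      then have "?feas (set L - {l}) (insert (g @ g') (set G - {g, g'}))"
        using c(2) dist unfolding ceq by (subst (asm) accepts_iff) (simp_all only: setL setG distinct_filter)
      from sound_state_merge[OF I[unfolded st] es l g w this] show ?thesis using shorter[OF l] by (simp add: ceq st)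
    qed
  qed
  show ?thesis
  proof (cases "filter (accepts es ss ks) (matches es ss st @ merges es ss ks st)")
    case (Cons c cs)
    then have "c \<in> set (filter (accepts es ss ks) (matches es ss st @ merges es ss ks st))" by simp
    then have "sound_state D Z es ss ?k c \<and> length (fst c) < length (fst st)" using good[of c] by auto
    then show ?thesis unfolding move_def Cons by auto
  next
    case Nil
    have "L = []"
    proof (rule ccontr)
      assume "L \<noteq> []"
      then have L: "set L \<noteq> {}" by simp
      have none: "\<not> accepts es ss ks c" if "c \<in> set (matches es ss st @ merges es ss ks st)" for c
        using Nil that unfolding filter_empty_conv by blast
      have capk: "capacity ss ?k g \<le> ?k" for g by (simp add: capacity_def)
      from feasible_step[OF List.finite_set List.finite_set feas k L capk]
      show False
      proof (elim disjE bexE conjE)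
        fix l g assume lg: "l \<in> set L" "g \<in> set G" "adjacent es l g" "capacity ss ?k g = ?k" "?feas (set L - {l}) (set G - {g})"
        have "length (marked ss g) = 0" using lg(4) k unfolding capacity_def by linarith
        then have m: "marked ss g = []" by simp
        have setG: "set (filter (\<lambda>h. h \<noteq> g) G) = set G - {g}" by auto
        let ?c = "(filter (\<lambda>x. x \<noteq> l) L, filter (\<lambda>h. h \<noteq> g) G)"
        have "?c \<in> set (matches es ss st)" unfolding st in_matches using lg m by blast
        moreover have "accepts es ss ks ?c"
          using lg(5) dist by (subst accepts_iff) (simp_all only: setL setG distinct_filter)
        ultimately show False using none[of ?c] by auto
      next
        fix l g g' assume l: "l \<in> set L" and g: "g \<in> set G" "g' \<in> set G" "g \<noteq> g'" "adjacent es l g" "adjacent es l g'"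
          and cp: "0 < capacity ss ?k g" "0 < capacity ss ?k g'"
          and f: "\<forall>m. m \<notin> set G - {g, g'} \<longrightarrow> (\<forall>l. adjacent es l g \<or> adjacent es l g' \<longrightarrow> adjacent es l m) \<longrightarrow>
            capacity ss ?k g + capacity ss ?k g' \<le> capacity ss ?k m + ?k \<longrightarrow> ?feas (set L - {l}) (insert m (set G - {g, g'}))"
        have ne: "g' \<noteq> []" "g \<noteq> []" and disj: "\<And>h. h \<in> set G \<Longrightarrow> h \<noteq> g \<Longrightarrow> set h \<inter> set g = {}"
          using I g(1,2) unfolding st sound_state_def by auto
        have new: "g @ g' \<notin> set G" using disj[of "g @ g'"] ne by auto
        \<comment> \<open>If the two groups together hold more than \<open>k\<close> marked
          elements, the merged capacity is truncated to zero, which only helps the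
          inequality.\<close>
        have "capacity ss ?k g + capacity ss ?k g' \<le> capacity ss ?k (g @ g') + ?k" using cp by (simp add: capacity_def marked_def)
        moreover have "\<forall>l. adjacent es l g \<or> adjacent es l g' \<longrightarrow> adjacent es l (g @ g')" by (auto simp: adjacent_def)
        ultimately have f': "?feas (set L - {l}) (insert (g @ g') (set G - {g, g'}))"
          using f[THEN spec, of "g @ g'"] new by simp
        have setG: "set ((g @ g') # filter (\<lambda>h. h \<noteq> g \<and> h \<noteq> g') G) = insert (g @ g') (set G - {g, g'})" by auto
        have dG: "distinct ((g @ g') # filter (\<lambda>h. h \<noteq> g \<and> h \<noteq> g') G)" using dist new by simp
        let ?c = "(filter (\<lambda>x. x \<noteq> l) L, (g @ g') # filter (\<lambda>h. h \<noteq> g \<and> h \<noteq> g') G)"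
        have "length (marked ss g) < ?k" "length (marked ss g') < ?k" using cp by (auto simp: capacity_def)
        then have "?c \<in> set (merges es ss ks st)" unfolding st in_merges using l g by blast
        moreover have "accepts es ss ks ?c"
          using f' dist dG by (subst accepts_iff) (simp_all only: setL setG distinct_filter)
        ultimately show False using none[of ?c] by auto
      qed
    qed
    then show ?thesis using I unfolding move_def Nil by (simp add: st)
  qed
qed

section \<open>Correctness of the output and the final theorem\<close>

lemma solve_correct:
  assumes fin: "pair_fin_digraph D" and D: "set vs = pverts D" "set es = parcs D" "distinct vs"
    and S: "set ss \<subseteq> pverts D" "distinct ss" and Z: "set zs = Z" "Z \<subseteq> pverts D"
    and k: "k \<ge> 2" and col: "colorable (gammoid D (set ss) Z) k"
  shows "(\<forall>xs\<in>set (solve vs es ss zs). distinct xs) \<and> distinct (map set (solve vs es ss zs)) \<and>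
    partition_on (set ss) (set ` set (solve vs es ss zs)) \<and>
    (\<forall>X\<in>set ` set (solve vs es ss zs). card X \<le> 2 * k - 2) \<and>
    is_reduction (partition_matroid (set ss) (set ` set (solve vs es ss zs))) (gammoid D (set ss) Z)"
proof -
  define st0 where "st0 = initial vs zs"
  define ks where "ks = find_k es ss st0"
  have st0: "st0 = (filter (\<lambda>v. v \<notin> set zs) vs, map (\<lambda>v. [v]) vs)" by (simp add: st0_def initial_def)
  have L0: "set (filter (\<lambda>v. v \<notin> set zs) vs) = pverts D - Z" using D Z by auto
  have dist0: "distinct (filter (\<lambda>v. v \<notin> set zs) vs)" "distinct (map (\<lambda>v. [v]) vs)"
    using D(3) by (auto simp: distinct_map inj_on_def)
  obtain k' where k': "2 \<le> k'" "k' \<le> k" "k' \<le> length ss + 2"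
    and feas: "feasible (adjacent es) (capacity ss k') k' (pverts D - Z) (set (map (\<lambda>v. [v]) vs))"
    using feasible_of_colorable[OF D(2,1,3) col k] by blast
  have "accepts es ss js st0" if "length js = k'" for js
    unfolding st0 accepts_iff[OF dist0] L0 that by (rule feas)
  from find_k_correct[OF this k'(1,3)]
  have ks: "accepts es ss ks st0" "2 \<le> length ks" "length ks \<le> k" using k'(2) by (auto simp: ks_def)
  have feas0: "feasible (adjacent es) (capacity ss (length ks)) (length ks) (pverts D - Z) (set (map (\<lambda>v. [v]) vs))"
    using ks(1) unfolding st0 accepts_iff[OF dist0] L0 .
  \<comment> \<open>An initial singleton group may hold one element of \<open>S\<close>; starting
    the search at length \<open>2\<close> makes this admissible.\<close>
  have "1 \<le> 2 * length ks - 2" using ks(2) by linarith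
  then have "length (marked ss [v]) \<le> 2 * length ks - 2" for v by (auto simp: marked_def)
  moreover have "escape D {} Y id" for Y by (simp add: escape_def)
  ultimately have I0: "sound_state D Z es ss (length ks) st0"
    unfolding sound_state_def st0 prod.case L0 using dist0 feas0 S(1) D(1)
    by (auto intro!: exI[of _ id])
  have kpos: "length ks > 0" using ks(2) by linarith
  have iter: "sound_state D Z es ss (length ks) (foldr (\<lambda>_. move es ss ks) xs st0) \<and>
     length (fst (foldr (\<lambda>_. move es ss ks) xs st0)) \<le> length (fst st0) - length xs" for xs :: "nat list"
  proof (induction xs)
    case (Cons x xs)
    then show ?case using sound_state_move[OF _ D(2) kpos, of Z ss "foldr (\<lambda>_. move es ss ks) xs st0"]
      by auto
  qed (use I0 in simp)
  obtain L G where LG: "foldr (\<lambda>_. move es ss ks) vs st0 = (L, G)" by fastforce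
  have "length (fst st0) \<le> length vs" by (simp add: st0)
  then have L: "L = []" and I: "sound_state D Z es ss (length ks) ([], G)" using iter[of vs] LG by auto
  have distG: "distinct G" and G: "\<And>g. g \<in> set G \<Longrightarrow> distinct g \<and> length (marked ss g) \<le> 2 * length ks - 2"
    and disj: "\<And>g h. g \<in> set G \<Longrightarrow> h \<in> set G \<Longrightarrow> g \<noteq> h \<Longrightarrow> set g \<inter> set h = {}"
    and cover: "set ss \<subseteq> (\<Union>g\<in>set G. set g)"
    using I unfolding sound_state_def by auto
  have esc: "\<exists>f. escape D (pverts D - Z) Y f"
    if "Y \<subseteq> (\<Union>g\<in>set G. set g)" "\<And>g. g \<in> set G \<Longrightarrow> card (Y \<inter> set g) \<le> 1" for Y
    using I that unfolding sound_state_def by simp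
  define G' where "G' = filter (\<lambda>g. marked ss g \<noteq> []) G"
  have res: "solve vs es ss zs = map (marked ss) G'"
    unfolding solve_def st0_def[symmetric] ks_def[symmetric] LG G'_def by (simp add: filter_map comp_def)
  have G'G: "set G' \<subseteq> set G" and G'ne: "\<And>g. g \<in> set G' \<Longrightarrow> marked ss g \<noteq> []" by (auto simp: G'_def)
  have mdisj: "set (marked ss g) \<inter> set (marked ss h) = {}" if "g \<in> set G'" "h \<in> set G'" "g \<noteq> h" for g h
    using disj[of g h] that G'G by (auto simp: set_marked)
  have fam: "set ` set (solve vs es ss zs) = (\<lambda>g. set (marked ss g)) ` set G'" by (auto simp: res)
  have "\<forall>xs\<in>set (solve vs es ss zs). distinct xs" using G G'G by (auto simp: res marked_def)
  moreover have "distinct (map set (solve vs es ss zs))"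
  proof -
    have "inj_on (\<lambda>g. set (marked ss g)) (set G')"
    proof (rule inj_onI, rule ccontr)
      fix g h assume gh: "g \<in> set G'" "h \<in> set G'" "set (marked ss g) = set (marked ss h)" "g \<noteq> h"
      have "set (marked ss g) = {}" using mdisj[OF gh(1,2,4)] gh(3) by simp
      then show False using G'ne[OF gh(1)] by simp
    qed
    then show ?thesis using distG by (simp add: res distinct_map G'_def comp_def)
  qed
  moreover have "partition_on (set ss) (set ` set (solve vs es ss zs))"
    unfolding fam
  proof (rule partition_onI)
    show "\<Union> ((\<lambda>g. set (marked ss g)) ` set G') = set ss"
    proof
      show "set ss \<subseteq> \<Union> ((\<lambda>g. set (marked ss g)) ` set G')"
      proof
        fix s assume s: "s \<in> set ss"
        then obtain g where g: "g \<in> set G" "s \<in> set g" using cover by blast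
        then have "s \<in> set (marked ss g)" using s by (simp add: set_marked)
        moreover from this have "g \<in> set G'" using g by (auto simp: G'_def)
        ultimately show "s \<in> \<Union> ((\<lambda>g. set (marked ss g)) ` set G')" by blast
      qed
    qed (auto simp: set_marked)
  next
    fix p p' assume "p \<in> (\<lambda>g. set (marked ss g)) ` set G'" "p' \<in> (\<lambda>g. set (marked ss g)) ` set G'" "p \<noteq> p'"
    then obtain g h where "g \<in> set G'" "h \<in> set G'" "p = set (marked ss g)" "p' = set (marked ss h)" "g \<noteq> h"
      by blast
    then show "disjnt p p'" using mdisj[of g h] unfolding disjnt_def by simp
  next
    show "{} \<notin> (\<lambda>g. set (marked ss g)) ` set G'" using G'ne by auto
  qed
  moreover have "card X \<le> 2 * k - 2" if X: "X \<in> set ` set (solve vs es ss zs)" for X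
  proof -
    obtain g where g: "g \<in> set G" "X = set (marked ss g)" using X G'G unfolding fam by auto
    have "card X \<le> length (marked ss g)" unfolding g(2) by (rule card_length)
    also have "\<dots> \<le> 2 * length ks - 2" using G[OF g(1)] by simp
    also have "\<dots> \<le> 2 * k - 2" using ks(3) by simp
    finally show ?thesis .
  qed
  moreover have "linked D Y Z"
    if Y: "Y \<subseteq> set ss" "\<And>X. X \<in> set ` set (solve vs es ss zs) \<Longrightarrow> card (Y \<inter> X) \<le> 1" for Y
  proof -
    \<comment> \<open>As \<open>Y\<close> lies in \<open>S\<close>, it meets a group in the same
      points as the marked part of the group.\<close>
    have "card (Y \<inter> set g) \<le> 1" if g: "g \<in> set G" for g
    proof -
      have eq: "Y \<inter> set g = Y \<inter> set (marked ss g)" using Y(1) by (auto simp: set_marked)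
      show ?thesis
      proof (cases "marked ss g = []")
        case False
        then have "set (marked ss g) \<in> set ` set (solve vs es ss zs)" using g unfolding fam G'_def by auto
        then show ?thesis unfolding eq by (rule Y(2))
      qed (simp add: eq)
    qed
    then obtain f where "escape D (pverts D - Z) Y f" using esc[of Y] Y(1) cover by blast
    then show ?thesis using pair_fin_digraph.pair_finite_verts[OF fin] Y(1) S(1)
      by (intro escape_imp_linked) auto
  qed
  then have "is_reduction (partition_matroid (set ss) (set ` set (solve vs es ss zs))) (gammoid D (set ss) Z)"
    unfolding is_reduction_def partition_matroid_def gammoid_def by auto
  ultimately show ?thesis by blast
qed

text \<open>Number the elements of each part injectively below \<open>n\<close>; equal numbers form
  a colour class, which meets each part at most once.\<close>

lemma colorable_partition_matroid:
  assumes "finite S" and P: "partition_on S \<X>" and card: "\<And>X. X \<in> \<X> \<Longrightarrow> card X \<le> n"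
  shows "colorable (partition_matroid S \<X>) n"
proof -
  have XS: "X \<subseteq> S" "finite X" if "X \<in> \<X>" for X
    using P that finite_subset[OF _ assms(1)] unfolding partition_on_def by auto
  have "\<exists>f. inj_on f X \<and> f ` X \<subseteq> {..<n}" if X: "X \<in> \<X>" for X
  proof -
    obtain f where "bij_betw f X {0..<card X}" using ex_bij_betw_finite_nat[OF XS(2)[OF X]] by blast
    then show ?thesis using card[OF X] unfolding bij_betw_def by (intro exI[of _ f]) auto
  qed
  then obtain f where f: "\<And>X. X \<in> \<X> \<Longrightarrow> inj_on (f X) X \<and> f X ` X \<subseteq> {..<n}" by metis
  define part where "part s = (THE X. X \<in> \<X> \<and> s \<in> X)" for s
  have uniq: "\<exists>!X. X \<in> \<X> \<and> s \<in> X" if "s \<in> S" for s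
    using that P unfolding partition_on_def disjoint_def by auto
  have part: "part s \<in> \<X> \<and> s \<in> part s" if "s \<in> S" for s
    unfolding part_def by (rule theI'[OF uniq[OF that]])
  have part_eq: "part s = X" if "X \<in> \<X>" "s \<in> X" for s X
    using uniq[of s] part[of s] XS(1)[OF that(1)] that by blast
  define C where "C i = {s \<in> S. f (part s) s = i}" for i
  have "disjoint_family_on C {..<n}" by (auto simp: disjoint_family_on_def C_def)
  moreover have "(\<Union>i<n. C i) = S" using f part by (fastforce simp: C_def)
  moreover have "card (C i \<inter> X) \<le> 1" if X: "X \<in> \<X>" for i X
  proof -
    have "a = b" if "a \<in> C i \<inter> X" "b \<in> C i \<inter> X" for a b
      using that f[OF X] part_eq[OF X] by (auto simp: C_def inj_on_def)
    then show ?thesis using XS(2)[OF X] by (auto simp: card_le_Suc0_iff_eq)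
  qed
  ultimately show ?thesis
    unfolding colorable_def coloring_def partition_matroid_def
    by (intro exI[of _ C]) (auto simp: C_def)
qed

text \<open>Bounds the encodings of \<open>S\<close> and \<open>Z\<close> by that of the vertex
  list, so that the running time is bounded in terms of the digraph alone.\<close>

lemma size_enc_list_subset:
  assumes "distinct xs" "distinct ys" "set xs \<subseteq> set ys"
  shows "size (enc_list ex xs) \<le> size (enc_list ex ys)"
proof -
  have *: "size (enc_list ex zs) = (\<Sum>x\<in>set zs. size (ex x) + 1)" if "distinct zs" for zs
    using that by (induction zs) auto
  show ?thesis unfolding *[OF assms(1)] *[OF assms(2)] using assms(3) by (intro sum_mono2) auto
qed

text \<open>The program and the polynomial are chosen before \<open>k\<close>, which is not given to
  the program. For \<open>k = 1\<close> the bound \<open>2 * k - 2\<close> is \<open>0\<close>,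
  which no partition of a nonempty \<open>S\<close> meets; hence \<open>k \<ge> 2\<close>.\<close>

theorem theorem2:
  shows "\<exists>(P :: program) (q :: nat poly).
    \<forall>(D :: nat pair_pre_digraph) (S :: nat set) (Z :: nat set) (k :: nat) d s z.
      pair_fin_digraph D \<longrightarrow> S \<subseteq> pverts D \<longrightarrow> Z \<subseteq> pverts D \<longrightarrow>
      k \<ge> 2 \<longrightarrow> colorable (gammoid D S Z) k \<longrightarrow>
      represents_digraph d D \<longrightarrow> represents_set s S \<longrightarrow> represents_set z Z \<longrightarrow>
      (\<exists>y t \<X>.
        computes_in P (Node d (Node s z)) y t \<and>
        t \<le> poly q (size d) \<and>
        represents_family y \<X> \<and>
        partition_on S \<X> \<and>
        colorable (partition_matroid S \<X>) (2 * k - 2) \<and>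
        (\<forall>X\<in>\<X>. card X \<le> 2 * k - 2) \<and>
        is_reduction (partition_matroid S \<X>) (gammoid D S Z))"
proof -
  let ?e = "enc_prod (enc_prod enc_nats enc_arcs) (enc_prod enc_nats enc_nats)"
  obtain P p where P: "\<And>i. \<exists>t. runs P 0 (?e i) (enc_list enc_nats (solve (fst (fst i)) (snd (fst i)) (fst (snd i)) (snd (snd i)))) t
      \<and> t \<le> poly p (size (?e i))"
    by (rule polytimeE[OF polytime_solve], rule that)
  \<comment> \<open>The input consists of three encodings of size at most \<open>size d\<close> and
    two further \<open>Node\<close> cells; the added \<open>2\<close> pays for the outer
    call.\<close>
  define q where "q = pcompose p [:2, 3:] + [:2:]"
  show ?thesis
  proof (rule exI[of _ P], rule exI[of _ q], intro allI impI)
    fix D :: "nat pair_pre_digraph" and S Z k d s z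
    assume fin: "pair_fin_digraph D" and S: "S \<subseteq> pverts D" and Z: "Z \<subseteq> pverts D" and k: "2 \<le> k"
      and col: "colorable (gammoid D S Z) k"
      and reps: "represents_digraph d D" "represents_set s S" "represents_set z Z"
    obtain vs es where d: "distinct vs" "set vs = pverts D" "distinct es" "set es = parcs D" "d = enc_digraph vs es"
      using reps(1) unfolding represents_digraph_def lists_set_def by auto
    obtain ss where ss: "distinct ss" "set ss = S" "s = enc_nats ss"
      using reps(2) unfolding represents_set_def lists_set_def by auto
    obtain zs where zs: "distinct zs" "set zs = Z" "z = enc_nats zs"
      using reps(3) unfolding represents_set_def lists_set_def by auto
    have arc: "enc_arc = enc_prod enc_nat enc_nat" by (auto simp: enc_arc_def enc_prod_def)
    have inp: "Node d (Node s z) = ?e ((vs, es), (ss, zs))"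
      by (simp add: d(5) enc_digraph_def ss(3) zs(3) enc_prod_def[abs_def] arc)
    define r where "r = solve vs es ss zs"
    obtain t where t: "runs P 0 (Node d (Node s z)) (enc_list enc_nats r) t" "t \<le> poly p (size (Node d (Node s z)))"
      using P[of "((vs, es), (ss, zs))"] unfolding inp r_def by auto
    have "size s \<le> size (enc_nats vs)" "size z \<le> size (enc_nats vs)"
      unfolding ss(3) zs(3) using d ss zs S Z by (auto intro!: size_enc_list_subset)
    moreover have "size (enc_nats vs) \<le> size d" by (simp add: d(5) enc_digraph_def)
    ultimately have "size (Node d (Node s z)) \<le> 2 + 3 * size d" by simp
    then have "poly p (size (Node d (Node s z))) \<le> poly p (2 + 3 * size d)" by (rule poly_nat_mono)
    then have tq: "1 + t + 1 \<le> poly q (size d)" using t(2) by (simp add: q_def poly_pcompose mult.commute)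
    have comp: "computes_in P (Node d (Node s z)) (enc_list enc_nats r) (1 + t + 1)"
      unfolding computes_in_def by (rule runs_call[OF eval_Var0 t(1)])
    have "(\<forall>xs\<in>set r. distinct xs) \<and> distinct (map set r) \<and> partition_on S (set ` set r) \<and>
      (\<forall>X\<in>set ` set r. card X \<le> 2 * k - 2) \<and>
      is_reduction (partition_matroid S (set ` set r)) (gammoid D S Z)"
      using solve_correct[OF fin d(2,4,1) _ ss(1) zs(2) Z k] S col unfolding r_def ss(2) by auto
    then have r: "\<forall>xs\<in>set r. distinct xs" "distinct (map set r)" "partition_on S (set ` set r)"
      "\<forall>X\<in>set ` set r. card X \<le> 2 * k - 2"
      "is_reduction (partition_matroid S (set ` set r)) (gammoid D S Z)" by auto
    have "represents_family (enc_list enc_nats r) (set ` set r)"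
      unfolding represents_family_def lists_set_def using r(1,2) by (intro exI[of _ r]) auto
    moreover have "colorable (partition_matroid S (set ` set r)) (2 * k - 2)"
      using r(3,4) ss(2) by (intro colorable_partition_matroid) auto
    ultimately show "\<exists>y t \<X>. computes_in P (Node d (Node s z)) y t \<and> t \<le> poly q (size d) \<and>
        represents_family y \<X> \<and> partition_on S \<X> \<and>
        colorable (partition_matroid S \<X>) (2 * k - 2) \<and> (\<forall>X\<in>\<X>. card X \<le> 2 * k - 2) \<and>
        is_reduction (partition_matroid S \<X>) (gammoid D S Z)"
      using comp tq r(3-5) by blast
  qed
qed

end
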